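(* \textsc{Harmless Set} is W[1]-hard when parametrised by the size of a modulator to a $2$-spider-forest, i.e. by the minimum size of a vertex set $M\subseteq V(G)$ such that $G-M$ is a $2$-spider-forest.
   Context: \textsc{Harmless Set}: given a graph $G$, a threshold function $t\colon V(G)\to\mathbb{N}_{>0}$ and an integer $k$, decide whether there is a set $S\subseteq V(G)$ with $|S|\ge k$ such that every vertex $v\in V(G)$ has fewer than $t(v)$ neighbours in $S$. A $2$-spider is a graph obtained from a star by subdividing every edge at most once; a $2$-spider-forest is a disjoint union of arbitrarily many $2$-spiders. *)

theory Defs
  imports Main
begin

section \<open>Machine model\<close>

text \<open>
  Instances are binary trees (the S-expressions of Jones' WHILE language); strings are the special
  case of lists over a finite set of atoms. Programs are point-free WHILE programs on trees.
  Every executed construct is charged the full size of the tree it is applied to, so doubling a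
  tree repeatedly is not cheap: the size of a result never exceeds the running time. With this cost
  measure, programs and multi-tape Turing machines simulate each other with polynomial overhead.
\<close>

datatype tree = Leaf | Node tree tree

fun tree_size :: "tree \<Rightarrow> nat" where
  "tree_size Leaf = 1"
| "tree_size (Node a b) = Suc (tree_size a + tree_size b)"

datatype prog =
    Ident
  | Const_Leaf
  | Left
  | Right
  | Seq prog prog
  | Fork prog prog
  | Cond prog prog prog
  | While prog prog

fun left :: "tree \<Rightarrow> tree" where
  "left Leaf = Leaf"
| "left (Node a b) = a"

fun right :: "tree \<Rightarrow> tree" where
  "right Leaf = Leaf"
| "right (Node a b) = b"

text \<open>\<open>run p x y t\<close>: program \<open>p\<close> halts on input \<open>x\<close> with output \<open>y\<close> after time \<open>t\<close>.
  In tests, \<open>Leaf\<close> means false and every other tree means true.\<close>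

inductive run :: "prog \<Rightarrow> tree \<Rightarrow> tree \<Rightarrow> nat \<Rightarrow> bool" where
  run_Ident: "run Ident x x (tree_size x)"
| run_Const_Leaf: "run Const_Leaf x Leaf (tree_size x)"
| run_Left: "run Left x (left x) (tree_size x)"
| run_Right: "run Right x (right x) (tree_size x)"
| run_Seq: "run p x y s \<Longrightarrow> run q y z t \<Longrightarrow> run (Seq p q) x z (tree_size x + s + t)"
| run_Fork: "run p x y s \<Longrightarrow> run q x z t \<Longrightarrow> run (Fork p q) x (Node y z) (tree_size x + s + t)"
| run_Cond_True: "run b x v s \<Longrightarrow> v \<noteq> Leaf \<Longrightarrow> run p x y t \<Longrightarrow>
    run (Cond b p q) x y (tree_size x + s + t)"
| run_Cond_False: "run b x Leaf s \<Longrightarrow> run q x y t \<Longrightarrow>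
    run (Cond b p q) x y (tree_size x + s + t)"
| run_While_Stop: "run b x Leaf s \<Longrightarrow> run (While b p) x x (tree_size x + s)"
| run_While_Step: "run b x v s \<Longrightarrow> v \<noteq> Leaf \<Longrightarrow> run p x y t \<Longrightarrow> run (While b p) y z u \<Longrightarrow>
    run (While b p) x z (tree_size x + s + t + u)"


section \<open>Encodings\<close>

text \<open>Numbers are written in unary.\<close>

fun enc_nat :: "nat \<Rightarrow> tree" where
  "enc_nat 0 = Leaf"
| "enc_nat (Suc n) = Node Leaf (enc_nat n)"

definition enc_int :: "int \<Rightarrow> tree" where
  "enc_int k = Node (enc_nat (if k < 0 then 1 else 0)) (enc_nat (nat \<bar>k\<bar>))"

fun enc_list :: "('a \<Rightarrow> tree) \<Rightarrow> 'a list \<Rightarrow> tree" where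
  "enc_list e [] = Leaf"
| "enc_list e (x # xs) = Node (e x) (enc_list e xs)"

definition enc_pair :: "('a \<Rightarrow> tree) \<Rightarrow> ('b \<Rightarrow> tree) \<Rightarrow> 'a \<times> 'b \<Rightarrow> tree" where
  "enc_pair e e' = (\<lambda>(a, b). Node (e a) (e' b))"


section \<open>Parameterized problems and fpt-reductions\<close>

text \<open>A parameterized problem is a language together with the parameter of every input.\<close>

type_synonym param_problem = "tree set \<times> (tree \<Rightarrow> nat)"

definition computable_nat :: "(nat \<Rightarrow> nat) \<Rightarrow> bool" where
  "computable_nat f \<longleftrightarrow> (\<exists>p. \<forall>n. \<exists>t. run p (enc_nat n) (enc_nat (f n)) t)"

definition fpt_reducible :: "param_problem \<Rightarrow> param_problem \<Rightarrow> bool" (infix "\<le>\<^sub>f\<^sub>p\<^sub>t" 50) where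
  "P \<le>\<^sub>f\<^sub>p\<^sub>t Q \<longleftrightarrow>
    (\<exists>R p f c g. computable_nat f \<and> computable_nat g \<and>
      (\<forall>x. (\<exists>t. run p x (R x) t \<and> t \<le> f (snd P x) * tree_size x ^ c) \<and>
           (x \<in> fst P \<longleftrightarrow> R x \<in> fst Q) \<and>
           snd Q (R x) \<le> g (snd P x)))"

text \<open>The problem given by well-formed instances of an arbitrary type, an encoding that is injective
  on them, the yes-instances and the parameter. Trees that encode no well-formed instance are
  no-instances of parameter 0.\<close>

definition problem ::
  "('i \<Rightarrow> bool) \<Rightarrow> ('i \<Rightarrow> tree) \<Rightarrow> ('i \<Rightarrow> bool) \<Rightarrow> ('i \<Rightarrow> nat) \<Rightarrow> param_problem" where
  "problem valid enc yes par =
    (enc ` {i. valid i \<and> yes i},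
     \<lambda>x. if x \<in> enc ` {i. valid i} then par (the_inv_into {i. valid i} enc x) else 0)"


section \<open>Boolean circuits and the W-hierarchy\<close>

text \<open>A circuit is the list of its gates in a topological order, the last one being the output gate;
  gates refer to their predecessors by position.\<close>

datatype gate = Input | Neg nat | Conj "nat list" | Disj "nat list"

fun preds :: "gate \<Rightarrow> nat list" where
  "preds Input = []"
| "preds (Neg j) = [j]"
| "preds (Conj js) = js"
| "preds (Disj js) = js"

fun proper_fanin :: "gate \<Rightarrow> bool" where
  "proper_fanin (Conj js) \<longleftrightarrow> length js \<ge> 2"
| "proper_fanin (Disj js) \<longleftrightarrow> length js \<ge> 2"
| "proper_fanin _ \<longleftrightarrow> True"

definition circuit :: "gate list \<Rightarrow> bool" where
  "circuit C \<longleftrightarrow> C \<noteq> [] \<and>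
    (\<forall>i < length C. (\<forall>j \<in> set (preds (C ! i)). j < i) \<and> distinct (preds (C ! i)) \<and>
       proper_fanin (C ! i))"

text \<open>Label the gates from left to right; \<open>h vs g\<close> is the label of gate \<open>g\<close> when \<open>vs\<close> are the labels
  of all gates before it. In particular \<open>length vs\<close> is the position of \<open>g\<close>.\<close>

definition output_label :: "('a list \<Rightarrow> gate \<Rightarrow> 'a) \<Rightarrow> gate list \<Rightarrow> 'a" where
  "output_label h C = last (foldl (\<lambda>vs g. vs @ [h vs g]) [] C)"

fun gate_value :: "nat set \<Rightarrow> bool list \<Rightarrow> gate \<Rightarrow> bool" where
  "gate_value A vs Input \<longleftrightarrow> length vs \<in> A"
| "gate_value A vs (Neg j) \<longleftrightarrow> \<not> vs ! j"
| "gate_value A vs (Conj js) \<longleftrightarrow> (\<forall>j \<in> set js. vs ! j)"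
| "gate_value A vs (Disj js) \<longleftrightarrow> (\<exists>j \<in> set js. vs ! j)"

text \<open>\<open>A\<close> is the set of positions of the input gates that are set to true.\<close>

definition satisfies :: "nat set \<Rightarrow> gate list \<Rightarrow> bool" where
  "satisfies A C \<longleftrightarrow> output_label (gate_value A) C"

definition inputs :: "gate list \<Rightarrow> nat set" where
  "inputs C = {i. i < length C \<and> C ! i = Input}"

text \<open>The depth is the maximum length of a path from an input gate to the output gate, the weft is
  the maximum number of large gates (fan-in greater than 2) on such a path.\<close>

definition gate_depth :: "nat list \<Rightarrow> gate \<Rightarrow> nat" where
  "gate_depth ds g = (if g = Input then 0 else Suc (Max ((!) ds ` set (preds g))))"

definition gate_weft :: "nat list \<Rightarrow> gate \<Rightarrow> nat" where
  "gate_weft ws g =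
    (if g = Input then 0
     else Max ((!) ws ` set (preds g)) + (if length (preds g) > 2 then 1 else 0))"

definition depth :: "gate list \<Rightarrow> nat" where
  "depth C = output_label gate_depth C"

definition weft :: "gate list \<Rightarrow> nat" where
  "weft C = output_label gate_weft C"

fun enc_gate :: "gate \<Rightarrow> tree" where
  "enc_gate Input = Node (enc_nat 0) Leaf"
| "enc_gate (Neg j) = Node (enc_nat 1) (enc_nat j)"
| "enc_gate (Conj js) = Node (enc_nat 2) (enc_list enc_nat js)"
| "enc_gate (Disj js) = Node (enc_nat 3) (enc_list enc_nat js)"

text \<open>Weighted circuit satisfiability for circuits of weft at most \<open>w\<close> and depth at most \<open>d\<close>:
  is there a satisfying assignment of weight exactly \<open>k\<close>? The parameter is \<open>k\<close>.\<close>

definition weighted_circuit_sat :: "nat \<Rightarrow> nat \<Rightarrow> param_problem" where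
  "weighted_circuit_sat w d =
    problem (\<lambda>(C, k). circuit C \<and> weft C \<le> w \<and> depth C \<le> d)
      (enc_pair (enc_list enc_gate) enc_nat)
      (\<lambda>(C, k). \<exists>A \<subseteq> inputs C. card A = k \<and> satisfies A C)
      (\<lambda>(C, k). k)"

definition W_class :: "nat \<Rightarrow> param_problem set" where
  "W_class w = {P. \<exists>d \<ge> 1. P \<le>\<^sub>f\<^sub>p\<^sub>t weighted_circuit_sat w d}"

definition W_hard :: "nat \<Rightarrow> param_problem \<Rightarrow> bool" where
  "W_hard w Q \<longleftrightarrow> (\<forall>P \<in> W_class w. P \<le>\<^sub>f\<^sub>p\<^sub>t Q)"


section \<open>Graphs and 2-spider-forests\<close>

type_synonym 'v graph = "'v set \<times> 'v set set"

abbreviation verts :: "'v graph \<Rightarrow> 'v set" where "verts \<equiv> fst"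
abbreviation edges :: "'v graph \<Rightarrow> 'v set set" where "edges \<equiv> snd"

definition simple_graph :: "'v graph \<Rightarrow> bool" where
  "simple_graph G \<longleftrightarrow> finite (verts G) \<and> (\<forall>e \<in> edges G. e \<subseteq> verts G \<and> card e = 2)"

definition neighbours :: "'v graph \<Rightarrow> 'v \<Rightarrow> 'v set" where
  "neighbours G v = {u \<in> verts G. {u, v} \<in> edges G}"

definition delete_verts :: "'v graph \<Rightarrow> 'v set \<Rightarrow> 'v graph" where
  "delete_verts G M = (verts G - M, {e \<in> edges G. e \<inter> M = {}})"

text \<open>Stars may have any number of leaves; a single vertex is a star.\<close>

definition star :: "'v graph \<Rightarrow> bool" where
  "star H \<longleftrightarrow>
    (\<exists>c L. finite L \<and> c \<notin> L \<and> verts H = insert c L \<and> edges H = (\<lambda>l. {c, l}) ` L)"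

text \<open>\<open>G\<close> arises from \<open>H\<close> by subdividing each edge in \<open>D\<close> exactly once; \<open>w e\<close> is the new vertex
  on \<open>e\<close>.\<close>

definition subdivided_at_most_once :: "'v graph \<Rightarrow> 'v graph \<Rightarrow> bool" where
  "subdivided_at_most_once H G \<longleftrightarrow>
    (\<exists>D w. D \<subseteq> edges H \<and> inj_on w D \<and> w ` D \<inter> verts H = {} \<and>
      verts G = verts H \<union> w ` D \<and>
      edges G = (edges H - D) \<union> {{u, w e} | u e. e \<in> D \<and> u \<in> e})"

definition two_spider :: "'v graph \<Rightarrow> bool" where
  "two_spider G \<longleftrightarrow> (\<exists>H. star H \<and> subdivided_at_most_once H G)"

definition two_spider_forest :: "'v graph \<Rightarrow> bool" where
  "two_spider_forest G \<longleftrightarrow>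
    (\<exists>F. (\<forall>H \<in> F. two_spider H) \<and> pairwise (\<lambda>H H'. verts H \<inter> verts H' = {}) F \<and>
      verts G = (\<Union>H \<in> F. verts H) \<and> edges G = (\<Union>H \<in> F. edges H))"

definition spider_modulator :: "'v graph \<Rightarrow> 'v set \<Rightarrow> bool" where
  "spider_modulator G M \<longleftrightarrow> M \<subseteq> verts G \<and> two_spider_forest (delete_verts G M)"

definition spider_modulator_size :: "'v graph \<Rightarrow> nat" where
  "spider_modulator_size G = (LEAST m. \<exists>M. spider_modulator G M \<and> card M = m)"

text \<open>The minimum is attained, since deleting all vertices leaves the empty disjoint union.\<close>

lemma spider_modulator_verts:
  assumes "simple_graph G"
  shows "spider_modulator G (verts G)"
proof -
  have "e \<inter> verts G \<noteq> {}" if "e \<in> edges G" for e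
  proof -
    have "e \<subseteq> verts G" "card e = 2"
      using that assms unfolding simple_graph_def by blast+
    then show ?thesis
      by (metis Int_absorb2 card.empty zero_neq_numeral)
  qed
  then have "delete_verts G (verts G) = ({}, {})"
    unfolding delete_verts_def by auto
  moreover have "two_spider_forest ({}, {})"
    unfolding two_spider_forest_def by (intro exI[of _ "{}"]) simp
  ultimately show ?thesis
    unfolding spider_modulator_def by simp
qed


section \<open>Harmless Set\<close>

definition harmless :: "'v graph \<Rightarrow> ('v \<Rightarrow> nat) \<Rightarrow> 'v set \<Rightarrow> bool" where
  "harmless G t S \<longleftrightarrow> S \<subseteq> verts G \<and> (\<forall>v \<in> verts G. card (neighbours G v \<inter> S) < t v)"

text \<open>Vertices are \<open>0, \<dots>, n - 1\<close>; the edges are given by a list of pairs of distinct vertices, and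
  the threshold of \<open>v\<close> is entry \<open>v\<close> of the threshold list.\<close>

datatype harmless_inst = Harmless_Inst
  (vertex_count: nat) (edge_list: "(nat \<times> nat) list") (thresholds: "nat list") (target: int)

definition graph_of :: "harmless_inst \<Rightarrow> nat graph" where
  "graph_of I = ({0..<vertex_count I}, (\<lambda>(u, v). {u, v}) ` set (edge_list I))"

definition wf_harmless_inst :: "harmless_inst \<Rightarrow> bool" where
  "wf_harmless_inst I \<longleftrightarrow>
    (\<forall>(u, v) \<in> set (edge_list I). u < vertex_count I \<and> v < vertex_count I \<and> u \<noteq> v) \<and>
    length (thresholds I) = vertex_count I \<and> (\<forall>a \<in> set (thresholds I). a > 0)"

lemma simple_graph_of: "wf_harmless_inst I \<Longrightarrow> simple_graph (graph_of I)"
  by (auto simp: wf_harmless_inst_def simple_graph_def graph_of_def)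

fun enc_harmless_inst :: "harmless_inst \<Rightarrow> tree" where
  "enc_harmless_inst (Harmless_Inst n es ts k) =
    Node (enc_nat n) (Node (enc_list (enc_pair enc_nat enc_nat) es)
      (Node (enc_list enc_nat ts) (enc_int k)))"

definition yes_harmless_inst :: "harmless_inst \<Rightarrow> bool" where
  "yes_harmless_inst I \<longleftrightarrow>
    (\<exists>S. harmless (graph_of I) ((!) (thresholds I)) S \<and> int (card S) \<ge> target I)"

definition harmless_set_by_spider_modulator :: param_problem where
  "harmless_set_by_spider_modulator =
    problem wf_harmless_inst enc_harmless_inst yes_harmless_inst
      (\<lambda>I. spider_modulator_size (graph_of I))"


section \<open>Injectivity of the encodings\<close>

lemma inj_enc_nat: "inj enc_nat"
proof (rule injI)
  show "enc_nat m = enc_nat n \<Longrightarrow> m = n" for m n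
    by (induction m arbitrary: n; case_tac n) auto
qed

lemma inj_enc_int: "inj enc_int"
  by (rule injI) (auto simp: enc_int_def inj_eq[OF inj_enc_nat] split: if_splits)

lemma inj_enc_list:
  assumes "inj e"
  shows "inj (enc_list e)"
proof (rule injI)
  show "enc_list e xs = enc_list e ys \<Longrightarrow> xs = ys" for xs ys
    using inj_eq[OF assms] by (induction xs arbitrary: ys; case_tac ys) auto
qed

lemma inj_enc_pair: "inj e \<Longrightarrow> inj e' \<Longrightarrow> inj (enc_pair e e')"
  by (auto simp: enc_pair_def inj_def)

lemma inj_enc_gate: "inj enc_gate"
proof (rule injI)
  show "enc_gate g = enc_gate h \<Longrightarrow> g = h" for g h
    by (cases g; cases h)
      (auto simp: inj_eq[OF inj_enc_nat] inj_eq[OF inj_enc_list[OF inj_enc_nat]] eval_nat_numeral)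
qed

lemma inj_enc_circuit_inst: "inj (enc_pair (enc_list enc_gate) enc_nat)"
  by (intro inj_enc_pair inj_enc_list inj_enc_gate inj_enc_nat)

lemma inj_enc_harmless_inst: "inj enc_harmless_inst"
proof (rule injI)
  show "enc_harmless_inst I = enc_harmless_inst J \<Longrightarrow> I = J" for I J
    by (cases I; cases J)
      (auto simp: inj_eq[OF inj_enc_nat] inj_eq[OF inj_enc_int]
        inj_eq[OF inj_enc_list[OF inj_enc_nat]]
        inj_eq[OF inj_enc_list[OF inj_enc_pair[OF inj_enc_nat inj_enc_nat]]])
qed

end

theory Submission
  imports Defs "HOL-Library.More_List"
begin

text \<open>
  A circuit of weft 1 and depth \<open>d\<close> is a bounded-size combination of large gates over functions of
  at most \<open>2 ^ d\<close> inputs. Guess \<open>2 ^ d\<close> claims about gate values that force the output to be true by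
  Kleene evaluation, restricting the guess to claims whose falsity is witnessed by the values of at
  most \<open>2 ^ d\<close> inputs (large gates may only be claimed to have the value that says something about
  all their predecessors). Represent a true set of \<open>k\<close> inputs by its increasing enumeration; the
  status of an input is then visible from two consecutive entries. So weighted satisfiability says
  that \<open>k + 3\<close> variables with polynomially many values can be chosen such that every tuple of a
  bounded number \<open>L\<close> of them, depending only on \<open>d\<close>, passes a local test.

  In the graph there is one fully subdivided star for every tuple of variables and every locally
  admissible choice of its values. All leaves have threshold 1 and all subdivision vertices have
  threshold 2, so of each star either the centre or some leaves are in a harmless set. Modulator
  vertices bound numbers of leaves: in a harmless set of the required size exactly one star per tuple
  loses its leaves to its centre, and comparing a number of legs coded in one tuple with the
  complementary number in another makes the choices consistent. The number of modulator vertices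
  depends on \<open>k\<close> and \<open>d\<close> only. As numbers are written in unary, everything is computed in polynomial
  time.
\<close>


section \<open>Polynomial-time computable functions\<close>

text \<open>W[1] is given by circuits of any constant depth, with negations anywhere, so the
  reduction itself has to find a local form for them. Guessing arbitrary gate values would not do:
  that a large conjunction is false, or a large disjunction true, is not refuted by few inputs. Such
  a value is certified by a claim about one predecessor instead; as a path contains at most one
  large gate, only gates of fan-in at most 2 lie below that predecessor.

  A refutation reads up to \<open>2 ^ d\<close> inputs, each input takes two consecutive positions,
  and one further variable holds the guess. Hence \<open>L = 2 * 2 ^ d + 1\<close>.

  With \<open>N\<close> stars of \<open>p\<close> legs and \<open>V\<close> tuples the required size
  is \<open>p * (N - V) + V\<close>. One modulator vertex per tuple sees all leaves of its stars and
  forces \<open>p\<close> of them out, so at least \<open>V\<close> centres are needed; every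
  further centre gains one vertex and costs \<open>p \<ge> 2\<close> leaves. A threshold only bounds
  a number from one side, so agreement of two values is obtained as two opposite
  inequalities.\<close>

lemma tree_size_pos: "tree_size x \<ge> 1"
  by (cases x) auto

text \<open>Each construct is charged for its input, projections do not enlarge it, and the root of
  a new pair is paid for by the charge of \<open>Fork\<close>. Intermediate results in a composition
  are therefore polynomial in the original input.\<close>

lemma run_output_size: "run p x y t \<Longrightarrow> tree_size y \<le> t"
proof (induction rule: run.induct)
  case (run_Left x) then show ?case by (cases x) auto
next
  case (run_Right x) then show ?case by (cases x) auto
next
  case (run_Fork p x y s q z t) then show ?case using tree_size_pos[of x] by simp
qed (use tree_size_pos in auto)

section \<open>Typed data as trees\<close>

class encodable =
  fixes enc :: "'a \<Rightarrow> tree"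

instantiation tree :: encodable begin
definition enc_tree_def: "enc (x::tree) = x"
instance ..
end

instantiation unit :: encodable begin
definition enc_unit_def: "enc (x::unit) = Leaf"
instance ..
end

instantiation bool :: encodable begin
definition enc_bool_def: "enc b = (if b then Node Leaf Leaf else Leaf)"
instance ..
end

instantiation nat :: encodable begin
definition enc_nat_def: "enc = enc_nat"
instance ..
end

instantiation int :: encodable begin
definition enc_int_def': "enc = enc_int"
instance ..
end

instantiation list :: (encodable) encodable begin
definition enc_list_def: "enc = enc_list enc"
instance ..
end

instantiation prod :: (encodable, encodable) encodable begin
definition enc_prod_def: "enc = enc_pair enc enc"
instance ..
end

instantiation gate :: encodable begin
definition enc_gate_def: "enc = enc_gate"
instance ..
end

instantiation harmless_inst :: encodable begin
definition enc_harmless_inst_def: "enc = enc_harmless_inst"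
instance ..
end

lemma enc_simps [simp]:
  "enc (a, b) = Node (enc a) (enc b)"
  "enc ([] :: 'a::encodable list) = Leaf"
  "enc (x # xs) = Node (enc x) (enc xs)"
  "enc True = Node Leaf Leaf" "enc False = Leaf"
  "enc (0::nat) = Leaf" "enc (Suc n) = Node Leaf (enc n)"
  "enc (u::unit) = Leaf" "enc (t::tree) = t"
  by (auto simp: enc_prod_def enc_pair_def enc_list_def enc_bool_def enc_nat_def enc_unit_def enc_tree_def)

abbreviation sz :: "'a::encodable \<Rightarrow> nat" where "sz x \<equiv> tree_size (enc x)"

lemma sz_pos: "sz x \<ge> 1" by (rule tree_size_pos)

section \<open>Polynomial bounds and closure properties of polynomial time\<close>

definition poly_bounded :: "(nat \<Rightarrow> nat) \<Rightarrow> bool" where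
  "poly_bounded f \<longleftrightarrow> (\<exists>c. \<forall>n \<ge> 1. f n \<le> c * n ^ c)"

lemma poly_bounded_const: "poly_bounded (\<lambda>_. c)"
  unfolding poly_bounded_def by (intro exI[of _ c]) simp

lemma poly_bounded_id: "poly_bounded (\<lambda>n. n)"
  unfolding poly_bounded_def by (intro exI[of _ 1]) simp

lemma poly_bounded_add: assumes "poly_bounded f" "poly_bounded g" shows "poly_bounded (\<lambda>n. f n + g n)"
proof -
  obtain a b where ab: "\<And>n. n \<ge> 1 \<Longrightarrow> f n \<le> a * n ^ a" "\<And>n. n \<ge> 1 \<Longrightarrow> g n \<le> b * n ^ b"
    using assms unfolding poly_bounded_def by blast
  have "f n + g n \<le> (a + b) * n ^ (a + b)" if "n \<ge> 1" for n
  proof -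
    have "n ^ a \<le> n ^ (a + b)" "n ^ b \<le> n ^ (a + b)" using that by (auto intro: power_increasing)
    then have "a * n ^ a + b * n ^ b \<le> a * n ^ (a + b) + b * n ^ (a + b)"
      by (intro add_mono mult_le_mono2)
    then show ?thesis using ab[OF that] by (simp add: add_mult_distrib)
  qed
  then show ?thesis unfolding poly_bounded_def by blast
qed

lemma poly_bounded_mult: assumes "poly_bounded f" "poly_bounded g" shows "poly_bounded (\<lambda>n. f n * g n)"
proof -
  obtain a b where ab: "\<And>n. n \<ge> 1 \<Longrightarrow> f n \<le> a * n ^ a" "\<And>n. n \<ge> 1 \<Longrightarrow> g n \<le> b * n ^ b"
    using assms unfolding poly_bounded_def by blast
  have "f n * g n \<le> (a * b + a + b) * n ^ (a * b + a + b)" if "n \<ge> 1" for n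
  proof -
    have "f n * g n \<le> (a * n ^ a) * (b * n ^ b)" using ab[OF that] by (rule mult_le_mono)
    also have "\<dots> = a * b * n ^ (a + b)" by (simp add: power_add)
    also have "\<dots> \<le> (a * b + a + b) * n ^ (a * b + a + b)"
      using that by (intro mult_le_mono power_increasing) auto
    finally show ?thesis .
  qed
  then show ?thesis unfolding poly_bounded_def by blast
qed

lemma poly_bounded_power: "poly_bounded f \<Longrightarrow> poly_bounded (\<lambda>n. f n ^ c)"
  by (induction c) (auto intro: poly_bounded_const poly_bounded_mult)

lemmas poly_bounded_intros = poly_bounded_const poly_bounded_id poly_bounded_add poly_bounded_mult poly_bounded_power

text \<open>Only inputs that are codes are constrained; the behaviour of the program on other trees
  is left open. One constant serves as factor and as exponent.\<close>

definition polytime :: "('a::encodable \<Rightarrow> 'b::encodable) \<Rightarrow> bool" where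
  "polytime f \<longleftrightarrow> (\<exists>p c. \<forall>x. \<exists>t \<le> c * sz x ^ c. run p (enc x) (enc (f x)) t)"

lemma polytimeI:
  assumes "poly_bounded B" "\<And>x. \<exists>t \<le> B (sz x). run p (enc x) (enc (f x)) t"
  shows "polytime f"
proof -
  obtain c where "\<And>n. n \<ge> 1 \<Longrightarrow> B n \<le> c * n ^ c" using assms(1) unfolding poly_bounded_def by blast
  then have "\<exists>t \<le> c * sz x ^ c. run p (enc x) (enc (f x)) t" for x
    using assms(2)[of x] sz_pos[of x] order.trans by blast
  then show ?thesis unfolding polytime_def by blast
qed

lemma polytime_output_size:
  assumes "polytime f"
  shows "\<exists>c. \<forall>x. sz (f x) \<le> c * sz x ^ c"
proof -
  obtain p c where p: "\<And>x. \<exists>t \<le> c * sz x ^ c. run p (enc x) (enc (f x)) t"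
    using assms unfolding polytime_def by blast
  have "sz (f x) \<le> c * sz x ^ c" for x
    using p[of x] run_output_size order.trans by blast
  then show ?thesis by blast
qed

named_theorems polytime_intros

lemma polytime_id [polytime_intros]: "polytime (\<lambda>x. x)"
  by (rule polytimeI[OF poly_bounded_id, of Ident]) (auto intro: run.intros)

lemma const_prog: "\<exists>p c. \<forall>x. \<exists>t \<le> c * tree_size x. run p x y t"
proof (induction y)
  case Leaf
  show ?case by (rule exI[of _ Const_Leaf], rule exI[of _ 1]) (auto intro: run.intros)
next
  case (Node y z)
  then obtain p c q d where "\<And>x. \<exists>t \<le> c * tree_size x. run p x y t"
    "\<And>x. \<exists>t \<le> d * tree_size x. run q x z t" by blast
  note pq = this
  have "\<exists>t \<le> (1 + c + d) * tree_size x. run (Fork p q) x (Node y z) t" for x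
  proof -
    obtain s t where "s \<le> c * tree_size x" "run p x y s" "t \<le> d * tree_size x" "run q x z t"
      using pq by meson
    then show ?thesis
      by (intro exI[of _ "tree_size x + s + t"] conjI run_Fork) (auto simp: algebra_simps)
  qed
  then show ?case by blast
qed

lemma polytime_const [polytime_intros]: "polytime (\<lambda>x. c)"
proof -
  obtain p d where "\<And>x. \<exists>t \<le> d * tree_size x. run p x (enc c) t"
    using const_prog[of "enc c"] by blast
  then show ?thesis by (intro polytimeI[of "\<lambda>n. d * n" p]) (auto intro: poly_bounded_intros)
qed

lemma polytime_comp: assumes "polytime f" "polytime g" shows "polytime (\<lambda>x. f (g x))"
proof -
  obtain p c where p: "\<And>x. \<exists>t \<le> c * sz x ^ c. run p (enc x) (enc (f x)) t" using assms(1) unfolding polytime_def by blast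
  obtain q d where q: "\<And>x. \<exists>t \<le> d * sz x ^ d. run q (enc x) (enc (g x)) t" using assms(2) unfolding polytime_def by blast
  show ?thesis
  proof (rule polytimeI[of "\<lambda>n. n + d * n ^ d + c * (d * n ^ d) ^ c" "Seq q p"])
    fix x
    obtain t where t: "t \<le> d * sz x ^ d" "run q (enc x) (enc (g x)) t" using q by blast
    obtain s where s: "s \<le> c * sz (g x) ^ c" "run p (enc (g x)) (enc (f (g x))) s" using p by blast
    have "sz (g x) \<le> d * sz x ^ d" using t run_output_size order.trans by blast
    then have st: "c * sz (g x) ^ c \<le> c * (d * sz x ^ d) ^ c" by (intro mult_le_mono2 power_mono) auto
    then show "\<exists>t\<le>sz x + d * sz x ^ d + c * (d * sz x ^ d) ^ c. run (Seq q p) (enc x) (enc (f (g x))) t"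
      using s t st by (intro exI[of _ "sz x + t + s"] conjI run_Seq) linarith+
  qed (intro poly_bounded_intros)
qed

lemma polytime_Pair [polytime_intros]: assumes "polytime f" "polytime g" shows "polytime (\<lambda>x. (f x, g x))"
proof -
  obtain p c where p: "\<And>x. \<exists>t \<le> c * sz x ^ c. run p (enc x) (enc (f x)) t" using assms(1) unfolding polytime_def by blast
  obtain q d where q: "\<And>x. \<exists>t \<le> d * sz x ^ d. run q (enc x) (enc (g x)) t" using assms(2) unfolding polytime_def by blast
  show ?thesis
  proof (rule polytimeI[of "\<lambda>n. n + c * n ^ c + d * n ^ d" "Fork p q"])
    fix x
    obtain s t where "s \<le> c * sz x ^ c" "run p (enc x) (enc (f x)) s"
      "t \<le> d * sz x ^ d" "run q (enc x) (enc (g x)) t" using p q by meson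
    then show "\<exists>t\<le>sz x + c * sz x ^ c + d * sz x ^ d. run (Fork p q) (enc x) (enc (f x, g x)) t"
      by (intro exI[of _ "sz x + s + t"] conjI) (auto intro: run_Fork)
  qed (intro poly_bounded_intros)
qed

text \<open>Only the encoding of the result matters, so the result may change its type: a unary
  number is also a list of units, a nonempty list is also a pair, every tree is also a list of
  trees. Many rules below are a known program read at another type.\<close>

lemma polytime_coerce:
  assumes "polytime f" "\<And>x. enc (g x) = enc (f x)"
  shows "polytime g"
  using assms unfolding polytime_def by simp

lemma polytime_left: assumes "\<And>x. enc (g x) = left (enc x)" shows "polytime g"
  by (rule polytimeI[OF poly_bounded_id, of Left]) (auto intro: run.intros simp: assms)

lemma polytime_right: assumes "\<And>x. enc (g x) = right (enc x)" shows "polytime g"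
  by (rule polytimeI[OF poly_bounded_id, of Right]) (auto intro: run.intros simp: assms)

lemma polytime_fst [polytime_intros]: "polytime f \<Longrightarrow> polytime (\<lambda>x. fst (f x))"
  by (rule polytime_comp[of fst]) (auto intro: polytime_left)

lemma polytime_snd [polytime_intros]: "polytime f \<Longrightarrow> polytime (\<lambda>x. snd (f x))"
  by (rule polytime_comp[of snd]) (auto intro: polytime_right)

lemma polytime_app2:
  assumes "polytime (\<lambda>p. F (fst p) (snd p))" "polytime f" "polytime g"
  shows "polytime (\<lambda>x. F (f x) (g x))"
  using polytime_comp[OF assms(1) polytime_Pair[OF assms(2,3)]] by simp

lemma polytime_app3:
  assumes "polytime (\<lambda>p. F (fst p) (fst (snd p)) (snd (snd p)))" "polytime f" "polytime g" "polytime h"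
  shows "polytime (\<lambda>x. F (f x) (g x) (h x))"
  using polytime_comp[OF assms(1) polytime_Pair[OF assms(2) polytime_Pair[OF assms(3,4)]]] by simp

lemma polytime_app4:
  assumes "polytime (\<lambda>p. F (fst p) (fst (snd p)) (fst (snd (snd p))) (snd (snd (snd p))))" "polytime f" "polytime g" "polytime h" "polytime k"
  shows "polytime (\<lambda>x. F (f x) (g x) (h x) (k x))"
  using polytime_comp[OF assms(1) polytime_Pair[OF assms(2) polytime_Pair[OF assms(3) polytime_Pair[OF assms(4,5)]]]] by simp

text \<open>The test has arbitrary type because \<open>Cond\<close> only asks whether a tree is
  \<open>Leaf\<close>; this yields the tests for zero and for the empty list.\<close>

lemma polytime_cond:
  fixes f g h :: "'a::encodable \<Rightarrow> 'b::encodable" and c :: "'a \<Rightarrow> 'c::encodable"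
  assumes "polytime c" "polytime f" "polytime g"
    "\<And>x. enc (c x) \<noteq> Leaf \<Longrightarrow> h x = f x" "\<And>x. enc (c x) = Leaf \<Longrightarrow> h x = g x"
  shows "polytime h"
proof -
  obtain b a where b: "\<And>x. \<exists>t \<le> a * sz x ^ a. run b (enc x) (enc (c x)) t" using assms(1) unfolding polytime_def by blast
  obtain p e where p: "\<And>x. \<exists>t \<le> e * sz x ^ e. run p (enc x) (enc (f x)) t" using assms(2) unfolding polytime_def by blast
  obtain q d where q: "\<And>x. \<exists>t \<le> d * sz x ^ d. run q (enc x) (enc (g x)) t" using assms(3) unfolding polytime_def by blast
  show ?thesis
  proof (rule polytimeI[of "\<lambda>n. n + a * n ^ a + e * n ^ e + d * n ^ d" "Cond b p q"])
    fix x
    obtain r where r: "r \<le> a * sz x ^ a" "run b (enc x) (enc (c x)) r" using b by meson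
    show "\<exists>t\<le>sz x + a * sz x ^ a + e * sz x ^ e + d * sz x ^ d. run (Cond b p q) (enc x) (enc (h x)) t"
    proof (cases "enc (c x) = Leaf")
      case True
      obtain t where "t \<le> d * sz x ^ d" "run q (enc x) (enc (g x)) t" using q by meson
      then show ?thesis using r True assms(5)
        by (intro exI[of _ "sz x + r + t"] conjI run_Cond_False) auto
    next
      case False
      obtain t where "t \<le> e * sz x ^ e" "run p (enc x) (enc (f x)) t" using p by meson
      then show ?thesis using r False assms(4)
        by (intro exI[of _ "sz x + r + t"] conjI run_Cond_True) auto
    qed
  qed (intro poly_bounded_intros)
qed

lemma polytime_if [polytime_intros]:
  assumes "polytime b" "polytime f" "polytime g"
  shows "polytime (\<lambda>x. if b x then f x else g x)"
  by (rule polytime_cond[OF assms]) (auto simp: enc_bool_def split: if_splits)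

lemma polytime_not [polytime_intros]: "polytime b \<Longrightarrow> polytime (\<lambda>x. \<not> b x)"
  by (rule polytime_coerce[OF polytime_if[OF _ polytime_const[of False] polytime_const[of True]]]) auto

lemma polytime_conj [polytime_intros]: "polytime b \<Longrightarrow> polytime c \<Longrightarrow> polytime (\<lambda>x. b x \<and> c x)"
  by (rule polytime_coerce[OF polytime_if[of b c "\<lambda>_. False"]]) (auto intro: polytime_const)

lemma polytime_disj [polytime_intros]: "polytime b \<Longrightarrow> polytime c \<Longrightarrow> polytime (\<lambda>x. b x \<or> c x)"
  using polytime_not[OF polytime_conj[OF polytime_not polytime_not], of b c] by simp

lemma polytime_imp [polytime_intros]: "polytime b \<Longrightarrow> polytime c \<Longrightarrow> polytime (\<lambda>x. b x \<longrightarrow> c x)"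
  unfolding imp_conv_disj by (intro polytime_disj polytime_not)

lemma polytime_iff [polytime_intros]: "polytime b \<Longrightarrow> polytime c \<Longrightarrow> polytime (\<lambda>x. b x \<longleftrightarrow> c x)"
  unfolding iff_conv_conj_imp by (intro polytime_conj polytime_imp)

lemma polytime_is_Leaf: "polytime f \<Longrightarrow> polytime (\<lambda>x. enc (f x) = Leaf)"
  by (rule polytime_cond[OF _ polytime_const[of False] polytime_const[of True]]) auto

lemma enc_nat_Leaf [simp]: "enc (n::nat) = Leaf \<longleftrightarrow> n = 0"
  by (cases n) auto

lemma enc_list_Leaf [simp]: "enc (xs::'a::encodable list) = Leaf \<longleftrightarrow> xs = []"
  by (cases xs) auto

lemma polytime_Nil_test [polytime_intros]: "polytime f \<Longrightarrow> polytime (\<lambda>x. f x = [])"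
  by (rule polytime_coerce[OF polytime_is_Leaf[of f]]) auto

lemma polytime_zero_test [polytime_intros]: "polytime f \<Longrightarrow> polytime (\<lambda>x. f x = (0::nat))"
  by (rule polytime_coerce[OF polytime_is_Leaf[of f]]) auto

lemma polytime_Cons [polytime_intros]: "polytime f \<Longrightarrow> polytime g \<Longrightarrow> polytime (\<lambda>x. f x # g x)"
  by (rule polytime_coerce[OF polytime_Pair]) auto

lemma polytime_Suc [polytime_intros]: "polytime f \<Longrightarrow> polytime (\<lambda>x. Suc (f x))"
  by (rule polytime_coerce[OF polytime_Pair[OF polytime_const[of "()"]]]) auto

lemma polytime_tl [polytime_intros]: "polytime f \<Longrightarrow> polytime (\<lambda>x. tl (f x))"
  by (rule polytime_comp[of tl], rule polytime_right, case_tac x) auto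

lemma polytime_pred [polytime_intros]: "polytime f \<Longrightarrow> polytime (\<lambda>x. f x - Suc 0)"
  by (rule polytime_comp[of "\<lambda>x. x - Suc 0"], rule polytime_right, case_tac x) auto

lemma polytime_case_list:
  assumes "polytime xs" "polytime a" "polytime (\<lambda>p. f (fst p) (fst (snd p)) (snd (snd p)))"
  shows "polytime (\<lambda>x. case xs x of [] \<Rightarrow> a x | y # ys \<Rightarrow> f x y ys)"
proof -
  obtain r b where r: "\<And>x. \<exists>t \<le> b * sz x ^ b. run r (enc x) (enc (xs x)) t" using assms(1) unfolding polytime_def by blast
  obtain q d where q: "\<And>x. \<exists>t \<le> d * sz x ^ d. run q (enc x) (enc (a x)) t" using assms(2) unfolding polytime_def by blast
  obtain p c where p: "\<And>x. \<exists>t \<le> c * sz x ^ c. run p (enc x) (enc (f (fst x) (fst (snd x)) (snd (snd x)))) t"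
    using assms(3) unfolding polytime_def by blast
  let ?B = "\<lambda>n. n + b * n ^ b + (d * n ^ d + (n + (n + n + b * n ^ b) + c * (1 + n + b * n ^ b) ^ c))"
  show ?thesis
  proof (rule polytimeI[of ?B "Cond r (Seq (Fork Ident r) p) q"])
    fix x
    obtain s where s: "s \<le> b * sz x ^ b" "run r (enc x) (enc (xs x)) s" using r by meson
    show "\<exists>t\<le>?B (sz x). run (Cond r (Seq (Fork Ident r) p) q) (enc x)
        (enc (case xs x of [] \<Rightarrow> a x | y # ys \<Rightarrow> f x y ys)) t"
    proof (cases "xs x")
      case Nil
      obtain t where "t \<le> d * sz x ^ d" "run q (enc x) (enc (a x)) t" using q by meson
      then show ?thesis using s Nil
        by (intro exI[of _ "sz x + s + t"] conjI run_Cond_False) auto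
    next
      case (Cons y ys)
      obtain t where t: "t \<le> c * sz (x, y, ys) ^ c" "run p (enc (x, y, ys)) (enc (f x y ys)) t"
        using p[of "(x, y, ys)"] by auto
      have "sz (x, y, ys) = 1 + sz x + sz (xs x)" using Cons by simp
      also have "\<dots> \<le> 1 + sz x + b * sz x ^ b" using s run_output_size order.trans by fastforce
      finally have "c * sz (x, y, ys) ^ c \<le> c * (1 + sz x + b * sz x ^ b) ^ c"
        by (intro mult_le_mono2 power_mono) auto
      then have t': "t \<le> c * (1 + sz x + b * sz x ^ b) ^ c" using t by linarith
      \<comment> \<open>\<open>(x, y, ys)\<close> and \<open>(x, y # ys)\<close> have the same
        encoding, so pairing the input with the list already splits off the head.\<close>
      have "run (Fork Ident r) (enc x) (enc (x, y, ys)) (sz x + sz x + s)"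
        using s Cons by (auto intro!: run.intros)
      then have "run (Seq (Fork Ident r) p) (enc x) (enc (f x y ys)) (sz x + (sz x + sz x + s) + t)"
        using t by (auto intro: run.intros)
      then have "run (Cond r (Seq (Fork Ident r) p) q) (enc x) (enc (f x y ys))
          (sz x + s + (sz x + (sz x + sz x + s) + t))"
        using s Cons by (auto intro: run_Cond_True)
      moreover have "sz x + s + (sz x + (sz x + sz x + s) + t) \<le> ?B (sz x)"
        using t' s(1) by linarith
      ultimately show ?thesis unfolding Cons list.case by blast
    qed
  qed (intro poly_bounded_intros)
qed

text \<open>The loop state consists of the remaining list, the environment and the accumulator, in
  this order, so that \<open>Left\<close> tests whether the list is exhausted. \<open>M\<close>
  bounds only the states that are reached.\<close>

lemma foldl_while:
  fixes st :: "'e::encodable \<Rightarrow> 'b::encodable \<Rightarrow> 'a::encodable \<Rightarrow> 'b"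
  assumes p: "\<And>ys e a. \<exists>t \<le> c * sz (ys, e, a) ^ c.
      run p (enc (ys, e, a)) (enc (tl ys, e, case ys of [] \<Rightarrow> a | y # zs \<Rightarrow> st e a y)) t"
    and M: "\<And>us vs. ys = us @ vs \<Longrightarrow> sz (vs, e, foldl (st e) a us) \<le> M"
  shows "\<exists>t \<le> Suc (length ys) * (2 * M + c * M ^ c).
    run (While Left p) (enc (ys, e, a)) (enc ([] :: 'a list, e, foldl (st e) a ys)) t"
  using M
proof (induction ys arbitrary: a)
  case Nil
  have "run Left (enc ([] :: 'a list, e, a)) Leaf (sz ([] :: 'a list, e, a))"
    using run_Left[of "enc ([] :: 'a list, e, a)"] by simp
  then have "run (While Left p) (enc ([] :: 'a list, e, a)) (enc ([] :: 'a list, e, a))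
      (sz ([] :: 'a list, e, a) + sz ([] :: 'a list, e, a))"
    by (rule run_While_Stop)
  moreover have "sz ([] :: 'a list, e, a) \<le> M" using Nil[of "[]" "[]"] by simp
  then have "sz ([] :: 'a list, e, a) + sz ([] :: 'a list, e, a) \<le> Suc (length []) * (2 * M + c * M ^ c)"
    by simp
  ultimately show ?case unfolding foldl.simps by blast
next
  case (Cons y ys)
  let ?x = "(y # ys, e, a)" let ?x' = "(ys, e, st e a y)"
  have M: "sz ?x \<le> M" using Cons.prems[of "[]" "y # ys"] by simp
  obtain t where t: "t \<le> c * sz ?x ^ c" "run p (enc ?x) (enc ?x') t" using p[of "y # ys" e a] by auto
  have "t \<le> c * M ^ c" using t(1) mult_le_mono2[OF power_mono[OF M]] order.trans by blast
  obtain u where u: "u \<le> Suc (length ys) * (2 * M + c * M ^ c)"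
    "run (While Left p) (enc ?x') (enc ([] :: 'a list, e, foldl (st e) (st e a y) ys)) u"
    using Cons.IH[of "st e a y"] Cons.prems[of "y # _"] by auto
  have "run Left (enc ?x) (enc (y # ys)) (sz ?x)" using run_Left[of "enc ?x"] by simp
  from run_While_Step[OF this _ t(2) u(2)]
  have "run (While Left p) (enc ?x) (enc ([] :: 'a list, e, foldl (st e) a (y # ys))) (sz ?x + sz ?x + t + u)"
    by simp
  moreover have "sz ?x + sz ?x + t + u \<le> Suc (length (y # ys)) * (2 * M + c * M ^ c)"
    using M \<open>t \<le> c * M ^ c\<close> u(1) by simp
  ultimately show ?case by blast
qed

lemma length_le_sz: "length xs \<le> sz xs"
  by (induction xs) auto

lemma sz_append: "sz (xs @ ys) + 1 = sz xs + sz (ys :: 'a::encodable list)"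
  by (induction xs) auto

text \<open>A polynomial-time step may double its accumulator, and iterating it then takes
  exponential time. The bound \<open>B\<close> on all partial results excludes this.\<close>

lemma polytime_foldl:
  fixes st :: "'e::encodable \<Rightarrow> 'b::encodable \<Rightarrow> 'a::encodable \<Rightarrow> 'b"
  assumes xs: "polytime xs" and i: "polytime i" and st: "polytime (\<lambda>p. st (fst p) (fst (snd p)) (snd (snd p)))"
    and B: "poly_bounded B" "\<And>e ys zs. xs e = ys @ zs \<Longrightarrow> sz (foldl (st e) (i e) ys) \<le> B (sz e)"
  shows "polytime (\<lambda>e. foldl (st e) (i e) (xs e))"
proof -
  have "polytime (\<lambda>s. (tl (fst s), fst (snd s), case fst s of [] \<Rightarrow> snd (snd s) | y # ys \<Rightarrow> st (fst (snd s)) (snd (snd s)) y))"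
    by (intro polytime_intros polytime_case_list[where f = "\<lambda>s y _. st (fst (snd s)) (snd (snd s)) y"]
        polytime_app3[of st, OF st])
  then obtain p c where "\<forall>s. \<exists>t \<le> c * sz s ^ c. run p (enc s) (enc (tl (fst s), fst (snd s),
     case fst s of [] \<Rightarrow> snd (snd s) | y # ys \<Rightarrow> st (fst (snd s)) (snd (snd s)) y)) t"
    unfolding polytime_def by blast
  then have p: "\<exists>t \<le> c * sz (ys, e, a) ^ c. run p (enc (ys, e, a))
      (enc (tl ys, e, case ys of [] \<Rightarrow> a | y # zs \<Rightarrow> st e a y)) t" for ys e a
    by (metis fst_conv snd_conv)
  obtain q d where q: "\<And>x. \<exists>t \<le> d * sz x ^ d. run q (enc x) (enc (xs x, x, i x)) t"
    using polytime_Pair[OF xs polytime_Pair[OF polytime_id i]] unfolding polytime_def by blast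
  obtain b where b: "\<And>x. sz (xs x) \<le> b * sz x ^ b" using polytime_output_size[OF xs] by blast
  define M where "M = (\<lambda>n. 2 + b * n ^ b + n + B n)"
  define T where "T = (\<lambda>n. Suc (b * n ^ b) * (2 * M n + c * M n ^ c))"
  have "poly_bounded M" unfolding M_def by (intro poly_bounded_intros B)
  then have T: "poly_bounded T" unfolding T_def Suc_eq_plus1 by (intro poly_bounded_intros)
  show ?thesis
  proof (rule polytimeI[of "\<lambda>n. n + d * n ^ d + (d * n ^ d + T n + (2 * M n + 2 * M n + 2 * M n))"
        "Seq q (Seq (While Left p) (Seq Right Right))"])
    fix e
    let ?a = "foldl (st e) (i e) (xs e)"
    obtain u where u: "u \<le> d * sz e ^ d" "run q (enc e) (enc (xs e, e, i e)) u" using q by blast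
    have M: "sz (vs, e, foldl (st e) (i e) us) \<le> M (sz e)" if "xs e = us @ vs" for us vs
    proof -
      have "sz (us @ vs) + 1 = sz us + sz vs" by (rule sz_append)
      then have "sz vs \<le> b * sz e ^ b" using b[of e] that sz_pos[of us] by simp
      then show ?thesis using B(2)[OF that] by (simp add: M_def)
    qed
    obtain t where t: "t \<le> Suc (length (xs e)) * (2 * M (sz e) + c * M (sz e) ^ c)"
      "run (While Left p) (enc (xs e, e, i e)) (enc ([] :: 'a list, e, ?a)) t"
      using foldl_while[where ys = "xs e" and e = e and a = "i e", OF p M] by blast
    have "Suc (length (xs e)) * (2 * M (sz e) + c * M (sz e) ^ c) \<le> T (sz e)"
      unfolding T_def using length_le_sz[of "xs e"] b[of e] by (intro mult_le_mono1) linarith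
    then have t': "t \<le> T (sz e)" using t by linarith
    have m: "sz ([] :: 'a list, e, ?a) \<le> M (sz e)" using M[of "xs e" "[]"] by simp
    have "run (Seq Right Right) (enc ([] :: 'a list, e, ?a)) (enc ?a)
        (sz ([] :: 'a list, e, ?a) + sz ([] :: 'a list, e, ?a) + sz (e, ?a))"
      using run_Seq[OF run_Right run_Right, of "enc ([] :: 'a list, e, ?a)"] by simp
    from run_Seq[OF u(2) run_Seq[OF t(2) this]]
    have r: "run (Seq q (Seq (While Left p) (Seq Right Right))) (enc e) (enc ?a)
        (sz e + u + (sz (xs e, e, i e) + t + (sz ([] :: 'a list, e, ?a) + sz ([] :: 'a list, e, ?a) + sz (e, ?a))))" .
    have "sz (xs e, e, i e) \<le> d * sz e ^ d" using run_output_size[OF u(2)] u(1) by linarith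
    moreover have "sz (e, ?a) \<le> M (sz e)" using m by simp
    ultimately have "sz e + u + (sz (xs e, e, i e) + t + (sz ([] :: 'a list, e, ?a) + sz ([] :: 'a list, e, ?a) + sz (e, ?a)))
      \<le> sz e + d * sz e ^ d + (d * sz e ^ d + T (sz e) + (2 * M (sz e) + 2 * M (sz e) + 2 * M (sz e)))"
      using u(1) t' m by linarith
    with r show "\<exists>t\<le>sz e + d * sz e ^ d + (d * sz e ^ d + T (sz e) + (2 * M (sz e) + 2 * M (sz e) + 2 * M (sz e))).
        run (Seq q (Seq (While Left p) (Seq Right Right))) (enc e) (enc ?a) t"
      by blast
  qed (intro poly_bounded_intros T \<open>poly_bounded M\<close>)
qed

text \<open>Growth per round by an amount that depends on the environment alone adds up to a
  polynomial, as there are at most \<open>sz (xs e)\<close> rounds.\<close>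

lemma polytime_foldl_step:
  fixes st :: "'e::encodable \<Rightarrow> 'b::encodable \<Rightarrow> 'a::encodable \<Rightarrow> 'b"
  assumes xs: "polytime xs" and i: "polytime i" and st: "polytime (\<lambda>p. st (fst p) (fst (snd p)) (snd (snd p)))"
    and D: "poly_bounded D" "\<And>e a x. x \<in> set (xs e) \<Longrightarrow> sz (st e a x) \<le> sz a + D (sz e)"
  shows "polytime (\<lambda>e. foldl (st e) (i e) (xs e))"
proof -
  obtain b where b: "\<And>x. sz (xs x) \<le> b * sz x ^ b" using polytime_output_size[OF xs] by blast
  obtain c where c: "\<And>x. sz (i x) \<le> c * sz x ^ c" using polytime_output_size[OF i] by blast
  show ?thesis
  proof (rule polytime_foldl[OF xs i st, of "\<lambda>n. c * n ^ c + (b * n ^ b) * D n"])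
    fix e ys zs assume "xs e = ys @ zs"
    have "sz (foldl (st e) a ys) \<le> sz a + length ys * D (sz e)" if "set ys \<subseteq> set (xs e)" for a ys
      using that
    proof (induction ys arbitrary: a)
      case (Cons y ys)
      have "sz (foldl (st e) (st e a y) ys) \<le> sz (st e a y) + length ys * D (sz e)"
        using Cons by simp
      moreover have "sz (st e a y) \<le> sz a + D (sz e)" using D(2) Cons.prems by simp
      ultimately show ?case by simp
    qed simp
    from this[of ys "i e"] have "sz (foldl (st e) (i e) ys) \<le> sz (i e) + length ys * D (sz e)"
      using \<open>xs e = ys @ zs\<close> by simp
    moreover have "length ys \<le> b * sz e ^ b"
      using length_le_sz[of "xs e"] b[of e] \<open>xs e = ys @ zs\<close> by simp
    then have "length ys * D (sz e) \<le> (b * sz e ^ b) * D (sz e)" by (rule mult_le_mono1)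
    ultimately show "sz (foldl (st e) (i e) ys) \<le> c * sz e ^ c + (b * sz e ^ b) * D (sz e)"
      using c[of e] by linarith
  qed (intro poly_bounded_intros D)
qed

lemma sz_mem: "x \<in> set e \<Longrightarrow> sz x \<le> sz e"
  by (induction e) auto

lemma polytime_rev [polytime_intros]: "polytime f \<Longrightarrow> polytime (\<lambda>x. rev (f x))"
proof (rule polytime_comp[of rev])
  have eq: "rev = (\<lambda>xs :: 'b list. foldl (\<lambda>a x. x # a) [] xs)"
    by (rule ext) (simp add: foldl_conv_fold fold_Cons_rev)
  show "polytime (rev :: 'b list \<Rightarrow> 'b list)"
    unfolding eq
  proof (rule polytime_foldl_step[where D = "\<lambda>n. n + 1"])
    show "x \<in> set e \<Longrightarrow> sz (x # a) \<le> sz a + (sz e + 1)" for x a and e :: "'b list"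
      using sz_mem[of x e] by simp
  qed (intro polytime_intros poly_bounded_intros)+
qed

lemma polytime_append [polytime_intros]:
  assumes "polytime f" "polytime g" shows "polytime (\<lambda>x. f x @ g x)"
proof (rule polytime_app2[OF _ assms])
  have eq: "(\<lambda>p. fst p @ snd p) = (\<lambda>p :: 'b list \<times> 'b list. foldl (\<lambda>a x. x # a) (snd p) (rev (fst p)))"
    by (rule ext) (simp add: foldl_conv_fold fold_Cons_rev fold_append_concat_rev)
  show "polytime (\<lambda>p :: 'b list \<times> 'b list. fst p @ snd p)"
    unfolding eq
  proof (rule polytime_foldl_step[where D = "\<lambda>n. n + 1"])
    show "x \<in> set (rev (fst e)) \<Longrightarrow> sz (x # a) \<le> sz a + (sz e + 1)" for x a and e :: "'b list \<times> 'b list"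
      using sz_mem[of x "fst e"] by (cases e) simp
  qed (intro polytime_intros poly_bounded_intros)+
qed

text \<open>The body may use the environment, so it is treated as a function of a pair. In this form
  nested maps, filters and quantifiers decompose by the rules alone.\<close>

lemma polytime_map [polytime_intros]:
  assumes "polytime xs" and f: "polytime (\<lambda>p. f (fst p) (snd p))"
  shows "polytime (\<lambda>e. map (f e) (xs e))"
proof -
  have eq: "map (f e) (xs e) = rev (foldl (\<lambda>a x. f e x # a) [] (xs e))" for e
  proof -
    have "foldl (\<lambda>a x. f e x # a) b ys = rev (map (f e) ys) @ b" for b ys
      by (induction ys arbitrary: b) auto
    then show ?thesis by simp
  qed
  obtain b where b: "\<And>x. sz (xs x) \<le> b * sz x ^ b" using polytime_output_size[OF assms(1)] by blast
  obtain c where c: "\<And>p. sz (f (fst p) (snd p)) \<le> c * sz p ^ c" using polytime_output_size[OF f] by blast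
  show ?thesis
    unfolding eq
  proof (intro polytime_rev polytime_foldl_step[where D = "\<lambda>n. 1 + c * (1 + n + b * n ^ b) ^ c"])
    show "polytime xs" by fact
    show "polytime (\<lambda>p. f (fst p) (snd (snd p)) # fst (snd p))"
      by (intro polytime_intros polytime_app2[of f, OF f])
    fix e a x assume "x \<in> set (xs e)"
    then have "sz (e, x) \<le> 1 + sz e + b * sz e ^ b" using b[of e] sz_mem[of x] by fastforce
    then have "c * sz (e, x) ^ c \<le> c * (1 + sz e + b * sz e ^ b) ^ c"
      by (intro mult_le_mono2 power_mono) auto
    then show "sz (f e x # a) \<le> sz a + (1 + c * (1 + sz e + b * sz e ^ b) ^ c)"
      using c[of "(e, x)"] unfolding enc_simps fst_conv snd_conv tree_size.simps by linarith
  qed (intro polytime_intros poly_bounded_intros)+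
qed

lemma polytime_filter [polytime_intros]:
  assumes "polytime xs" and P: "polytime (\<lambda>p. P (fst p) (snd p))"
  shows "polytime (\<lambda>e. filter (P e) (xs e))"
proof -
  have eq: "filter (P e) (xs e) = rev (foldl (\<lambda>a x. if P e x then x # a else a) [] (xs e))" for e
  proof -
    have "foldl (\<lambda>a x. if P e x then x # a else a) b ys = rev (filter (P e) ys) @ b" for b ys
      by (induction ys arbitrary: b) auto
    then show ?thesis by simp
  qed
  obtain b where b: "\<And>x. sz (xs x) \<le> b * sz x ^ b" using polytime_output_size[OF assms(1)] by blast
  show ?thesis
    unfolding eq
  proof (intro polytime_rev polytime_foldl_step[where D = "\<lambda>n. 1 + b * n ^ b"])
    show "polytime xs" by fact
    show "polytime (\<lambda>p. if P (fst p) (snd (snd p)) then snd (snd p) # fst (snd p) else fst (snd p))"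
      by (intro polytime_intros polytime_app2[of P, OF P])
    fix e a x assume "x \<in> set (xs e)"
    then show "sz (if P e x then x # a else a) \<le> sz a + (1 + b * sz e ^ b)"
      using b[of e] sz_mem[of x] by fastforce
  qed (intro polytime_intros poly_bounded_intros)+
qed

lemma polytime_ball [polytime_intros]:
  assumes "polytime xs" and P: "polytime (\<lambda>p. P (fst p) (snd p))"
  shows "polytime (\<lambda>e. \<forall>x \<in> set (xs e). P e x)"
  by (rule polytime_coerce[OF polytime_Nil_test[OF polytime_filter[OF assms(1), of "\<lambda>e x. \<not> P e x"]]])
    (auto intro: polytime_not P simp: filter_empty_conv)

lemma polytime_bex [polytime_intros]:
  assumes "polytime xs" and P: "polytime (\<lambda>p. P (fst p) (snd p))"
  shows "polytime (\<lambda>e. \<exists>x \<in> set (xs e). P e x)"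
  by (rule polytime_coerce[OF polytime_not[OF polytime_ball[OF assms(1), of "\<lambda>e x. \<not> P e x"]]])
    (auto intro: polytime_not P)

lemma polytime_concat [polytime_intros]: assumes "polytime f" shows "polytime (\<lambda>x. concat (f x))"
proof (rule polytime_comp[OF _ assms])
  have eq: "concat = (\<lambda>xs :: 'b list list. foldl (@) [] xs)"
  proof
    have "foldl (@) a xs = a @ concat xs" for a and xs :: "'b list list" by (induction xs arbitrary: a) auto
    then show "concat xs = foldl (@) [] xs" for xs :: "'b list list" by simp
  qed
  show "polytime (concat :: 'b list list \<Rightarrow> 'b list)"
    unfolding eq
  proof (rule polytime_foldl_step[where D = "\<lambda>n. n"])
    show "x \<in> set e \<Longrightarrow> sz (a @ x) \<le> sz a + sz e" for x a and e :: "'b list list"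
      using sz_append[of a x] sz_mem[of x e] by simp
  qed (intro polytime_intros poly_bounded_intros)+
qed

lemma polytime_product [polytime_intros]:
  assumes "polytime f" "polytime g" shows "polytime (\<lambda>x. List.product (f x) (g x))"
proof (rule polytime_app2[OF _ assms])
  show "polytime (\<lambda>p. List.product (fst p) (snd p))"
    unfolding product_concat_map by (intro polytime_intros)
qed

text \<open>The length \<open>n\<close> is a constant: the number \<open>m ^ n\<close> of tuples
  over \<open>m\<close> entries is polynomial for fixed \<open>n\<close> only.\<close>

lemma polytime_n_lists [polytime_intros]:
  assumes "polytime f" shows "polytime (\<lambda>x. List.n_lists n (f x))"
proof (rule polytime_comp[OF _ assms])
  show "polytime (List.n_lists n :: 'b list \<Rightarrow> _)"
  proof (induction n)
    case (Suc n)
    show ?case unfolding List.n_lists.simps by (intro polytime_intros polytime_comp[OF Suc])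
  qed (simp add: polytime_const)
qed

text \<open>A unary number is literally the code of a list of units; counting loops thus become
  folds over lists.\<close>

lemma polytime_replicate_unit: "polytime f \<Longrightarrow> polytime (\<lambda>x. replicate (f x) ())"
proof (erule polytime_coerce)
  have "enc (replicate n ()) = enc n" for n by (induction n) auto
  then show "enc (replicate (f x) ()) = enc (f x)" for x .
qed

lemma polytime_length [polytime_intros]: assumes "polytime f" shows "polytime (\<lambda>x. length (f x))"
proof (rule polytime_comp[OF _ assms])
  have eq: "length = (\<lambda>xs :: 'b list. foldl (\<lambda>a x. Suc a) 0 xs)"
  proof
    have "foldl (\<lambda>a x. Suc a) b xs = b + length xs" for b and xs :: "'b list" by (induction xs arbitrary: b) auto
    then show "length xs = foldl (\<lambda>a x. Suc a) 0 xs" for xs :: "'b list" by simp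
  qed
  show "polytime (length :: 'b list \<Rightarrow> nat)"
    unfolding eq by (rule polytime_foldl_step[where D = "\<lambda>n. 2"]) (auto intro!: polytime_intros poly_bounded_intros)
qed

section \<open>Arithmetic on unary numbers, and list access\<close>

lemma sz_nat [simp]: "sz (n::nat) = 2 * n + 1"
  by (induction n) auto

lemma polytime_funpow:
  fixes st :: "'e::encodable \<Rightarrow> 'b::encodable \<Rightarrow> 'b"
  assumes n: "polytime n" and i: "polytime i" and st: "polytime (\<lambda>p. st (fst p) (snd p))"
    and D: "poly_bounded D" "\<And>e a. sz (st e a) \<le> sz a + D (sz e)"
  shows "polytime (\<lambda>e. (st e ^^ n e) (i e))"
proof -
  have eq: "(st e ^^ n e) (i e) = foldl (\<lambda>a _. st e a) (i e) (replicate (n e) ())" for e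
  proof -
    have "foldl (\<lambda>a _. st e a) b (replicate m ()) = (st e ^^ m) b" for m b
      by (induction m arbitrary: b) (auto simp: funpow_swap1)
    then show ?thesis by simp
  qed
  show ?thesis
    unfolding eq
  proof (rule polytime_foldl_step[where D = D])
    show "polytime (\<lambda>p :: 'e \<times> 'b \<times> unit. st (fst p) (fst (snd p)))"
      by (intro polytime_app2[of st, OF st] polytime_intros)
  qed (intro polytime_replicate_unit n i D)+
qed

lemma polytime_add [polytime_intros]:
  assumes "polytime f" "polytime g" shows "polytime (\<lambda>x. f x + g x :: nat)"
proof -
  have eq: "f x + g x = (Suc ^^ f x) (g x)" for x by simp
  show ?thesis unfolding eq
  proof (rule polytime_funpow[where D = "\<lambda>_. 2" and st = "\<lambda>_. Suc"])
    show "sz (Suc a) \<le> sz a + 2" for a by simp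
  qed (intro assms polytime_intros poly_bounded_intros)+
qed

lemma polytime_mult [polytime_intros]:
  assumes "polytime f" "polytime g" shows "polytime (\<lambda>x. f x * g x :: nat)"
proof -
  obtain c where c: "\<And>x. sz (g x) \<le> c * sz x ^ c" using polytime_output_size[OF assms(2)] by blast
  show ?thesis
  proof (rule polytime_coerce[OF polytime_funpow[where D = "\<lambda>n. c * n ^ c" and st = "\<lambda>x. (+) (g x)" and n = f and i = "\<lambda>_. 0"]])
    show "polytime (\<lambda>p. g (fst p) + snd p)" by (intro polytime_intros polytime_comp[OF assms(2)])
    show "sz (g e + a) \<le> sz a + c * sz e ^ c" for e a using c[of e] by simp
    have "((+) m ^^ n) 0 = n * m" for m n :: nat by (induction n) auto
    then show "enc (f x * g x) = enc (((+) (g x) ^^ f x) 0)" for x by simp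
  qed (intro assms polytime_intros poly_bounded_intros)+
qed

lemma polytime_diff [polytime_intros]:
  assumes "polytime f" "polytime g" shows "polytime (\<lambda>x. f x - g x :: nat)"
proof (rule polytime_coerce[OF polytime_funpow[where D = "\<lambda>n. 0" and st = "\<lambda>x a. a - Suc 0" and n = g and i = f]])
  have "((\<lambda>a. a - Suc 0) ^^ n) m = m - n" for m n :: nat by (induction n) auto
  then show "enc (f x - g x) = enc (((\<lambda>a. a - Suc 0) ^^ g x) (f x))" for x by simp
  show "sz (a - Suc 0) \<le> sz a + 0" for a by simp
qed (intro assms polytime_intros poly_bounded_intros)+

lemma polytime_le [polytime_intros]: "polytime f \<Longrightarrow> polytime g \<Longrightarrow> polytime (\<lambda>x. f x \<le> (g x :: nat))"
  by (rule polytime_coerce[OF polytime_zero_test[OF polytime_diff[of f g]]]) auto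

lemma polytime_less [polytime_intros]: "polytime f \<Longrightarrow> polytime g \<Longrightarrow> polytime (\<lambda>x. f x < (g x :: nat))"
  unfolding Suc_le_eq[symmetric] by (intro polytime_intros)

lemma polytime_eq_nat [polytime_intros]: "polytime f \<Longrightarrow> polytime g \<Longrightarrow> polytime (\<lambda>x. f x = (g x :: nat))"
  unfolding order_eq_iff[of "_ :: nat"] by (intro polytime_intros)

text \<open>Appending the current length makes the growth depend on the accumulator, so
  \<open>polytime_foldl_step\<close> does not apply; the bound is taken over the reachable
  accumulators instead.\<close>

lemma polytime_upt [polytime_intros]: assumes "polytime f" shows "polytime (\<lambda>x. [0..<f x])"
proof -
  obtain c where c: "\<And>x. sz (f x) \<le> c * sz x ^ c" using polytime_output_size[OF assms] by blast
  have eq: "foldl (\<lambda>a (_::unit). a @ [length a]) [] us = [0..<length us]" for us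
    by (induction us rule: rev_induct) auto
  have bound: "sz [0..<n] \<le> (n + 1) * (2 * n + 2)" for n
  proof (induction n)
    case (Suc n)
    then show ?case using sz_append[of "[0..<n]" "[n]"] by simp
  qed simp
  show ?thesis
  proof (rule polytime_coerce[OF polytime_foldl[where st = "\<lambda>_ a (_::unit). a @ [length a]"
        and xs = "\<lambda>x. replicate (f x) ()" and i = "\<lambda>_. []"
        and B = "\<lambda>n. (c * n ^ c + 1) * (2 * (c * n ^ c) + 2)"]])
    fix e and ys zs :: "unit list"
    assume "replicate (f e) () = ys @ zs"
    then have "length ys \<le> f e" by (metis le_add1 length_append length_replicate)
    then have *: "length ys \<le> c * sz e ^ c" using c[of e] by simp
    show "sz (foldl (\<lambda>a (_::unit). a @ [length a]) [] ys) \<le> (c * sz e ^ c + 1) * (2 * (c * sz e ^ c) + 2)"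
      unfolding eq by (rule order.trans[OF bound], rule mult_le_mono) (use * in simp_all)
  next
    show "poly_bounded (\<lambda>n. (c * n ^ c + 1) * (2 * (c * n ^ c) + 2))" by (intro poly_bounded_intros)
    show "enc [0..<f x] = enc (foldl (\<lambda>a (_::unit). a @ [length a]) [] (replicate (f x) ()))" for x
      unfolding eq by simp
  qed (intro assms polytime_intros polytime_replicate_unit)+
qed

lemma polytime_drop [polytime_intros]:
  assumes "polytime n" "polytime f" shows "polytime (\<lambda>x. drop (n x) (f x))"
proof (rule polytime_coerce[OF polytime_funpow[where D = "\<lambda>n. 0" and st = "\<lambda>x a. tl a" and n = n and i = f]])
  have "(tl ^^ n) xs = drop n xs" for n and xs :: "'b list"
    by (induction n) (auto simp: drop_Suc tl_drop)
  then show "enc (drop (n x) (f x)) = enc ((tl ^^ n x) (f x))" for x by simp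
  show "sz (tl a) \<le> sz a + 0" for a :: "'b list" by (cases a) auto
qed (intro assms polytime_intros poly_bounded_intros)+

text \<open>\<open>polytime\<close> speaks of all arguments, whereas \<open>xs ! i\<close> is
  unspecified beyond the end; the default makes list access total.\<close>

lemma polytime_nth_default [polytime_intros]:
  assumes "polytime f" "polytime n" shows "polytime (\<lambda>x. nth_default d (f x) (n x))"
proof (rule polytime_coerce[OF polytime_case_list[where f = "\<lambda>x y ys. y" and a = "\<lambda>_. d"]])
  show "polytime (\<lambda>x. drop (n x) (f x))" by (intro polytime_intros assms)
  have "nth_default d xs m = (case drop m xs of [] \<Rightarrow> d | y # ys \<Rightarrow> y)" for m xs
    by (induction xs arbitrary: m) (auto simp: nth_default_Cons split: nat.splits)
  then show "enc (nth_default d (f x) (n x)) = enc (case drop (n x) (f x) of [] \<Rightarrow> d | y # ys \<Rightarrow> y)" for x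
    by simp
qed (intro polytime_intros)+

lemma polytime_replicate [polytime_intros]:
  assumes "polytime n" "polytime c" shows "polytime (\<lambda>x. replicate (n x) (c x))"
proof -
  have eq: "replicate (n x) (c x) = map (\<lambda>_. c x) [0..<n x]" for x by (simp add: map_replicate_const)
  show ?thesis unfolding eq by (intro polytime_intros assms polytime_comp[OF assms(2)])
qed

lemma polytime_power [polytime_intros]: assumes "polytime f" shows "polytime (\<lambda>x. f x ^ c :: nat)"
proof (induction c)
  case (Suc c)
  show ?case unfolding power.simps by (intro polytime_mult assms Suc)
qed (simp add: polytime_const)

lemma nats_eq_iff:
  "xs = ys \<longleftrightarrow> length xs = length ys \<and>
    (\<forall>i \<in> set [0..<length xs]. nth_default 0 xs i = nth_default (0::nat) ys i)"
proof
  assume *: "length xs = length ys \<and>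
    (\<forall>i \<in> set [0..<length xs]. nth_default 0 xs i = nth_default (0::nat) ys i)"
  then show "xs = ys"
    by (intro nth_equalityI) (auto simp: nth_default_def)
qed auto

lemma polytime_eq_nats [polytime_intros]:
  fixes f g :: "'a::encodable \<Rightarrow> nat list"
  assumes "polytime f" "polytime g" shows "polytime (\<lambda>x. f x = g x)"
proof (rule polytime_app2[OF _ assms])
  have "polytime (\<lambda>p :: nat list \<times> nat list. length (fst p) = length (snd p) \<and>
    (\<forall>i \<in> set [0..<length (fst p)]. nth_default 0 (fst p) i = nth_default (0::nat) (snd p) i))"
    by (intro polytime_intros)
  then show "polytime (\<lambda>p :: nat list \<times> nat list. fst p = snd p)"
    by (rule polytime_coerce) (simp only: nats_eq_iff[symmetric])
qed

lemma polytime_int [polytime_intros]: "polytime f \<Longrightarrow> polytime (\<lambda>x. int (f x))"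
  by (rule polytime_coerce[OF polytime_Pair[OF polytime_const[of "0::nat"]]]) (auto simp: enc_int_def' enc_int_def enc_nat_def)

lemma polytime_Harmless_Inst [polytime_intros]:
  "polytime n \<Longrightarrow> polytime es \<Longrightarrow> polytime ts \<Longrightarrow> polytime k \<Longrightarrow> polytime (\<lambda>x. Harmless_Inst (n x) (es x) (ts x) (k x))"
  by (rule polytime_coerce[of "\<lambda>x. (n x, es x, ts x, k x)"])
    (auto intro!: polytime_intros simp: enc_harmless_inst_def enc_nat_def enc_list_def enc_prod_def enc_pair_def enc_int_def')

section \<open>Parsing instances and composing reductions\<close>

text \<open>Every tree is the encoding of the list of trees along its right spine.\<close>

fun spine :: "tree \<Rightarrow> tree list" where
  "spine Leaf = []" | "spine (Node a b) = a # spine b"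

lemma enc_spine [simp]: "enc (spine x) = x"
  by (induction x) auto

lemma range_enc_list: "x \<in> range (enc_list e) \<longleftrightarrow> (\<forall>y \<in> set (spine x). y \<in> range e)"
proof
  show "x \<in> range (enc_list e) \<Longrightarrow> \<forall>y \<in> set (spine x). y \<in> range e"
  proof (elim rangeE)
    show "x = enc_list e xs \<Longrightarrow> \<forall>y \<in> set (spine x). y \<in> range e" for xs
      by (induction xs arbitrary: x) auto
  qed
  show "\<forall>y \<in> set (spine x). y \<in> range e \<Longrightarrow> x \<in> range (enc_list e)"
  proof (induction x)
    case Leaf
    have "Leaf = enc_list e []" by simp
    then show ?case by (rule range_eqI)
  next
    case (Node a b)
    then obtain y ys where "a = e y" "b = enc_list e ys" by auto
    then have "Node a b = enc_list e (y # ys)" by simp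
    then show ?case by (rule range_eqI)
  qed
qed

section \<open>Recognising the codes of circuit instances\<close>

definition is_nat :: "tree \<Rightarrow> bool" where
  "is_nat x \<longleftrightarrow> (\<forall>y \<in> set (spine x). y = Leaf)"

lemma is_nat_iff: "is_nat x \<longleftrightarrow> x \<in> range enc_nat"
proof
  show "is_nat x \<Longrightarrow> x \<in> range enc_nat"
  proof (induction x)
    case Leaf
    have "Leaf = enc_nat 0" by simp
    then show ?case by (rule range_eqI)
  next
    case (Node a b)
    then obtain m where "a = Leaf" "b = enc_nat m" by (auto simp: is_nat_def)
    then have "Node a b = enc_nat (Suc m)" by simp
    then show ?case by (rule range_eqI)
  qed
  show "x \<in> range enc_nat \<Longrightarrow> is_nat x"
  proof (elim rangeE)
    show "x = enc_nat m \<Longrightarrow> is_nat x" for m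
      by (induction m arbitrary: x) (auto simp: is_nat_def)
  qed
qed

definition is_gate :: "tree \<Rightarrow> bool" where
  "is_gate x \<longleftrightarrow> x \<noteq> Leaf \<and>
    (left x = enc_nat 0 \<and> right x = Leaf \<or> left x = enc_nat 1 \<and> is_nat (right x) \<or>
     (left x = enc_nat 2 \<or> left x = enc_nat 3) \<and> (\<forall>y \<in> set (spine (right x)). is_nat y))"

lemma is_gate_iff: "is_gate x \<longleftrightarrow> x \<in> range enc_gate"
proof
  assume x: "is_gate x"
  then obtain a b where ab: "x = Node a b" by (cases x) (auto simp: is_gate_def)
  consider "a = enc_nat 0" "b = Leaf" | "a = enc_nat 1" "b \<in> range enc_nat"
    | "a = enc_nat 2" "b \<in> range (enc_list enc_nat)" | "a = enc_nat 3" "b \<in> range (enc_list enc_nat)"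
    using x unfolding ab is_gate_def is_nat_iff range_enc_list[symmetric] by auto
  then show "x \<in> range enc_gate"
  proof cases
    case 1 then show ?thesis unfolding ab by (intro range_eqI[of _ _ Input]) simp
  next
    case 2
    then obtain j where "b = enc_nat j" by blast
    then show ?thesis using 2 unfolding ab by (intro range_eqI[of _ _ "Neg j"]) simp
  next
    case 3
    then obtain js where "b = enc_list enc_nat js" by blast
    then show ?thesis using 3 unfolding ab by (intro range_eqI[of _ _ "Conj js"]) simp
  next
    case 4
    then obtain js where "b = enc_list enc_nat js" by blast
    then show ?thesis using 4 unfolding ab by (intro range_eqI[of _ _ "Disj js"]) simp
  qed
next
  assume "x \<in> range enc_gate"
  then obtain g where g: "x = enc_gate g" by blast
  show "is_gate x"
    unfolding g is_gate_def is_nat_iff range_enc_list[symmetric] by (cases g) simp_all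
qed

definition is_circuit_inst :: "tree \<Rightarrow> bool" where
  "is_circuit_inst x \<longleftrightarrow> x \<noteq> Leaf \<and> (\<forall>y \<in> set (spine (left x)). is_gate y) \<and> is_nat (right x)"

lemma enc_circuit_inst: "enc = enc_pair (enc_list enc_gate) enc_nat"
  by (simp add: enc_prod_def enc_list_def enc_gate_def enc_nat_def)

lemma is_circuit_inst_iff: "is_circuit_inst x \<longleftrightarrow> x \<in> range (enc :: gate list \<times> nat \<Rightarrow> tree)"
  unfolding is_circuit_inst_def is_gate_iff is_nat_iff range_enc_list[symmetric] enc_circuit_inst enc_pair_def
  by (cases x) (auto simp: image_iff)

lemma polytime_spine [polytime_intros]: "polytime f \<Longrightarrow> polytime (\<lambda>x. spine (f x))"
  by (erule polytime_coerce) simp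

lemma polytime_left_tree [polytime_intros]: "polytime f \<Longrightarrow> polytime (\<lambda>x. left (f x))"
  by (rule polytime_comp[of left], rule polytime_left) simp_all

lemma polytime_right_tree [polytime_intros]: "polytime f \<Longrightarrow> polytime (\<lambda>x. right (f x))"
  by (rule polytime_comp[of right], rule polytime_right) simp_all

text \<open>\<open>T\<close> is a fixed tree, so induction on it produces a comparison program of
  constant size.\<close>

lemma polytime_eq_tree [polytime_intros]: "polytime f \<Longrightarrow> polytime (\<lambda>x. f x = (T::tree))"
proof (induction T arbitrary: f)
  case Leaf
  then show ?case using polytime_is_Leaf[of f] by simp
next
  case (Node a b)
  have "polytime (\<lambda>x. \<not> enc (f x) = Leaf \<and> left (f x) = a \<and> right (f x) = b)"
    by (intro polytime_conj polytime_not polytime_is_Leaf Node polytime_left_tree polytime_right_tree)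
  then show ?case
  proof (rule polytime_coerce)
    show "enc (f x = Node a b) = enc (\<not> enc (f x) = Leaf \<and> left (f x) = a \<and> right (f x) = b)" for x
      by (cases "f x") auto
  qed
qed

lemma polytime_is_nat [polytime_intros]: "polytime f \<Longrightarrow> polytime (\<lambda>x. is_nat (f x))"
  unfolding is_nat_def by (intro polytime_intros)

lemma polytime_is_circuit_inst: "polytime is_circuit_inst"
proof -
  have g: "polytime is_gate" unfolding is_gate_def[abs_def] by (intro polytime_intros)
  show ?thesis unfolding is_circuit_inst_def[abs_def]
    by (intro polytime_intros polytime_comp[OF g])
qed

text \<open>A reduction must be total on trees, but \<open>polytime\<close> says nothing about trees
  that are no codes; the test \<open>w\<close> sends them to a fixed \<open>y\<close>. No decoding
  takes place: on a code \<open>x\<close> the program for \<open>f\<close> runs on \<open>x\<close>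
  itself, since \<open>enc (inv enc x) = x\<close>.\<close>

lemma polytime_decode:
  fixes f :: "'a::encodable \<Rightarrow> 'b::encodable" and y :: tree
  assumes f: "polytime f" and w: "polytime w" and wf: "\<And>x. w x \<longleftrightarrow> x \<in> range (enc :: 'a \<Rightarrow> tree)"
  shows "polytime (\<lambda>x. if w x then enc (f (inv enc x)) else y)"
proof -
  obtain p c where p: "\<And>x. \<exists>t \<le> c * sz x ^ c. run p (enc x) (enc (f x)) t" using f unfolding polytime_def by blast
  obtain b a where b: "\<And>x :: tree. \<exists>t \<le> a * sz x ^ a. run b (enc x) (enc (w x)) t" using w unfolding polytime_def by blast
  obtain q d where q: "\<And>x :: tree. \<exists>t \<le> d * sz x ^ d. run q (enc x) (enc y) t"
    using polytime_const[of y] unfolding polytime_def by blast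
  show ?thesis
  proof (rule polytimeI[of "\<lambda>n. n + a * n ^ a + c * n ^ c + d * n ^ d" "Cond b p q"])
    fix x :: tree
    obtain r where r: "r \<le> a * sz x ^ a" "run b (enc x) (enc (w x)) r" using b by blast
    show "\<exists>t\<le>sz x + a * sz x ^ a + c * sz x ^ c + d * sz x ^ d.
        run (Cond b p q) (enc x) (enc (if w x then enc (f (inv enc x)) else y)) t"
    proof (cases "w x")
      case False
      obtain t where "t \<le> d * sz x ^ d" "run q (enc x) (enc y) t" using q by blast
      then show ?thesis using r False
        by (intro exI[of _ "sz x + r + t"] conjI) (auto intro: run_Cond_False)
    next
      case True
      then have x: "enc (inv enc x :: 'a) = x" using wf f_inv_into_f by metis
      obtain t where "t \<le> c * sz x ^ c" "run p (enc x) (enc (f (inv enc x))) t" using p[of "inv enc x"] x by auto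
      then show ?thesis using r True run_Cond_True[of b "enc x" "Node Leaf Leaf" r]
        by (intro exI[of _ "sz x + r + t"] conjI) auto
    qed
  qed (intro poly_bounded_intros)
qed

section \<open>Composition of reductions\<close>

lemma computable_nat_polytime:
  assumes "computable_nat f" "polytime h"
  shows "computable_nat (\<lambda>n. h (f n))"
proof -
  obtain p where p: "\<forall>n. \<exists>t. run p (enc_nat n) (enc_nat (f n)) t" using assms(1) unfolding computable_nat_def by blast
  obtain q where q: "\<forall>n. \<exists>t. run q (enc_nat n) (enc_nat (h n)) t"
    using assms(2) unfolding polytime_def enc_nat_def by blast
  have "\<exists>t. run (Seq p q) (enc_nat n) (enc_nat (h (f n))) t" for n
    using p q run_Seq by meson
  then show ?thesis unfolding computable_nat_def by blast
qed

text \<open>A polynomial in \<open>k * n ^ c\<close> is again a function of \<open>k\<close> times a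
  power of \<open>n\<close>. Monotonicity of \<open>g\<close> is what carries a mere upper bound on
  the intermediate parameter through.\<close>

lemma fpt_reducible_poly_trans:
  fixes R :: "tree \<Rightarrow> tree"
  assumes red: "P \<le>\<^sub>f\<^sub>p\<^sub>t Q" and R: "polytime R" and iff: "\<And>x. x \<in> fst Q \<longleftrightarrow> R x \<in> fst H"
    and g: "polytime g" "mono g" "\<And>x. snd H (R x) \<le> g (snd Q x)"
  shows "P \<le>\<^sub>f\<^sub>p\<^sub>t H"
proof -
  obtain S p f c h where "computable_nat f" "computable_nat h"
    and 1: "\<forall>x. (\<exists>t. run p x (S x) t \<and> t \<le> f (snd P x) * tree_size x ^ c) \<and>
           (x \<in> fst P \<longleftrightarrow> S x \<in> fst Q) \<and> snd Q (S x) \<le> h (snd P x)"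
    using red unfolding fpt_reducible_def by blast
  obtain q a where q: "\<And>x. \<exists>t \<le> a * tree_size x ^ a. run q x (R x) t"
    using R unfolding polytime_def by auto
  \<comment> \<open>The summands pay for the charge of \<open>Seq\<close>, for the first program,
    and for the second one on an input of size at most \<open>f (snd P x) * tree_size x ^ c\<close>.
    Their exponents \<open>1\<close>, \<open>c\<close> and \<open>c * a\<close> are all replaced by
    the sum.\<close>
  define F where "F m = 1 + m + a * m ^ a" for m :: nat
  have "polytime F" unfolding F_def[abs_def] by (intro polytime_intros)
  have time: "\<exists>t. run (Seq p q) x (R (S x)) t \<and> t \<le> F (f (snd P x)) * tree_size x ^ (1 + c + c * a)" for x
  proof -
    obtain t where t: "run p x (S x) t" "t \<le> f (snd P x) * tree_size x ^ c" using 1 by blast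
    obtain u where u: "run q (S x) (R (S x)) u" "u \<le> a * tree_size (S x) ^ a" using q by blast
    let ?n = "tree_size x" and ?k = "f (snd P x)"
    have n: "1 \<le> ?n" by (rule tree_size_pos)
    have e: "?n ^ i \<le> ?n ^ (1 + c + c * a)" if "i \<le> 1 + c + c * a" for i
      using n that by (rule power_increasing[rotated])
    have "tree_size (S x) \<le> ?k * ?n ^ c" using run_output_size[OF t(1)] t(2) by linarith
    then have "a * tree_size (S x) ^ a \<le> a * (?k * ?n ^ c) ^ a" by (intro mult_le_mono2 power_mono) auto
    with u(2) have "u \<le> a * (?k * ?n ^ c) ^ a" by (rule order.trans)
    also have "\<dots> = a * ?k ^ a * ?n ^ (c * a)" by (simp add: power_mult_distrib power_mult)
    also have "\<dots> \<le> a * ?k ^ a * ?n ^ (1 + c + c * a)" by (intro mult_le_mono2 e) simp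
    finally have u': "u \<le> a * ?k ^ a * ?n ^ (1 + c + c * a)" .
    have t': "t \<le> ?k * ?n ^ (1 + c + c * a)" by (rule order.trans[OF t(2)], rule mult_le_mono2, rule e) simp
    have n': "?n \<le> ?n ^ (1 + c + c * a)" using e[of 1] by simp
    have "run (Seq p q) x (R (S x)) (?n + t + u)" using t(1) u(1) by (rule run_Seq)
    moreover have "?n + t + u \<le> F ?k * ?n ^ (1 + c + c * a)"
      using add_mono[OF add_mono[OF n' t'] u'] by (simp only: F_def add_mult_distrib mult_1)
    ultimately show ?thesis by blast
  qed
  show ?thesis
    unfolding fpt_reducible_def
  proof (rule exI[of _ "\<lambda>x. R (S x)"], rule exI[of _ "Seq p q"], rule exI[of _ "\<lambda>k. F (f k)"],
      rule exI[of _ "1 + c + c * a"], rule exI[of _ "\<lambda>k. g (h k)"], intro conjI allI)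
    show "computable_nat (\<lambda>k. F (f k))" "computable_nat (\<lambda>k. g (h k))"
      using computable_nat_polytime \<open>computable_nat f\<close> \<open>computable_nat h\<close> \<open>polytime F\<close> g(1) by blast+
    fix x
    show "\<exists>t. run (Seq p q) x (R (S x)) t \<and> t \<le> F (f (snd P x)) * tree_size x ^ (1 + c + c * a)" by (rule time)
    show "x \<in> fst P \<longleftrightarrow> R (S x) \<in> fst H" using 1 iff by blast
    have "snd H (R (S x)) \<le> g (snd Q (S x))" by (rule g(3))
    also have "\<dots> \<le> g (h (snd P x))" using 1 g(2) by (auto dest: monoD)
    finally show "snd H (R (S x)) \<le> g (h (snd P x))" .
  qed
qed

section \<open>The spider gadget\<close>

text \<open>Vertices are numbered in blocks: \<open>J\<close> modulator vertices, called coordinates, then the \<open>N\<close> centres,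
  the \<open>N * p\<close> subdivision vertices and the \<open>N * p\<close> leaves of \<open>N\<close> spiders with \<open>p\<close> legs, called options.
  \<open>A i b j\<close> says that leaf \<open>b\<close> of option \<open>i\<close> is adjacent to coordinate \<open>j\<close>. The threshold of a
  coordinate requires that at least \<open>p\<close> of its neighbours are left out, provided that it has \<open>p\<close>.\<close>

definition gadget_inst :: "nat \<Rightarrow> nat \<Rightarrow> nat \<Rightarrow> nat \<Rightarrow> (nat \<Rightarrow> nat \<Rightarrow> nat \<Rightarrow> bool) \<Rightarrow> harmless_inst" where
  "gadget_inst N p J V A = Harmless_Inst (J + (N + (N * p + N * p)))
    (map (\<lambda>x. (J + fst x, J + (N + (fst x * p + snd x)))) (List.product [0..<N] [0..<p]) @
     map (\<lambda>x. (J + (N + (fst x * p + snd x)), J + (N + (N * p + (fst x * p + snd x))))) (List.product [0..<N] [0..<p]) @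
     map (\<lambda>x. (J + (N + (N * p + (fst (fst x) * p + snd (fst x)))), snd x))
       (filter (\<lambda>x. A (fst (fst x)) (snd (fst x)) (snd x))
         (List.product (List.product [0..<N] [0..<p]) [0..<J])))
    (map (\<lambda>j. Suc (length (filter (\<lambda>x. A (fst x) (snd x) j) (List.product [0..<N] [0..<p])) - p)) [0..<J] @
     replicate N 1 @ replicate (N * p) 2 @ replicate (N * p) 1)
    (int (p * (N - V) + V))"

lemma leg_less: "o' < (N::nat) \<Longrightarrow> b < p \<Longrightarrow> o' * p + b < N * p"
proof -
  assume "o' < N" "b < p"
  then have "o' * p + b < Suc o' * p" by simp
  also have "\<dots> \<le> N * p" using \<open>o' < N\<close> by (intro mult_le_mono1) simp
  finally show ?thesis .
qed

lemma leg_inject: "b < p \<Longrightarrow> b' < p \<Longrightarrow> o1 * p + b = o2 * p + b' \<longleftrightarrow> o1 = o2 \<and> b = (b'::nat)"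
proof
  assume *: "b < p" "b' < p" "o1 * p + b = o2 * p + b'"
  have "(o1 * p + b) div p = o1" using *(1) by simp
  moreover have "(o2 * p + b') div p = o2" using *(2) by simp
  ultimately have "o1 = o2" using *(3) by simp
  with * show "o1 = o2 \<and> b = b'" by simp
qed simp

lemma leg_surj: "i < (N::nat) * p \<Longrightarrow> \<exists>o' < N. \<exists>b < p. i = o' * p + b"
proof -
  assume i: "i < N * p"
  then have "0 < p" by (cases p) auto
  then have "i div p < N" "i mod p < p" "i = i div p * p + i mod p"
    using i by (simp_all add: less_mult_imp_div_less)
  then show ?thesis by blast
qed

section \<open>The graph of the gadget, its neighbourhoods and its modulator\<close>

locale gadget =
  fixes N p J V :: nat and A :: "nat \<Rightarrow> nat \<Rightarrow> nat \<Rightarrow> bool"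
begin

definition cen where "cen x = J + (x::nat)"
definition mid where "mid x = J + (N + (fst x * p + snd x))"
definition leaf where "leaf x = J + (N + (N * p + (fst x * p + (snd x :: nat))))"
definition "legs = {..<N} \<times> {..<p}"
text \<open>The degree of the coordinate \<open>j\<close>.\<close>

definition "cnt j = card {x \<in> legs. A (fst x) (snd x) j}"

abbreviation "I \<equiv> gadget_inst N p J V A"
abbreviation "G \<equiv> graph_of I"

lemma finite_legs: "finite legs" by (simp add: legs_def)
lemma card_legs: "card legs = N * p" by (simp add: legs_def card_cartesian_product)

lemma cen_eq: "cen x = cen y \<longleftrightarrow> x = y" by (simp add: cen_def)
lemma mid_eq: "x \<in> legs \<Longrightarrow> y \<in> legs \<Longrightarrow> mid x = mid y \<longleftrightarrow> x = y"
  by (cases x; cases y) (auto simp: mid_def legs_def leg_inject)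
lemma leaf_eq: "x \<in> legs \<Longrightarrow> y \<in> legs \<Longrightarrow> leaf x = leaf y \<longleftrightarrow> x = y"
  by (cases x; cases y) (auto simp: leaf_def legs_def leg_inject)

lemma bounds:
  "x \<in> legs \<Longrightarrow> J + N \<le> mid x" "x \<in> legs \<Longrightarrow> mid x < J + N + N * p"
  "x \<in> legs \<Longrightarrow> J + N + N * p \<le> leaf x" "x \<in> legs \<Longrightarrow> leaf x < J + N + N * p + N * p"
  "i < N \<Longrightarrow> J \<le> cen i" "i < N \<Longrightarrow> cen i < J + N"
  using leg_less[of "fst x" N "snd x" p] by (auto simp: mid_def leaf_def cen_def legs_def)

lemma neqs:
  "i < N \<Longrightarrow> x \<in> legs \<Longrightarrow> cen i \<noteq> mid x" "i < N \<Longrightarrow> x \<in> legs \<Longrightarrow> cen i \<noteq> leaf x"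
  "x \<in> legs \<Longrightarrow> y \<in> legs \<Longrightarrow> mid x \<noteq> leaf y" "i < N \<Longrightarrow> j < J \<Longrightarrow> cen i \<noteq> j"
  "x \<in> legs \<Longrightarrow> j < J \<Longrightarrow> mid x \<noteq> j" "x \<in> legs \<Longrightarrow> j < J \<Longrightarrow> leaf x \<noteq> j"
  using bounds(1-4)[of x] bounds(1-4)[of y] bounds(5,6)[of i] by linarith+

lemma vertex_cases:
  assumes "v < J + (N + (N * p + N * p))"
  obtains (modul) "v < J" | (cen) i where "i < N" "v = cen i"
    | (mid) x where "x \<in> legs" "v = mid x" | (leaf) x where "x \<in> legs" "v = leaf x"
proof -
  consider "v < J" | "J \<le> v" "v < J + N" | "J + N \<le> v" "v < J + N + N * p"
    | "J + N + N * p \<le> v" using assms by linarith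
  then show thesis
  proof cases
    case 2 then show ?thesis using cen[of "v - J"] by (simp add: cen_def)
  next
    case 3
    then have "v - (J + N) < N * p" by linarith
    from leg_surj[OF this] obtain i b where "i < N" "b < p" "v - (J + N) = i * p + b" by blast
    then show ?thesis using 3 mid[of "(i, b)"] by (simp add: mid_def legs_def)
  next
    case 4
    then have "v - (J + N + N * p) < N * p" using assms by linarith
    from leg_surj[OF this] obtain i b where "i < N" "b < p" "v - (J + N + N * p) = i * p + b" by blast
    then show ?thesis using 4 leaf[of "(i, b)"] by (simp add: leaf_def legs_def)
  qed (rule modul)
qed

lemma verts_G: "verts G = {..<J + (N + (N * p + N * p))}"
  by (auto simp: graph_of_def gadget_inst_def)

lemma edges_G: "edges G = (\<lambda>x. {cen (fst x), mid x}) ` legs \<union> (\<lambda>x. {mid x, leaf x}) ` legs \<union>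
    (\<lambda>(x, j). {leaf x, j}) ` {(x, j). x \<in> legs \<and> j < J \<and> A (fst x) (snd x) j}"
  unfolding graph_of_def gadget_inst_def harmless_inst.sel snd_conv set_append set_map image_Un
    image_image set_filter set_product prod.case cen_def mid_def leaf_def legs_def atLeast0LessThan set_upt
  by (intro arg_cong2[where f = "(\<union>)"] Un_assoc[symmetric, THEN trans]) (auto simp: image_def)

lemma length_filter_product: "length (filter (\<lambda>x. A (fst x) (snd x) j) (List.product [0..<N] [0..<p])) = cnt j"
proof -
  have "distinct (filter (\<lambda>x. A (fst x) (snd x) j) (List.product [0..<N] [0..<p]))"
    by (simp add: distinct_product)
  from distinct_card[OF this] show ?thesis
    unfolding cnt_def by (simp add: legs_def atLeast0LessThan)
qed

lemma thr_mod: "j < J \<Longrightarrow> thresholds I ! j = Suc (cnt j - p)"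
  by (simp add: gadget_inst_def nth_append length_filter_product)

lemma thr_cen: "i < N \<Longrightarrow> thresholds I ! cen i = 1"
  by (simp add: gadget_inst_def nth_append cen_def)

lemma thr_mid: "x \<in> legs \<Longrightarrow> thresholds I ! mid x = 2"
  using leg_less[of "fst x" N "snd x" p]
  by (auto simp: gadget_inst_def nth_append mid_def legs_def)

lemma thr_leaf: "x \<in> legs \<Longrightarrow> thresholds I ! leaf x = 1"
  using leg_less[of "fst x" N "snd x" p]
  by (auto simp: gadget_inst_def nth_append leaf_def legs_def)

lemma cen_vert: "i < N \<Longrightarrow> cen i \<in> verts G" using bounds(6)[of i] by (simp add: verts_G)
lemma mid_vert: "x \<in> legs \<Longrightarrow> mid x \<in> verts G" using bounds(2)[of x] by (simp add: verts_G)
lemma leaf_vert: "x \<in> legs \<Longrightarrow> leaf x \<in> verts G" using bounds(4)[of x] by (simp add: verts_G)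

lemma legs_fst: "x \<in> legs \<Longrightarrow> fst x < N" by (auto simp: legs_def)

lemmas distinct_verts = neqs neqs[symmetric] cen_eq mid_eq leaf_eq legs_fst

lemma nb_cen: "i < N \<Longrightarrow> neighbours G (cen i) = mid ` {x \<in> legs. fst x = i}"
  by (auto simp: neighbours_def edges_G doubleton_eq_iff distinct_verts legs_def mid_vert)

lemma nb_mid: "x \<in> legs \<Longrightarrow> neighbours G (mid x) = {cen (fst x), leaf x}"
  by (auto simp: neighbours_def edges_G doubleton_eq_iff distinct_verts legs_def cen_vert leaf_vert)

lemma nb_leaf:
  assumes x: "x \<in> legs"
  shows "neighbours G (leaf x) = insert (mid x) {j. j < J \<and> A (fst x) (snd x) j}"
proof
  show "neighbours G (leaf x) \<subseteq> insert (mid x) {j. j < J \<and> A (fst x) (snd x) j}"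
    using x by (auto simp: neighbours_def edges_G doubleton_eq_iff distinct_verts legs_def)
  have "{mid x, leaf x} \<in> edges G" unfolding edges_G using x by blast
  moreover have "{j, leaf x} \<in> edges G" if "j < J" "A (fst x) (snd x) j" for j
    unfolding edges_G insert_commute[of j] using x that by (intro UnI2 image_eqI[of _ _ "(x, j)"]) auto
  ultimately show "insert (mid x) {j. j < J \<and> A (fst x) (snd x) j} \<subseteq> neighbours G (leaf x)"
    using mid_vert[OF x] by (auto simp: neighbours_def verts_G)
qed

lemma nb_mod: "j < J \<Longrightarrow> neighbours G j = leaf ` {x \<in> legs. A (fst x) (snd x) j}"
  by (auto simp: neighbours_def edges_G doubleton_eq_iff distinct_verts legs_def leaf_vert)

lemma wf_gadget_inst: "wf_harmless_inst I"
proof -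
  have "set (thresholds I) \<subseteq> {0<..}" by (auto simp: gadget_inst_def)
  moreover have "u < vertex_count I \<and> v < vertex_count I \<and> u \<noteq> v" if "(u, v) \<in> set (edge_list I)" for u v
  proof -
    have "\<exists>x \<in> legs. (u, v) = (cen (fst x), mid x) \<or> (u, v) = (mid x, leaf x) \<or> (u = leaf x \<and> v < J)"
      using that by (force simp: gadget_inst_def cen_def mid_def leaf_def legs_def)
    then consider x where "x \<in> legs" "u = cen (fst x)" "v = mid x"
      | x where "x \<in> legs" "u = mid x" "v = leaf x" | x where "x \<in> legs" "u = leaf x" "v < J"
      by blast
    then show ?thesis
    proof cases
      case 1 then show ?thesis using bounds(1-4)[of x] bounds(5,6)[of "fst x"] legs_fst[of x]
        by (simp add: gadget_inst_def)
    next
      case 2 then show ?thesis using bounds(1-4)[of x] by (simp add: gadget_inst_def)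
    next
      case 3 then show ?thesis using bounds(1-4)[of x] by (simp add: gadget_inst_def)
    qed
  qed
  moreover have "length (thresholds I) = vertex_count I" by (simp add: gadget_inst_def)
  ultimately show ?thesis unfolding wf_harmless_inst_def by auto
qed

definition spider where
  "spider i = (insert (cen i) (mid ` {x \<in> legs. fst x = i} \<union> leaf ` {x \<in> legs. fst x = i}),
     (\<lambda>x. {cen (fst x), mid x}) ` {x \<in> legs. fst x = i} \<union> (\<lambda>x. {mid x, leaf x}) ` {x \<in> legs. fst x = i})"

lemma two_spider_spider:
  assumes i: "i < N"
  shows "two_spider (spider i)"
proof -
  let ?X = "{x \<in> legs. fst x = i}"
  \<comment> \<open>Before subdivision the centre is joined directly to the leaves;
    \<open>mid x\<close> then subdivides the edge to \<open>leaf x\<close>.\<close>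
  define H where "H = (insert (cen i) (leaf ` ?X), (\<lambda>l. {cen i, l}) ` leaf ` ?X)"
  have "star H"
    unfolding star_def H_def using finite_legs neqs(2) i
    by (intro exI[of _ "cen i"] exI[of _ "leaf ` ?X"]) (auto simp: distinct_verts)
  moreover have "subdivided_at_most_once H (spider i)"
  proof -
    \<comment> \<open>New vertices are indexed by edges, so the leg has to be recovered from its
      edge; its leaf determines it.\<close>
    define w where "w e = mid (THE x. x \<in> ?X \<and> e = {cen i, leaf x})" for e
    have w: "w {cen i, leaf x} = mid x" if "x \<in> ?X" for x
    proof -
      have "(THE y. y \<in> ?X \<and> {cen i, leaf x} = {cen i, leaf y}) = x"
        using that i by (intro the_equality) (auto simp: doubleton_eq_iff distinct_verts legs_def)
      then show ?thesis by (simp add: w_def)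
    qed
    have wi: "w ` edges H = mid ` ?X"
      unfolding H_def snd_conv image_image using w by (intro image_cong) auto
    show ?thesis
      unfolding subdivided_at_most_once_def
    proof (intro exI[of _ "edges H"] exI[of _ w] conjI)
      show "inj_on w (edges H)"
        unfolding H_def by (auto simp: inj_on_def w mid_eq)
      show "w ` edges H \<inter> verts H = {}"
        unfolding wi using i by (auto simp: H_def distinct_verts)
      show "verts (spider i) = verts H \<union> w ` edges H"
        unfolding wi by (auto simp: H_def spider_def)
      have "{{u, w e} |u e. e \<in> edges H \<and> u \<in> e} =
          (\<Union>x \<in> ?X. {{cen i, w {cen i, leaf x}}, {leaf x, w {cen i, leaf x}}})"
        unfolding H_def by auto
      also have "\<dots> = (\<Union>x \<in> ?X. {{cen i, mid x}, {leaf x, mid x}})"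
        by (intro SUP_cong refl) (simp add: w)
      also have "\<dots> = edges (spider i)"
        unfolding spider_def by (auto simp: insert_commute)
      finally show "edges (spider i) = edges H - edges H \<union> {{u, w e} |u e. e \<in> edges H \<and> u \<in> e}"
        by simp
    qed simp
  qed
  ultimately show ?thesis unfolding two_spider_def by blast
qed

lemma modulator: "spider_modulator G {..<J}"
proof -
  have ge: "x \<in> legs \<Longrightarrow> J \<le> mid x" "i < N \<Longrightarrow> J \<le> cen i" "x \<in> legs \<Longrightarrow> J \<le> leaf x" for x i
    using bounds(1,3)[of x] bounds(5)[of i] by linarith+
  have "two_spider_forest (delete_verts G {..<J})"
    unfolding two_spider_forest_def
  proof (intro exI[of _ "spider ` {..<N}"] conjI)
    show "\<forall>H \<in> spider ` {..<N}. two_spider H" by (auto intro: two_spider_spider)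
    show "pairwise (\<lambda>H H'. verts H \<inter> verts H' = {}) (spider ` {..<N})"
    proof (rule pairwiseI)
      fix H H' assume "H \<in> spider ` {..<N}" "H' \<in> spider ` {..<N}" "H \<noteq> H'"
      then obtain i i' where "i < N" "i' < N" "i \<noteq> i'" "H = spider i" "H' = spider i'" by auto
      then show "verts H \<inter> verts H' = {}"
        by (auto simp: spider_def distinct_verts)
    qed
    show "verts (delete_verts G {..<J}) = (\<Union>H \<in> spider ` {..<N}. verts H)"
    proof (rule set_eqI)
      fix v
      show "v \<in> verts (delete_verts G {..<J}) \<longleftrightarrow> v \<in> (\<Union>H \<in> spider ` {..<N}. verts H)"
      proof
        assume "v \<in> verts (delete_verts G {..<J})"
        then have v: "v < J + (N + (N * p + N * p))" "J \<le> v" by (auto simp: delete_verts_def verts_G)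
        from v(1) show "v \<in> (\<Union>H \<in> spider ` {..<N}. verts H)"
          by (cases rule: vertex_cases) (use v(2) legs_fst in \<open>auto simp: spider_def\<close>)
      next
        assume "v \<in> (\<Union>H \<in> spider ` {..<N}. verts H)"
        then obtain i where "i < N" "v = cen i \<or> (\<exists>x \<in> legs. v = mid x \<or> v = leaf x)"
          by (auto simp: spider_def)
        then have "v \<in> verts G \<and> J \<le> v"
          using ge cen_vert mid_vert leaf_vert by blast
        then show "v \<in> verts (delete_verts G {..<J})" by (auto simp: delete_verts_def)
      qed
    qed
    have split: "{e \<in> E1 \<union> E2 \<union> E3. P e} = E1 \<union> E2"
      if "\<forall>e \<in> E1. P e" "\<forall>e \<in> E2. P e" "\<forall>e \<in> E3. \<not> P e" for E1 E2 E3 :: "nat set set" and P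
      using that by blast
    have "edges (delete_verts G {..<J}) = (\<lambda>x. {cen (fst x), mid x}) ` legs \<union> (\<lambda>x. {mid x, leaf x}) ` legs"
      unfolding delete_verts_def edges_G snd_conv
    proof (rule split)
      show "\<forall>e \<in> (\<lambda>x. {cen (fst x), mid x}) ` legs. e \<inter> {..<J} = {}"
        using ge(1) ge(2)[OF legs_fst] by (auto simp: not_less)
      show "\<forall>e \<in> (\<lambda>x. {mid x, leaf x}) ` legs. e \<inter> {..<J} = {}"
        using ge(1,3) by (auto simp: not_less)
    qed auto
    also have "\<dots> = (\<Union>i<N. (\<lambda>x. {cen (fst x), mid x}) ` {x \<in> legs. fst x = i} \<union>
        (\<lambda>x. {mid x, leaf x}) ` {x \<in> legs. fst x = i})"
      using legs_fst by blast
    also have "\<dots> = (\<Union>H \<in> spider ` {..<N}. edges H)"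
      by (simp add: spider_def)
    finally show "edges (delete_verts G {..<J}) = (\<Union>H \<in> spider ` {..<N}. edges H)" .
  qed
  then show ?thesis unfolding spider_modulator_def by (auto simp: verts_G)
qed

lemma modulator_size: "spider_modulator_size G \<le> J"
  unfolding spider_modulator_size_def
  by (rule Least_le) (use modulator in \<open>auto intro!: exI[of _ "{..<J}"]\<close>)

text \<open>The number of neighbours that coordinate \<open>j\<close> loses when option
  \<open>i\<close> is switched on.\<close>

definition u where "u i j = card {b. b < p \<and> A i b j}"

lemma card_rows: 
  assumes "X \<subseteq> {..<N}"
  shows "card {x \<in> legs. fst x \<in> X \<and> A (fst x) (snd x) j} = (\<Sum>i \<in> X. u i j)"
proof -
  have "{x \<in> legs. fst x \<in> X \<and> A (fst x) (snd x) j} = Sigma X (\<lambda>i. {b. b < p \<and> A i b j})"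
    using assms by (auto simp: legs_def)
  then show ?thesis using assms finite_subset[OF assms] by (simp add: u_def)
qed

text \<open>If \<open>X\<close> is switched on, the summands count the neighbours of
  \<open>j\<close> that are left out and those that are chosen. For \<open>cnt j \<ge> p\<close> the
  threshold of \<open>j\<close> thus says that the first summand is at least
  \<open>p\<close>.\<close>

lemma cnt_split:
  assumes "X \<subseteq> {..<N}"
  shows "cnt j = (\<Sum>i \<in> X. u i j) + card {x \<in> legs. fst x \<notin> X \<and> A (fst x) (snd x) j}"
proof -
  have "cnt j = (\<Sum>i \<in> {..<N}. u i j)"
  proof -
    have "{x \<in> legs. A (fst x) (snd x) j} = {x \<in> legs. fst x \<in> {..<N} \<and> A (fst x) (snd x) j}"
      using legs_fst by auto
    then show ?thesis using card_rows[of "{..<N}" j] by (simp only: cnt_def)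
  qed
  also have "\<dots> = (\<Sum>i \<in> {..<N} - X. u i j) + (\<Sum>i \<in> X. u i j)"
    using assms by (simp add: sum.subset_diff)
  also have "(\<Sum>i \<in> {..<N} - X. u i j) = card {x \<in> legs. fst x \<in> {..<N} - X \<and> A (fst x) (snd x) j}"
    by (rule card_rows[symmetric]) auto
  also have "{x \<in> legs. fst x \<in> {..<N} - X \<and> A (fst x) (snd x) j} = {x \<in> legs. fst x \<notin> X \<and> A (fst x) (snd x) j}"
    using legs_fst by auto
  finally show ?thesis by simp
qed

end

text \<open>In a solution exactly one option of every class is switched on, namely the one whose centre is
  chosen; all leaves of the other options are chosen.\<close>

locale gadget_classes = gadget +
  fixes cl :: "nat \<Rightarrow> 'c" and CV :: "'c set"
  assumes p: "p \<ge> 2" and CV: "finite CV" "card CV = V" "cl ` {..<N} \<subseteq> CV"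
    and cnt_ge: "\<And>j. j < J \<Longrightarrow> p \<le> cnt j"
    and selector: "\<And>v. v \<in> CV \<Longrightarrow> \<exists>j < J. \<forall>i < N. \<forall>b < p. A i b j \<longleftrightarrow> cl i = v"
begin

lemma V_le_N: "V \<le> N"
proof -
  have "v \<in> cl ` {..<N}" if v: "v \<in> CV" for v
  proof -
    obtain j where j: "j < J" "\<And>i b. i < N \<Longrightarrow> b < p \<Longrightarrow> A i b j \<longleftrightarrow> cl i = v" using selector[OF v] by blast
    have "cnt j > 0" using cnt_ge[OF j(1)] p by linarith
    then obtain x where "x \<in> legs" "A (fst x) (snd x) j" unfolding cnt_def card_gt_0_iff by blast
    then show ?thesis using j(2) by (auto simp: legs_def)
  qed
  then have "card CV \<le> card (cl ` {..<N})" by (intro card_mono) auto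
  also have "\<dots> \<le> N" using card_image_le[of "{..<N}" cl] by simp
  finally show ?thesis using CV by simp
qed

text \<open>Threshold 1 of a leaf keeps all its neighbours out of \<open>S\<close>; these include
  every subdivision vertex and, as \<open>cnt j \<ge> p > 0\<close>, every coordinate. Threshold 2
  of a subdivision vertex forbids choosing both the centre and the leaf of its leg.\<close>

lemma harmless_structure:
  assumes S: "harmless G ((!) (thresholds I)) S"
  defines "X \<equiv> {i. i < N \<and> cen i \<in> S}" and "Y \<equiv> {x \<in> legs. leaf x \<in> S}"
  shows "S = cen ` X \<union> leaf ` Y" "\<And>x. x \<in> Y \<Longrightarrow> fst x \<notin> X"
    "\<And>j. j < J \<Longrightarrow> card {x \<in> Y. A (fst x) (snd x) j} \<le> cnt j - p"
proof -
  have fin: "finite (verts G)" by (simp add: verts_G)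
  have h: "card (neighbours G v \<inter> S) < thresholds I ! v" if "v \<in> verts G" for v
    using S that unfolding harmless_def by blast
  have fn: "finite (neighbours G v)" for v unfolding neighbours_def using fin by simp
  have leaf0: "neighbours G (leaf x) \<inter> S = {}" if "x \<in> legs" for x
    using h[OF leaf_vert[OF that]] thr_leaf[OF that] fn by (simp add: card_eq_0_iff)
  then have mid: "mid x \<notin> S" if "x \<in> legs" for x using that nb_leaf[OF that] by blast
  have modul: "j \<notin> S" if "j < J" for j
  proof -
    have "cnt j > 0" using cnt_ge[OF that] p by linarith
    then obtain x where "x \<in> legs" "A (fst x) (snd x) j" unfolding cnt_def card_gt_0_iff by blast
    then show ?thesis using leaf0[of x] nb_leaf[of x] that by blast
  qed
  have "v \<in> cen ` X \<union> leaf ` Y" if "v \<in> S" for v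
  proof -
    have "v < J + (N + (N * p + N * p))" using S that unfolding harmless_def verts_G by blast
    then show ?thesis
      by (cases rule: vertex_cases) (use that mid modul in \<open>auto simp: X_def Y_def\<close>)
  qed
  then show "S = cen ` X \<union> leaf ` Y" by (auto simp: X_def Y_def)
  show "fst x \<notin> X" if "x \<in> Y" for x
  proof
    assume "fst x \<in> X"
    then have "neighbours G (mid x) \<inter> S = {cen (fst x), leaf x}" "x \<in> legs" "cen (fst x) \<noteq> leaf x"
      using that nb_mid[of x] neqs(2)[of "fst x" x] by (auto simp: X_def Y_def)
    then show False using h[OF mid_vert] thr_mid by fastforce
  qed
  show "card {x \<in> Y. A (fst x) (snd x) j} \<le> cnt j - p" if "j < J" for j
  proof -
    have "neighbours G j \<inter> S = leaf ` {x \<in> Y. A (fst x) (snd x) j}"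
      unfolding nb_mod[OF that] by (auto simp: Y_def)
    moreover have "inj_on leaf {x \<in> Y. A (fst x) (snd x) j}" by (auto simp: inj_on_def Y_def leaf_eq)
    ultimately have "card {x \<in> Y. A (fst x) (snd x) j} = card (neighbours G j \<inter> S)" by (simp add: card_image)
    also have "\<dots> < Suc (cnt j - p)" using h[of j] thr_mod[OF that] that by (simp add: verts_G)
    finally show ?thesis by simp
  qed
qed

text \<open>The neighbours of a selector are exactly the leaves of one class, so its threshold
  leaves at least \<open>p\<close> of them out. The \<open>V\<close> classes partition the legs,
  hence at least \<open>p * V\<close> leaves are missing.\<close>

lemma card_leaves_le:
  assumes Y: "Y \<subseteq> legs" "\<And>j. j < J \<Longrightarrow> card {x \<in> Y. A (fst x) (snd x) j} \<le> cnt j - p"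
  shows "card Y \<le> p * (N - V)"
proof -
  have fY: "finite Y" using Y(1) finite_legs by (rule finite_subset)
  have *: "card {x \<in> Y. cl (fst x) = v} + p \<le> card {x \<in> legs. cl (fst x) = v}" if v: "v \<in> CV" for v
  proof -
    obtain j where j: "j < J" "\<And>i b. i < N \<Longrightarrow> b < p \<Longrightarrow> A i b j \<longleftrightarrow> cl i = v" using selector[OF v] by blast
    have "A (fst x) (snd x) j \<longleftrightarrow> cl (fst x) = v" if "x \<in> legs" for x
      using that j(2) by (auto simp: legs_def)
    then have "{x \<in> Y. A (fst x) (snd x) j} = {x \<in> Y. cl (fst x) = v}"
      "{x \<in> legs. A (fst x) (snd x) j} = {x \<in> legs. cl (fst x) = v}" using Y(1) by blast+
    then show ?thesis using Y(2)[OF j(1)] cnt_ge[OF j(1)] unfolding cnt_def by simp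
  qed
  have part: "card Z = (\<Sum>v \<in> CV. card {x \<in> Z. cl (fst x) = v})" if "Z \<subseteq> legs" for Z
  proof -
    have "Z = (\<Union>v \<in> CV. {x \<in> Z. cl (fst x) = v})" using that CV(3) legs_fst by blast
    moreover have "card (\<Union>v \<in> CV. {x \<in> Z. cl (fst x) = v}) = (\<Sum>v \<in> CV. card {x \<in> Z. cl (fst x) = v})"
      using CV(1) finite_subset[OF that finite_legs] by (intro card_UN_disjoint) auto
    ultimately show ?thesis by simp
  qed
  have "card Y + p * V = (\<Sum>v \<in> CV. card {x \<in> Y. cl (fst x) = v} + p)"
    using part[OF Y(1)] CV(2) by (simp add: sum.distrib)
  also have "\<dots> \<le> (\<Sum>v \<in> CV. card {x \<in> legs. cl (fst x) = v})" using * by (rule sum_mono)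
  also have "\<dots> = N * p" using part[of legs] card_legs by simp
  finally show ?thesis using V_le_N by (simp add: diff_mult_distrib2 mult.commute)
qed

text \<open>The bound on leaves forces at least \<open>V\<close> centres, and more of them cannot
  pay off. With exactly \<open>V\<close> centres the target can only be met by taking every leaf of
  the other options, so the left-out neighbours of a coordinate are those of the chosen options, and
  its threshold becomes a condition on \<open>X\<close>.\<close>

lemma yes_iff:
  "yes_harmless_inst I \<longleftrightarrow> (\<exists>X \<subseteq> {..<N}. card X = V \<and> (\<forall>j < J. p \<le> (\<Sum>i \<in> X. u i j)))"
proof
  assume "yes_harmless_inst I"
  then obtain S where S: "harmless G ((!) (thresholds I)) S" and "int (card S) \<ge> target I"
    unfolding yes_harmless_inst_def by blast
  moreover have "target I = int (p * (N - V) + V)" by (simp only: gadget_inst_def harmless_inst.sel)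
  ultimately have cS: "p * (N - V) + V \<le> card S" by linarith
  define X where "X = {i. i < N \<and> cen i \<in> S}"
  define Y where "Y = {x \<in> legs. leaf x \<in> S}"
  note str = harmless_structure[OF S, folded X_def Y_def]
  have X: "X \<subseteq> {..<N}" and Y: "Y \<subseteq> legs" by (auto simp: X_def Y_def)
  have fin: "finite X" "finite Y" using X Y finite_legs finite_subset by auto
  have "card S \<le> card (cen ` X) + card (leaf ` Y)" using str(1) card_Un_le by metis
  also have "\<dots> \<le> card X + card Y" using fin by (intro add_mono card_image_le)
  finally have XY: "p * (N - V) + V \<le> card X + card Y" using cS by linarith
  have cY: "card Y \<le> p * (N - V)" using card_leaves_le[OF Y str(3)] .
  then have "V \<le> card X" using XY by linarith
  have sub: "Y \<subseteq> ({..<N} - X) \<times> {..<p}" using str(2) Y by (auto simp: legs_def)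
  have cc: "card (({..<N} - X) \<times> {..<p}) = (N - card X) * p"
    using X fin by (simp add: card_cartesian_product card_Diff_subset)
  have cY': "card Y \<le> (N - card X) * p" using card_mono[OF _ sub] cc by simp
  have "card X \<le> N" using card_mono[OF _ X] by simp
  \<comment> \<open>Each of the \<open>d\<close> centres beyond \<open>V\<close> adds one vertex and
    removes \<open>p \<ge> 2\<close> leaves from the maximum.\<close>
  have cX: "card X = V"
  proof (rule ccontr)
    assume "card X \<noteq> V"
    then obtain d where d: "card X = V + d" "d \<ge> 1" using \<open>V \<le> card X\<close> le_Suc_ex by fastforce
    then have "(N - V) = (N - card X) + d" using \<open>card X \<le> N\<close> by linarith
    then have "p * (N - V) = (N - card X) * p + p * d" by (simp add: algebra_simps)
    moreover have "2 * d \<le> p * d" using p by simp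
    ultimately show False using XY cY' d by linarith
  qed
  then have "card (({..<N} - X) \<times> {..<p}) \<le> card Y" using XY unfolding cc by (simp add: mult.commute)
  then have Yeq: "Y = ({..<N} - X) \<times> {..<p}" by (intro card_seteq sub) auto
  have "p \<le> (\<Sum>i \<in> X. u i j)" if j: "j < J" for j
  proof -
    have eq: "{x \<in> Y. A (fst x) (snd x) j} = {x \<in> legs. fst x \<notin> X \<and> A (fst x) (snd x) j}"
      unfolding Yeq legs_def by auto
    show ?thesis using str(3)[OF j] unfolding eq using cnt_split[OF X, of j] cnt_ge[OF j] by linarith
  qed
  then show "\<exists>X \<subseteq> {..<N}. card X = V \<and> (\<forall>j < J. p \<le> (\<Sum>i \<in> X. u i j))" using X cX by blast
next
  assume "\<exists>X \<subseteq> {..<N}. card X = V \<and> (\<forall>j < J. p \<le> (\<Sum>i \<in> X. u i j))"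
  then obtain X where X: "X \<subseteq> {..<N}" "card X = V" "\<And>j. j < J \<Longrightarrow> p \<le> (\<Sum>i \<in> X. u i j)" by blast
  define Y where "Y = ({..<N} - X) \<times> {..<p}"
  define S where "S = cen ` X \<union> leaf ` Y"
  have Y: "Y \<subseteq> legs" by (auto simp: Y_def legs_def)
  have fin: "finite X" "finite Y" using X(1) finite_subset by (auto simp: Y_def)
  have memS: "cen i \<in> S \<longleftrightarrow> i \<in> X" if "i < N" for i
    using that Y by (auto simp: S_def distinct_verts)
  have memL: "leaf x \<in> S \<longleftrightarrow> x \<in> Y" if "x \<in> legs" for x
  proof -
    have "leaf x \<noteq> cen i" if "i \<in> X" for i using \<open>x \<in> legs\<close> that X(1) neqs(2)[of i x] by auto
    then show ?thesis using that Y by (auto simp: S_def leaf_eq subset_iff)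
  qed
  have nmid: "mid x \<notin> S" if "x \<in> legs" for x
    using that X(1) Y by (auto simp: S_def distinct_verts subset_iff)
  have nmod: "j \<notin> S" if "j < J" for j
  proof
    assume "j \<in> S"
    then have "(\<exists>i \<in> X. j = cen i) \<or> (\<exists>x \<in> Y. j = leaf x)" unfolding S_def by blast
    then show False using that neqs(4,6) X(1) Y by blast
  qed
  have "harmless G ((!) (thresholds I)) S"
    unfolding harmless_def
  proof (intro conjI ballI)
    show "S \<subseteq> verts G" using X(1) Y cen_vert leaf_vert by (auto simp: S_def)
    fix v assume "v \<in> verts G"
    then have "v < J + (N + (N * p + N * p))" by (simp add: verts_G)
    then show "card (neighbours G v \<inter> S) < thresholds I ! v"
    proof (cases rule: vertex_cases)
      case modul
      have "neighbours G v \<inter> S = leaf ` {x \<in> legs. fst x \<notin> X \<and> A (fst x) (snd x) v}"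
        unfolding nb_mod[OF modul] using memL by (auto simp: Y_def legs_def)
      then have "card (neighbours G v \<inter> S) \<le> card {x \<in> legs. fst x \<notin> X \<and> A (fst x) (snd x) v}"
        using finite_legs by (simp add: card_image_le)
      then show ?thesis using thr_mod[OF modul] cnt_split[OF X(1), of v] X(3)[OF modul] by linarith
    next
      case (cen i)
      then have "neighbours G v \<inter> S = {}" using nb_cen[of i] nmid by auto
      then show ?thesis using cen thr_cen by simp
    next
      case (mid x)
      have "neighbours G v \<inter> S \<subseteq> (if x \<in> Y then {leaf x} else {cen (fst x)})"
        using mid nb_mid[of x] memL[of x] memS[of "fst x"] legs_fst by (auto simp: Y_def)
      then have "card (neighbours G v \<inter> S) \<le> card (if x \<in> Y then {leaf x} else {cen (fst x)})"
        by (intro card_mono) auto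
      then have "card (neighbours G v \<inter> S) \<le> 1" by (simp split: if_splits)
      then show ?thesis using mid thr_mid by simp
    next
      case (leaf x)
      then have "neighbours G v \<inter> S = {}" using nb_leaf[of x] nmid nmod by auto
      then show ?thesis using leaf thr_leaf by simp
    qed
  qed
  moreover have "card S = p * (N - V) + V"
  proof -
    have "cen i \<noteq> leaf x" if "i \<in> X" "x \<in> Y" for i x using neqs(2)[of i x] that X(1) Y by blast
    then have "card S = card (cen ` X) + card (leaf ` Y)"
      unfolding S_def using fin by (intro card_Un_disjoint) auto
    also have "card (leaf ` Y) = card Y" using Y by (intro card_image) (auto simp: inj_on_def leaf_eq subset_iff)
    also have "card (cen ` X) = card X" by (intro card_image) (auto simp: inj_on_def cen_eq)
    also have "card Y = (N - V) * p"
      using X(1,2) fin by (simp add: Y_def card_cartesian_product card_Diff_subset)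
    finally show ?thesis using X(2) by (simp add: mult.commute)
  qed
  ultimately show "yes_harmless_inst I"
    unfolding yes_harmless_inst_def by (auto simp: gadget_inst_def)
qed

end

section \<open>Constraint satisfaction as a harmless set\<close>

text \<open>A coordinate \<open>(Q, Q', q)\<close> compares the values given to \<open>q\<close> by the options for \<open>Q\<close> and \<open>Q'\<close>:
  the legs below the first value and those from the second value on must together be all legs.
  For \<open>Q = Q'\<close> it requires that some option for \<open>Q\<close> is switched on.\<close>

definition linked :: "(nat \<times> nat) list \<Rightarrow> nat \<Rightarrow> nat list \<times> nat list \<times> nat \<Rightarrow> bool" where
  "linked al b d \<longleftrightarrow>
    (map fst al = fst d \<and> (\<forall>e \<in> set al. fst e = snd (snd d) \<longrightarrow> b < snd e)) \<or>
    (map fst al = fst (snd d) \<and> (\<forall>e \<in> set al. fst e = snd (snd d) \<longrightarrow> snd e \<le> b))"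

text \<open>Repetitions are allowed, so for \<open>L \<ge> 1\<close> the tuples also cover all
  nonempty sets of fewer than \<open>L\<close> variables.\<close>

definition scopes :: "nat \<Rightarrow> nat \<Rightarrow> nat list list" where
  "scopes L K = List.n_lists L [0..<K]"

definition coordinates :: "nat \<Rightarrow> nat \<Rightarrow> (nat list \<times> nat list \<times> nat) list" where
  "coordinates L K = List.product (scopes L K) (List.product (scopes L K) [0..<K])"

definition adj :: "(nat \<times> nat) list list \<Rightarrow> (nat list \<times> nat list \<times> nat) list \<Rightarrow> nat \<Rightarrow> nat \<Rightarrow> nat \<Rightarrow> bool" where
  "adj opts ds i b j = linked (nth_default [] opts i) b (nth_default ([], [], 0) ds j)"

definition no_inst :: harmless_inst where
  "no_inst = Harmless_Inst 0 [] [] 1"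

text \<open>A coordinate with fewer than \<open>D\<close> neighbours can never have \<open>D\<close>
  of them left out, but the truncated subtraction in its threshold would hide this. Such instances
  are rejected at once.\<close>

definition csp_inst :: "nat \<Rightarrow> nat \<Rightarrow> nat \<Rightarrow> (nat \<times> nat) list list \<Rightarrow> harmless_inst" where
  "csp_inst L K D opts =
    (if \<forall>j \<in> set [0..<length (coordinates L K)].
        D \<le> length (filter (\<lambda>x. adj opts (coordinates L K) (fst x) (snd x) j)
          (List.product [0..<length opts] [0..<D]))
     then gadget_inst (length opts) D (length (coordinates L K)) (length (scopes L K)) (adj opts (coordinates L K))
     else no_inst)"

lemma wf_no_inst: "wf_harmless_inst no_inst"
  by (simp add: wf_harmless_inst_def no_inst_def)

lemma not_yes_no_inst: "\<not> yes_harmless_inst no_inst"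
  by (auto simp: yes_harmless_inst_def no_inst_def harmless_def graph_of_def)

lemma size_no_inst: "spider_modulator_size (graph_of no_inst) = 0"
proof -
  have "verts (graph_of no_inst) = {}" by (simp add: graph_of_def no_inst_def)
  then have "spider_modulator (graph_of no_inst) {}"
    using spider_modulator_verts[OF simple_graph_of[OF wf_no_inst]] by simp
  then show ?thesis
    unfolding spider_modulator_size_def by (intro Least_eq_0 exI[of _ "{}"]) simp
qed

lemma wf_csp_inst: "wf_harmless_inst (csp_inst L K D opts)"
  by (simp add: csp_inst_def gadget.wf_gadget_inst wf_no_inst)

lemma length_scopes: "length (scopes L K) = K ^ L"
  by (simp add: scopes_def length_n_lists)

lemma length_coordinates: "length (coordinates L K) = K ^ L * (K ^ L * K)"
  by (simp add: coordinates_def length_product length_scopes)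

lemma csp_inst_size: "spider_modulator_size (graph_of (csp_inst L K D opts)) \<le> K ^ L * (K ^ L * K)"
  using gadget.modulator_size[of "length opts" D "length (coordinates L K)" "length (scopes L K)" "adj opts (coordinates L K)"]
  by (simp add: csp_inst_def size_no_inst length_coordinates)

lemma set_scopes: "set (scopes L K) = {Q. length Q = L \<and> set Q \<subseteq> {..<K}}"
  by (auto simp: scopes_def set_n_lists)

lemma distinct_scopes: "distinct (scopes L K)"
  by (simp add: scopes_def distinct_n_lists)

text \<open>For \<open>Q \<noteq> Q'\<close>, options giving \<open>v\<close> and \<open>v'\<close>
  to \<open>q\<close> contribute the legs below \<open>v\<close> and those from \<open>v'\<close>
  on, together \<open>v + (D - v')\<close>. Requiring \<open>D\<close> means
  \<open>v' \<le> v\<close>, and the coordinate \<open>(Q', Q, q)\<close> gives the converse. If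
  \<open>q\<close> is missing from one of the tuples, its option contributes all \<open>D\<close>
  legs and nothing is required.\<close>

lemma csp_inst_yes_iff:
  fixes ok :: "(nat \<times> nat) list \<Rightarrow> bool"
  assumes fn: "\<And>al q v v'. ok al \<Longrightarrow> (q, v) \<in> set al \<Longrightarrow> (q, v') \<in> set al \<Longrightarrow> v = v'"
    and L: "L \<ge> 1" and K: "K \<ge> 1" and D: "D \<ge> 2"
  shows "yes_harmless_inst (csp_inst L K D (filter ok (List.n_lists L (List.product [0..<K] [0..<D]))))
    \<longleftrightarrow> (\<exists>z. (\<forall>q<K. z q < D) \<and> (\<forall>Q. length Q = L \<and> set Q \<subseteq> {..<K} \<longrightarrow> ok (map (\<lambda>q. (q, z q)) Q)))"
    (is "yes_harmless_inst (csp_inst L K D ?opts) \<longleftrightarrow> ?sol")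
proof -
  define opts where "opts = ?opts"
  define N where "N = length opts"
  define ds where "ds = coordinates L K"
  define J where "J = length ds"
  define CV where "CV = set (scopes L K)"
  define A where "A = adj opts ds"
  define cl where "cl i = map fst (opts ! i)" for i
  have set_opts: "set opts = {al. length al = L \<and> set al \<subseteq> {..<K} \<times> {..<D} \<and> ok al}"
    by (auto simp: opts_def set_n_lists)
  have opt: "opts ! i \<in> set opts" if "i < N" for i using that by (simp add: N_def)
  have cCV: "card CV = length (scopes L K)" using distinct_card[OF distinct_scopes] by (simp add: CV_def)
  have fCV: "finite CV" by (simp add: CV_def)
  have CVD: "CV = {Q. length Q = L \<and> set Q \<subseteq> {..<K}}" by (simp add: CV_def set_scopes)
  have cl: "cl i \<in> CV" if "i < N" for i using opt[OF that] by (auto simp: set_opts CVD cl_def)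
  have dsset: "set ds = CV \<times> CV \<times> {..<K}" by (auto simp: ds_def coordinates_def CV_def)
  have coord: "\<exists>j < J. ds ! j = (Q, Q', q)" if "Q \<in> CV" "Q' \<in> CV" "q < K" for Q Q' q
    using that dsset by (auto simp: J_def in_set_conv_nth[symmetric])
  have A: "A i b j = linked (opts ! i) b (ds ! j)" if "i < N" "j < J" for i b j
    using that by (simp add: A_def adj_def nth_default_nth N_def J_def)
  \<comment> \<open>The legs below a value and those from it on are all legs, and \<open>ok\<close>
    admits only one value for \<open>q\<close>; so a coordinate with \<open>Q = Q'\<close> is a
    selector.\<close>
  have self: "linked (opts ! i) b (Q, Q, q) \<longleftrightarrow> cl i = Q" if i: "i < N" for i b Q q
  proof
    assume "cl i = Q"
    show "linked (opts ! i) b (Q, Q, q)"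
    proof (cases "\<exists>v. (q, v) \<in> set (opts ! i)")
      case True
      then obtain v where v: "(q, v) \<in> set (opts ! i)" by blast
      have "ok (opts ! i)" using opt[OF i] by (simp add: set_opts)
      then have "snd e = v" if "e \<in> set (opts ! i)" "fst e = q" for e
        using fn[of "opts ! i" q v "snd e"] v that by (cases e) auto
      then show ?thesis using \<open>cl i = Q\<close> unfolding linked_def cl_def by (cases "b < v") (auto simp: not_less)
    next
      case False
      then show ?thesis using \<open>cl i = Q\<close> unfolding linked_def cl_def by force
    qed
  qed (auto simp: linked_def cl_def)
  have sel: "\<exists>j < J. \<forall>i < N. \<forall>b < D. A i b j \<longleftrightarrow> cl i = Q" if Q: "Q \<in> CV" for Q
  proof -
    obtain j where "j < J" "ds ! j = (Q, Q, 0)" using coord[OF Q Q, of 0] K by auto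
    then show ?thesis using A self by auto
  qed
  interpret gadget N D J "length (scopes L K)" A .
  have classes: "gadget_classes N D J (length (scopes L K)) A cl CV" if "\<And>j. j < J \<Longrightarrow> D \<le> cnt j"
    using that sel D fCV cCV cl by unfold_locales auto
  have inst: "csp_inst L K D opts = (if \<forall>j < J. D \<le> cnt j then I else no_inst)"
    unfolding csp_inst_def ds_def[symmetric] J_def[symmetric] N_def[symmetric] A_def[symmetric]
      length_filter_product set_upt atLeast0LessThan Ball_def lessThan_iff ..
  have iff: "yes_harmless_inst (csp_inst L K D opts) \<longleftrightarrow>
      (\<exists>X \<subseteq> {..<N}. card X = card CV \<and> (\<forall>j < J. D \<le> (\<Sum>i \<in> X. u i j)))"
  proof (cases "\<forall>j < J. D \<le> cnt j")
    case True
    then interpret gadget_classes N D J "length (scopes L K)" A cl CV using classes by blast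
    show ?thesis using True yes_iff by (simp add: inst cCV)
  next
    case False
    \<comment> \<open>The legs counted by the sum are neighbours of \<open>j\<close>, so in the
      rejected case no \<open>X\<close> satisfies the condition either.\<close>
    have "D \<le> cnt j" if "X \<subseteq> {..<N}" "D \<le> (\<Sum>i \<in> X. u i j)" for X j
      using cnt_split[OF that(1), of j] that(2) by linarith
    then show ?thesis using False not_yes_no_inst by (auto simp: inst)
  qed
  have dir1: "?sol" if "X \<subseteq> {..<N}" "card X = card CV" and sum: "\<And>j. j < J \<Longrightarrow> D \<le> (\<Sum>i \<in> X. u i j)" for X
  proof -
    have fX: "finite X" using \<open>X \<subseteq> {..<N}\<close> finite_subset by blast
    have X: "i < N" if "i \<in> X" for i using that \<open>X \<subseteq> {..<N}\<close> by blast
    have "\<exists>i \<in> X. cl i = Q" if Q: "Q \<in> CV" for Q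
    proof (rule ccontr)
      assume none: "\<not> (\<exists>i \<in> X. cl i = Q)"
      obtain j where j: "j < J" "\<forall>i < N. \<forall>b < D. A i b j \<longleftrightarrow> cl i = Q" using sel[OF Q] by blast
      have "u i j = 0" if "i \<in> X" for i
      proof -
        have "{b. b < D \<and> A i b j} = {}" using none that j(2) X[OF that] by auto
        then show ?thesis by (simp add: u_def)
      qed
      then show False using sum[OF j(1)] D by simp
    qed
    then have surj: "cl ` X = CV" using cl X by auto
    \<comment> \<open>Every class is hit, and only as many options are switched on as there are
      classes.\<close>
    have inj: "inj_on cl X" using fX surj \<open>card X = card CV\<close> by (intro eq_card_imp_inj_on) auto
    define ix where "ix = the_inv_into X cl"
    have ix: "ix Q \<in> X" "cl (ix Q) = Q" "ix Q < N" if "Q \<in> CV" for Q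
      using the_inv_into_into[OF inj, of Q X] f_the_inv_into_f[OF inj, of Q] that surj X
      by (auto simp: ix_def)
    have le: "v' \<le> v" if Q: "Q \<in> CV" "Q' \<in> CV"
      and v: "(q, v) \<in> set (opts ! ix Q)" "(q, v') \<in> set (opts ! ix Q')" for Q Q' q v v'
    proof (cases "Q = Q'")
      case True
      have "ok (opts ! ix Q)" using opt[OF ix(3)[OF Q(1)]] by (simp add: set_opts)
      then have "v = v'" using fn v True by blast
      then show ?thesis by simp
    next
      case False
      have ok: "ok (opts ! ix Q)" "ok (opts ! ix Q')" and bd: "q < K" "v < D" "v' < D"
        using opt[OF ix(3)[OF Q(1)]] opt[OF ix(3)[OF Q(2)]] v by (auto simp: set_opts)
      obtain j where j: "j < J" "ds ! j = (Q, Q', q)" using coord[OF Q bd(1)] by blast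
      have "u i j = 0" if i: "i \<in> X - {ix Q, ix Q'}" for i
      proof -
        have "cl i \<noteq> Q" "cl i \<noteq> Q'" using i ix[OF Q(1)] ix[OF Q(2)] inj by (auto simp: inj_on_def)
        then have "{b. b < D \<and> A i b j} = {}" using i j X[of i] A[of i j] by (auto simp: linked_def cl_def)
        then show ?thesis by (simp add: u_def)
      qed
      then have "(\<Sum>i \<in> X. u i j) = (\<Sum>i \<in> {ix Q, ix Q'}. u i j)"
        using fX ix(1)[OF Q(1)] ix(1)[OF Q(2)] by (intro sum.mono_neutral_right) auto
      moreover have "ix Q \<noteq> ix Q'" using ix(2)[OF Q(1)] ix(2)[OF Q(2)] False by auto
      ultimately have D1: "D \<le> u (ix Q) j + u (ix Q') j" using sum[OF j(1)] by simp
      have "{b. b < D \<and> A (ix Q) b j} \<subseteq> {..<v}"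
        using A[OF ix(3)[OF Q(1)] j(1)] j(2) ix(2)[OF Q(1)] False v(1) by (fastforce simp: linked_def cl_def)
      then have u1: "u (ix Q) j \<le> v" unfolding u_def using card_mono[of "{..<v}"] by fastforce
      have "{b. b < D \<and> A (ix Q') b j} \<subseteq> {v'..<D}"
        using A[OF ix(3)[OF Q(2)] j(1)] j(2) ix(2)[OF Q(2)] False v(2) by (fastforce simp: linked_def cl_def)
      then have "u (ix Q') j \<le> D - v'" unfolding u_def using card_mono[of "{v'..<D}"] by fastforce
      then show ?thesis using D1 u1 bd by linarith
    qed
    have rep: "replicate L q \<in> CV" if "q < K" for q using that by (auto simp: CVD)
    \<comment> \<open>The value of \<open>q\<close> is read off the option chosen for the constant
      tuple; comparison with it then fixes the value of \<open>q\<close> in every other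
      option.\<close>
    define z where "z q = snd (hd (opts ! ix (replicate L q)))" for q
    have zmem: "(q, z q) \<in> set (opts ! ix (replicate L q))" if q: "q < K" for q
    proof -
      have f: "map fst (opts ! ix (replicate L q)) = replicate L q" using ix(2)[OF rep[OF q]] by (simp add: cl_def)
      then have ne: "opts ! ix (replicate L q) \<noteq> []" using L by auto
      then have "fst (hd (opts ! ix (replicate L q))) = hd (map fst (opts ! ix (replicate L q)))"
        by (simp add: hd_map)
      also have "\<dots> = q" unfolding f using L by simp
      finally have "(q, z q) = hd (opts ! ix (replicate L q))" by (simp add: z_def prod_eq_iff)
      then show ?thesis using ne by simp
    qed
    have zD: "z q < D" if q: "q < K" for q
      using zmem[OF q] opt[OF ix(3)[OF rep[OF q]]] by (auto simp: set_opts)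
    have "ok (map (\<lambda>q. (q, z q)) Q)" if Q: "Q \<in> CV" for Q
    proof -
      have "snd e = z (fst e)" if e: "e \<in> set (opts ! ix Q)" for e
      proof -
        have K': "fst e < K" using e opt[OF ix(3)[OF Q]] by (auto simp: set_opts)
        have e': "(fst e, snd e) \<in> set (opts ! ix Q)" using e by simp
        show ?thesis
          using le[OF Q rep[OF K'] e' zmem[OF K']] le[OF rep[OF K'] Q zmem[OF K'] e'] by simp
      qed
      then have "opts ! ix Q = map (\<lambda>q. (q, z q)) (map fst (opts ! ix Q))"
        by (auto simp: comp_def intro!: map_idI[symmetric] prod_eqI)
      then have "opts ! ix Q = map (\<lambda>q. (q, z q)) Q" using ix(2)[OF Q] by (simp only: cl_def)
      then show ?thesis using opt[OF ix(3)[OF Q]] by (simp add: set_opts)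
    qed
    then show ?thesis using zD by (auto simp: CVD)
  qed
  have dir2: "\<exists>X \<subseteq> {..<N}. card X = card CV \<and> (\<forall>j < J. D \<le> (\<Sum>i \<in> X. u i j))"
    if "\<forall>q<K. z q < D" and z: "\<forall>Q. length Q = L \<and> set Q \<subseteq> {..<K} \<longrightarrow> ok (map (\<lambda>q. (q, z q)) Q)" for z
  proof -
    have "\<exists>i < N. opts ! i = map (\<lambda>q. (q, z q)) Q" if "Q \<in> CV" for Q
    proof -
      have "map (\<lambda>q. (q, z q)) Q \<in> set opts"
        using that z \<open>\<forall>q<K. z q < D\<close> by (auto simp: set_opts CVD)
      then show ?thesis by (simp add: N_def in_set_conv_nth)
    qed
    then obtain ix where ix: "\<And>Q. Q \<in> CV \<Longrightarrow> ix Q < N" "\<And>Q. Q \<in> CV \<Longrightarrow> opts ! ix Q = map (\<lambda>q. (q, z q)) Q"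
      by metis
    have cli: "cl (ix Q) = Q" if "Q \<in> CV" for Q by (simp add: cl_def ix(2)[OF that] comp_def)
    have inj: "inj_on ix CV" by (metis cli inj_on_def)
    have "D \<le> (\<Sum>i \<in> ix ` CV. u i j)" if j: "j < J" for j
    proof -
      obtain Q Q' q where d: "ds ! j = (Q, Q', q)" by (cases "ds ! j")
      then have Q: "Q \<in> CV" "Q' \<in> CV" using dsset j nth_mem[of j ds] by (auto simp: J_def)
      \<comment> \<open>Both options use the same value \<open>z q\<close>, so every
        \<open>b\<close> lies on one of its two sides. Covering by a union treats
        \<open>Q = Q'\<close> and \<open>Q \<noteq> Q'\<close> alike.\<close>
      have "{..<D} \<subseteq> (\<Union>i \<in> ix ` CV. {b. b < D \<and> A i b j})"
      proof
        fix b assume "b \<in> {..<D}"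
        have "linked (opts ! ix Q) b (Q, Q', q) \<or> linked (opts ! ix Q') b (Q, Q', q)"
          unfolding linked_def ix(2)[OF Q(1)] ix(2)[OF Q(2)] by (auto simp: comp_def not_less)
        then have "A (ix Q) b j \<or> A (ix Q') b j" using A[OF ix(1) j] Q d by simp
        then show "b \<in> (\<Union>i \<in> ix ` CV. {b. b < D \<and> A i b j})" using Q \<open>b \<in> {..<D}\<close> by blast
      qed
      then have "card {..<D} \<le> card (\<Union>i \<in> ix ` CV. {b. b < D \<and> A i b j})"
        using fCV by (intro card_mono) auto
      also have "\<dots> \<le> (\<Sum>i \<in> ix ` CV. card {b. b < D \<and> A i b j})"
        using fCV by (intro card_UN_le) auto
      finally show ?thesis by (simp add: u_def)
    qed
    moreover have "ix ` CV \<subseteq> {..<N}" using ix(1) by blast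
    ultimately show ?thesis using card_image[OF inj] by blast
  qed
  have "(\<exists>X \<subseteq> {..<N}. card X = card CV \<and> (\<forall>j < J. D \<le> (\<Sum>i \<in> X. u i j))) \<longleftrightarrow> ?sol"
    using dir1 dir2 by (intro iffI; elim exE conjE) simp_all
  with iff show ?thesis unfolding opts_def by simp
qed

section \<open>Circuits under partial information\<close>

definition labels :: "('a list \<Rightarrow> gate \<Rightarrow> 'a) \<Rightarrow> gate list \<Rightarrow> 'a list" where
  "labels h C = foldl (\<lambda>vs g. vs @ [h vs g]) [] C"

lemma labels_snoc: "labels h (C @ [g]) = labels h C @ [h (labels h C) g]"
  by (simp add: labels_def)

lemma length_labels [simp]: "length (labels h C) = length C"
proof (induction C rule: rev_induct)
  case Nil
  show ?case by (simp add: labels_def)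
next
  case (snoc g C)
  then show ?case by (simp add: labels_snoc)
qed

lemma labels_nth: "i < length C \<Longrightarrow> labels h C ! i = h (take i (labels h C)) (C ! i)"
proof (induction C rule: rev_induct)
  case (snoc g C)
  show ?case
  proof (cases "i < length C")
    case True
    then show ?thesis using snoc.IH by (simp add: labels_snoc nth_append)
  next
    case False
    then have "i = length C" using snoc.prems by simp
    then show ?thesis by (simp add: labels_snoc nth_append)
  qed
qed simp

lemma output_label_eq:
  assumes "C \<noteq> []"
  shows "output_label h C = labels h C ! (length C - 1)"
proof -
  have "length (labels h C) \<noteq> 0" using assms by simp
  then have "labels h C \<noteq> []" by (simp only: length_0_conv not_False_eq_True)
  then show ?thesis unfolding output_label_def labels_def[symmetric] by (simp add: last_conv_nth)
qed

text \<open>The number that \<open>enc_gate\<close> puts in front of a gate.\<close>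

fun tag :: "gate \<Rightarrow> nat" where
  "tag Input = 0" | "tag (Neg _) = 1" | "tag (Conj _) = 2" | "tag (Disj _) = 3"

definition gate_at :: "gate list \<Rightarrow> nat \<Rightarrow> gate" where
  "gate_at C g = nth_default Input C g"

text \<open>\<open>small d\<close> and \<open>weft1 d\<close> characterise depth at most \<open>d\<close> together with weft \<open>0\<close> and at most \<open>1\<close>
  (\<open>small_iff\<close>, \<open>weft1_iff\<close>).\<close>

fun small :: "nat \<Rightarrow> gate list \<Rightarrow> nat \<Rightarrow> bool" where
  "small 0 C g \<longleftrightarrow> preds (gate_at C g) = []"
| "small (Suc d) C g \<longleftrightarrow>
    length (preds (gate_at C g)) \<le> 2 \<and> (\<forall>j \<in> set (preds (gate_at C g)). small d C j)"

fun weft1 :: "nat \<Rightarrow> gate list \<Rightarrow> nat \<Rightarrow> bool" where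
  "weft1 0 C g \<longleftrightarrow> preds (gate_at C g) = []"
| "weft1 (Suc d) C g \<longleftrightarrow> (\<forall>j \<in> set (preds (gate_at C g)).
    if length (preds (gate_at C g)) \<le> 2 then weft1 d C j else small d C j)"

text \<open>\<open>forced d C cs b g\<close>: Kleene evaluation down to depth \<open>d\<close>, starting from the claims \<open>cs\<close>
  about the values of some gates, yields value \<open>b\<close> for gate \<open>g\<close>.\<close>

fun forced :: "nat \<Rightarrow> gate list \<Rightarrow> (nat \<times> bool) list \<Rightarrow> bool \<Rightarrow> nat \<Rightarrow> bool" where
  "forced 0 C cs b g \<longleftrightarrow> (\<exists>e \<in> set cs. fst e = g \<and> (snd e \<longleftrightarrow> b))"
| "forced (Suc d) C cs b g \<longleftrightarrow> (\<exists>e \<in> set cs. fst e = g \<and> (snd e \<longleftrightarrow> b)) \<or>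
    tag (gate_at C g) = 1 \<and> (\<forall>j \<in> set (preds (gate_at C g)). forced d C cs (\<not> b) j) \<or>
    2 \<le> tag (gate_at C g) \<and>
      (if tag (gate_at C g) = 2 \<longleftrightarrow> b
       then \<forall>j \<in> set (preds (gate_at C g)). forced d C cs b j
       else \<exists>j \<in> set (preds (gate_at C g)). forced d C cs b j)"

text \<open>A false claim of this kind is refuted by the values of at most \<open>2 ^ d\<close> inputs.\<close>

definition refutable :: "nat \<Rightarrow> gate list \<Rightarrow> nat \<times> bool \<Rightarrow> bool" where
  "refutable d C e \<longleftrightarrow> small d C (fst e) \<or>
    2 \<le> tag (gate_at C (fst e)) \<and> (tag (gate_at C (fst e)) = 2 \<longleftrightarrow> snd e) \<and>
      (\<forall>j \<in> set (preds (gate_at C (fst e))). small d C j)"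

lemma small_mono: "small d C g \<Longrightarrow> d \<le> d' \<Longrightarrow> small d' C g"
proof (induction d arbitrary: g d')
  case 0 then show ?case by (cases d') auto
next
  case (Suc d) then show ?case by (cases d') auto
qed

lemma forced_claim:
  assumes "(g, b) \<in> set cs"
  shows "forced d C cs b g"
proof -
  have "\<exists>e \<in> set cs. fst e = g \<and> (snd e \<longleftrightarrow> b)" using assms by (intro bexI[of _ "(g, b)"]) simp_all
  then show ?thesis by (cases d) simp_all
qed

text \<open>The induction step shared by monotonicity in the depth and monotonicity in the
  claims.\<close>

lemma forced_step:
  assumes f: "forced (Suc d) C cs b g" and cs: "set cs \<subseteq> set cs'"
    and IH: "\<And>b j. forced d C cs b j \<Longrightarrow> forced d' C cs' b j"
  shows "forced (Suc d') C cs' b g"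
proof -
  let ?t = "tag (gate_at C g)" and ?js = "set (preds (gate_at C g))"
  consider (claim) "\<exists>e \<in> set cs. fst e = g \<and> (snd e \<longleftrightarrow> b)"
    | (neg) "?t = 1" "\<forall>j \<in> ?js. forced d C cs (\<not> b) j"
    | (all) "2 \<le> ?t" "?t = 2 \<longleftrightarrow> b" "\<forall>j \<in> ?js. forced d C cs b j"
    | (ex) "2 \<le> ?t" "\<not> (?t = 2 \<longleftrightarrow> b)" "\<exists>j \<in> ?js. forced d C cs b j"
    using f unfolding forced.simps(2) by presburger
  then show ?thesis
  proof cases
    case claim
    then have "\<exists>e \<in> set cs'. fst e = g \<and> (snd e \<longleftrightarrow> b)" using cs by (meson subsetD)
    then show ?thesis by simp
  next
    case neg
    then have "\<forall>j \<in> ?js. forced d' C cs' (\<not> b) j" using IH by simp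
    then show ?thesis using neg by simp
  next
    case all
    then have "\<forall>j \<in> ?js. forced d' C cs' b j" using IH by simp
    then show ?thesis using all by simp
  next
    case ex
    then have "\<exists>j \<in> ?js. forced d' C cs' b j" using IH by meson
    then show ?thesis using ex by simp
  qed
qed

lemma forced_Suc: "forced d C cs b g \<Longrightarrow> forced (Suc d) C cs b g"
proof (induction d arbitrary: b g)
  case (Suc d)
  show ?case by (rule forced_step[OF Suc.prems subset_refl Suc.IH])
qed simp

lemma forced_mono:
  assumes "set cs \<subseteq> set cs'"
  shows "forced d C cs b g \<Longrightarrow> forced d C cs' b g"
proof (induction d arbitrary: b g)
  case 0
  then show ?case using assms by (auto dest: subsetD)
next
  case (Suc d)
  show ?case by (rule forced_step[OF Suc.prems assms Suc.IH])
qed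

lemma length_concat_map_le: "\<forall>j \<in> set js. length (f j) \<le> m \<Longrightarrow> length (concat (map f js)) \<le> length js * m"
  by (induction js) auto

section \<open>Refuting false claims and certifying the output by true ones\<close>

locale boolean_circuit =
  fixes C :: "gate list"
  assumes circuit: "circuit C"
begin

abbreviation "n \<equiv> length C"

lemma gate_at: "g < n \<Longrightarrow> gate_at C g = C ! g"
  by (simp add: gate_at_def nth_default_nth)

lemma nonempty: "C \<noteq> []" using circuit by (simp add: circuit_def)

lemma pred_less: "g < n \<Longrightarrow> j \<in> set (preds (C ! g)) \<Longrightarrow> j < g"
  using circuit by (auto simp: circuit_def)

lemma pred_less_n: "g < n \<Longrightarrow> j \<in> set (preds (C ! g)) \<Longrightarrow> j < n"
  using pred_less by fastforce

text \<open>Proper fan-in excludes constant gates, so depth and weft never take \<open>Max\<close>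
  over the empty set.\<close>

lemma preds_Nil: "g < n \<Longrightarrow> preds (C ! g) = [] \<longleftrightarrow> C ! g = Input"
  using circuit unfolding circuit_def by (cases "C ! g") fastforce+

definition dep where "dep = labels gate_depth C"
definition wef where "wef = labels gate_weft C"

lemma take_image: "g < n \<Longrightarrow> (!) (take g (labels h C)) ` set (preds (C ! g)) = (!) (labels h C) ` set (preds (C ! g))"
  using pred_less by (intro image_cong) auto

lemma dep_eq: "g < n \<Longrightarrow> dep ! g = (if C ! g = Input then 0 else Suc (Max ((!) dep ` set (preds (C ! g)))))"
  using labels_nth[of g C gate_depth] by (simp add: dep_def gate_depth_def take_image)

lemma wef_eq: "g < n \<Longrightarrow> wef ! g = (if C ! g = Input then 0
    else Max ((!) wef ` set (preds (C ! g))) + (if length (preds (C ! g)) > 2 then 1 else 0))"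
  using labels_nth[of g C gate_weft] by (simp add: wef_def gate_weft_def take_image)

lemma Max_preds_le: 
  assumes "g < n" "C ! g \<noteq> Input"
  shows "Max (f ` set (preds (C ! g))) \<le> m \<longleftrightarrow> (\<forall>j \<in> set (preds (C ! g)). f j \<le> (m::nat))"
  using assms preds_Nil by (subst Max_le_iff) auto

lemma small_iff: "g < n \<Longrightarrow> small d C g \<longleftrightarrow> dep ! g \<le> d \<and> wef ! g = 0"
proof (induction d arbitrary: g)
  case 0
  then show ?case using preds_Nil by (simp add: gate_at dep_eq wef_eq)
next
  case (Suc d)
  have "small d C j \<longleftrightarrow> dep ! j \<le> d \<and> wef ! j \<le> 0" if "j \<in> set (preds (C ! g))" for j
    using Suc.IH pred_less_n[OF Suc.prems that] by simp
  then show ?case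
    using Suc.prems Max_preds_le[OF Suc.prems, of "(!) dep" d] Max_preds_le[OF Suc.prems, of "(!) wef" 0]
    by (auto simp: gate_at dep_eq[of g] wef_eq[of g])
qed

lemma weft1_iff: "g < n \<Longrightarrow> weft1 d C g \<longleftrightarrow> dep ! g \<le> d \<and> wef ! g \<le> 1"
proof (induction d arbitrary: g)
  case 0
  then show ?case using preds_Nil by (simp add: gate_at dep_eq wef_eq)
next
  case (Suc d)
  have "small d C j \<longleftrightarrow> dep ! j \<le> d \<and> wef ! j \<le> 0" "weft1 d C j \<longleftrightarrow> dep ! j \<le> d \<and> wef ! j \<le> 1"
    if "j \<in> set (preds (C ! g))" for j
    using Suc.IH small_iff pred_less_n[OF Suc.prems that] by simp_all
  then show ?case
    using Suc.prems Max_preds_le[OF Suc.prems, of "(!) dep" d]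
      Max_preds_le[OF Suc.prems, of "(!) wef" 0] Max_preds_le[OF Suc.prems, of "(!) wef" 1]
    by (auto simp: gate_at dep_eq[of g] wef_eq[of g])
qed

lemma weft1_output: "weft1 d C (n - 1) \<longleftrightarrow> weft C \<le> 1 \<and> depth C \<le> d"
  using weft1_iff[of "n - 1" d] nonempty
  by (auto simp: weft_def depth_def output_label_eq dep_def wef_def)

context
  fixes A :: "nat set"
begin

definition val where "val g = labels (gate_value A) C ! g"

lemma val_eq: "g < n \<Longrightarrow> val g = (case C ! g of Input \<Rightarrow> g \<in> A | Neg j \<Rightarrow> \<not> val j
    | Conj js \<Rightarrow> \<forall>j \<in> set js. val j | Disj js \<Rightarrow> \<exists>j \<in> set js. val j)"
  using labels_nth[of g C "gate_value A"] pred_less[of g]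
  by (auto simp: val_def split: gate.splits)

lemma satisfies_iff: "satisfies A C \<longleftrightarrow> val (n - 1)"
  by (simp add: satisfies_def output_label_eq[OF nonempty] val_def)

lemma forced_sound:
  assumes "\<forall>e \<in> set cs. val (fst e) = snd e"
  shows "g < n \<Longrightarrow> forced d C cs b g \<Longrightarrow> val g = b"
proof (induction d arbitrary: b g)
  case 0
  then show ?case using assms by auto
next
  case (Suc d)
  have IH: "forced d C cs b j \<Longrightarrow> val j = b" if "j \<in> set (preds (C ! g))" for b j
    using Suc.IH pred_less_n[OF Suc.prems(1) that] by blast
  show ?case
    using Suc.prems(2) assms IH val_eq[OF Suc.prems(1)]
    by (cases "C ! g") (auto simp: gate_at[OF Suc.prems(1)] split: if_splits)
qed

lemma forced_from_preds:
  assumes "g < n" "C ! g \<noteq> Input" "\<And>j. j \<in> set (preds (C ! g)) \<Longrightarrow> forced d C cs (val j) j"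
  shows "forced (Suc d) C cs (val g) g"
proof -
  have *: "j \<in> set (preds (C ! g)) \<Longrightarrow> val j \<Longrightarrow> forced d C cs True j"
    "j \<in> set (preds (C ! g)) \<Longrightarrow> \<not> val j \<Longrightarrow> forced d C cs False j" for j
    using assms(3)[of j] by simp_all
  show ?thesis
    using * assms(2) val_eq[OF assms(1)]
    by (cases "C ! g"; cases "val g") (auto simp: gate_at[OF assms(1)])
qed

text \<open>Unfolding gates of fan-in at most 2 to depth \<open>d\<close> meets at most
  \<open>2 ^ d\<close> inputs, and their values settle the evaluation. The claims \<open>cs\<close>
  are quantified after \<open>xs\<close>, so that \<open>xs\<close> can be used to choose the
  positions that reveal these inputs.\<close>

lemma small_forced:
  "g < n \<Longrightarrow> small d C g \<Longrightarrow> \<exists>xs. length xs \<le> 2 ^ d \<and> set xs \<subseteq> inputs C \<and>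
    (\<forall>cs. (\<forall>x \<in> set xs. (x, x \<in> A) \<in> set cs) \<longrightarrow> forced d C cs (val g) g)"
proof (induction d arbitrary: g)
  case 0
  then have "C ! g = Input" using preds_Nil by (simp add: gate_at)
  then show ?case using 0 val_eq[of g]
    by (intro exI[of _ "[g]"]) (force simp: inputs_def)
next
  case (Suc d)
  show ?case
  proof (cases "C ! g = Input")
    case True
    then have "val g = (g \<in> A)" using val_eq[OF Suc.prems(1)] by simp
    then show ?thesis using Suc.prems(1) True forced_claim[of g "val g" _ "Suc d" C]
      by (intro exI[of _ "[g]"]) (simp add: inputs_def del: forced.simps)
  next
    case False
    let ?js = "preds (C ! g)"
    have len: "length ?js \<le> 2" using Suc.prems by (simp add: gate_at)
    have "\<forall>j \<in> set ?js. \<exists>xs. length xs \<le> 2 ^ d \<and> set xs \<subseteq> inputs C \<and>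
      (\<forall>cs. (\<forall>x \<in> set xs. (x, x \<in> A) \<in> set cs) \<longrightarrow> forced d C cs (val j) j)"
      using Suc pred_less_n by (simp add: gate_at)
    then obtain f where f: "\<forall>j \<in> set ?js. length (f j) \<le> 2 ^ d \<and> set (f j) \<subseteq> inputs C \<and>
      (\<forall>cs. (\<forall>x \<in> set (f j). (x, x \<in> A) \<in> set cs) \<longrightarrow> forced d C cs (val j) j)"
      by metis
    have "length (concat (map f ?js)) \<le> length ?js * 2 ^ d"
      using f by (intro length_concat_map_le) auto
    also have "\<dots> \<le> 2 ^ Suc d" using len by simp
    finally have "length (concat (map f ?js)) \<le> 2 ^ Suc d" .
    moreover have "forced (Suc d) C cs (val g) g" if "\<forall>x \<in> set (concat (map f ?js)). (x, x \<in> A) \<in> set cs" for cs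
      using that f by (intro forced_from_preds Suc.prems False) auto
    ultimately show ?thesis using f by (intro exI[of _ "concat (map f ?js)"]) (auto simp del: forced.simps)
  qed
qed

text \<open>A conjunction falsely claimed true, or a disjunction falsely claimed false, has a
  predecessor with the opposite value. That predecessor is small, so few inputs expose it, and one
  more evaluation step refutes the claim.\<close>

lemma refutable_refuted:
  assumes e: "refutable d C e" "fst e < n" "val (fst e) \<noteq> snd e"
  shows "\<exists>xs. length xs \<le> 2 ^ d \<and> set xs \<subseteq> inputs C \<and>
    (\<forall>cs. (\<forall>x \<in> set xs. (x, x \<in> A) \<in> set cs) \<longrightarrow> forced (Suc d) C cs (\<not> snd e) (fst e))"
proof (cases "small d C (fst e)")
  case True
  have v: "val (fst e) = (\<not> snd e)" using e(3) by blast
  show ?thesis using small_forced[OF e(2) True] unfolding v using forced_Suc by blast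
next
  case False
  then have l: "2 \<le> tag (C ! fst e)" "tag (C ! fst e) = 2 \<longleftrightarrow> snd e" "\<forall>j \<in> set (preds (C ! fst e)). small d C j"
    using e by (auto simp: refutable_def gate_at)
  then have "\<exists>j \<in> set (preds (C ! fst e)). val j = (\<not> snd e)"
    using val_eq[OF e(2)] e(3) by (cases "C ! fst e") auto
  then obtain j where j: "j \<in> set (preds (C ! fst e))" "val j = (\<not> snd e)" by blast
  have "forced (Suc d) C cs (\<not> snd e) (fst e)" if "forced d C cs (\<not> snd e) j" for cs
    using l j that by (auto simp: gate_at[OF e(2)])
  then show ?thesis
    using small_forced[OF pred_less_n[OF e(2) j(1)], of d] l(3) j(1) unfolding j(2) by blast
qed

text \<open>Descending from \<open>g\<close>, a gate of fan-in at most 2 passes the task to its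
  predecessors, which at most doubles the number of claims; a large gate ends the descent with a
  single claim. \<open>D\<close> stays fixed while \<open>d\<close> decreases.\<close>

lemma claims_complete:
  "g < n \<Longrightarrow> weft1 d C g \<Longrightarrow> d \<le> D \<Longrightarrow> \<exists>cs. cs \<noteq> [] \<and> length cs \<le> 2 ^ d \<and>
    (\<forall>e \<in> set cs. fst e < n \<and> val (fst e) = snd e \<and> refutable D C e) \<and> forced d C cs (val g) g"
proof (induction d arbitrary: g)
  case 0
  then have "small D C g" using small_mono[of 0] by simp
  then show ?case using 0 by (intro exI[of _ "[(g, val g)]"]) (auto simp: refutable_def)
next
  case (Suc d)
  let ?js = "preds (C ! g)"
  consider "C ! g = Input" | "C ! g \<noteq> Input" "length ?js \<le> 2" | "2 < length ?js" by linarith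
  then show ?case
  proof cases
    case 1
    then have "small D C g" using small_mono[of 0] Suc.prems(1) by (simp add: gate_at)
    then show ?thesis using Suc.prems(1)
      by (intro exI[of _ "[(g, val g)]"]) (auto simp: refutable_def)
  next
    case 2
    have "\<forall>j \<in> set ?js. \<exists>cs. cs \<noteq> [] \<and> length cs \<le> 2 ^ d \<and>
      (\<forall>e \<in> set cs. fst e < n \<and> val (fst e) = snd e \<and> refutable D C e) \<and> forced d C cs (val j) j"
      using Suc 2 pred_less_n by (simp add: gate_at)
    then obtain f where f: "\<forall>j \<in> set ?js. f j \<noteq> [] \<and> length (f j) \<le> 2 ^ d \<and>
      (\<forall>e \<in> set (f j). fst e < n \<and> val (fst e) = snd e \<and> refutable D C e) \<and> forced d C (f j) (val j) j"
      by metis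
    have "length (concat (map f ?js)) \<le> length ?js * 2 ^ d"
      using f by (intro length_concat_map_le) auto
    also have "\<dots> \<le> 2 ^ Suc d" using 2(2) by simp
    finally have "length (concat (map f ?js)) \<le> 2 ^ Suc d" .
    moreover have "forced (Suc d) C (concat (map f ?js)) (val g) g"
    proof (intro forced_from_preds Suc.prems 2(1))
      fix j assume j: "j \<in> set ?js"
      have "set (f j) \<subseteq> set (concat (map f ?js))" using j by auto
      then show "forced d C (concat (map f ?js)) (val j) j"
        by (rule forced_mono) (use f j in blast)
    qed
    moreover have "concat (map f ?js) \<noteq> []"
      using f 2(1) preds_Nil[OF Suc.prems(1)] by (cases ?js) auto
    ultimately show ?thesis using f by (intro exI[of _ "concat (map f ?js)"]) (auto simp del: forced.simps)
  next
    case 3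
    then have sm: "\<forall>j \<in> set ?js. small d C j" using Suc.prems by (auto simp: gate_at)
    have smD: "\<forall>j \<in> set ?js. small D C j" using sm small_mono[of d C _ D] Suc.prems(3) by auto
    have t: "2 \<le> tag (C ! g)" using 3 by (cases "C ! g") auto
    show ?thesis
    proof (cases "tag (C ! g) = 2 \<longleftrightarrow> val g")
      case True
      then show ?thesis using t smD Suc.prems(1)
        by (intro exI[of _ "[(g, val g)]"]) (auto simp: refutable_def gate_at)
    next
      case False
      \<comment> \<open>The value of \<open>g\<close> is now witnessed by a single predecessor;
        claiming that small gate instead keeps the claim refutable.\<close>
      then have "\<exists>j \<in> set ?js. val j = val g"
        using val_eq[OF Suc.prems(1)] t by (cases "C ! g") auto
      then obtain j where j: "j \<in> set ?js" "val j = val g" by blast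
      have "forced d C [(j, val g)] (val g) j" by (rule forced_claim) simp
      then have "forced (Suc d) C [(j, val g)] (val g) g"
        using False t j(1) by (auto simp: gate_at[OF Suc.prems(1)])
      then show ?thesis using j smD pred_less_n[OF Suc.prems(1) j(1)]
        by (intro exI[of _ "[(j, val g)]"]) (auto simp: refutable_def simp del: forced.simps)
    qed
  qed
qed

end

end

section \<open>Guesses and local tests\<close>

definition claims :: "gate list \<Rightarrow> (nat \<times> bool) list" where
  "claims C = List.product [0..<length C] [True, False]"

text \<open>Shorter lists of claims are padded by repetition to the length \<open>2 ^ d\<close>. As
  this is constant, there are polynomially many guesses, and the value of one variable can select
  among them.\<close>

definition guesses :: "nat \<Rightarrow> gate list \<Rightarrow> (nat \<times> bool) list list" where
  "guesses d C = filter (\<lambda>cs. (\<forall>e \<in> set cs. refutable d C e) \<and> forced d C cs True (length C - Suc 0))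
    (List.n_lists (2 ^ d) (claims C))"

text \<open>The true inputs \<open>a\<^sub>1 - 1 < \<dots> < a\<^sub>k - 1\<close> are the values of the positions \<open>1, \<dots>, k\<close>, between
  the sentinels \<open>a\<^sub>0 = 0\<close> and \<open>a\<^sub>k\<^sub>+\<^sub>1 = length C + 1\<close>. So two consecutive values \<open>a\<^sub>q < a\<^sub>q\<^sub>+\<^sub>1\<close> also
  tell which inputs are false: those in the gap.\<close>

definition known :: "nat \<Rightarrow> gate list \<Rightarrow> (nat \<times> nat) list \<Rightarrow> (nat \<times> bool) list" where
  "known k C al = filter (\<lambda>e. tag (gate_at C (fst e)) = 0 \<and>
     (if snd e then \<exists>p \<in> set al. Suc 0 \<le> fst p \<and> fst p \<le> k \<and> snd p = Suc (fst e)
      else \<exists>p \<in> set al. \<exists>p' \<in> set al. fst p' = Suc (fst p) \<and> fst p \<le> k \<and>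
        snd p < Suc (fst e) \<and> Suc (fst e) < snd p'))
    (claims C)"

text \<open>Position \<open>k + 2\<close> selects one of the guesses \<open>Gs\<close>. A partial assignment of the positions is okay
  if it does not refute any claim of the guess.\<close>

definition okay :: "nat \<Rightarrow> nat \<Rightarrow> gate list \<Rightarrow> (nat \<times> bool) list list \<Rightarrow> (nat \<times> nat) list \<Rightarrow> bool" where
  "okay d k C Gs al \<longleftrightarrow>
    (\<forall>p \<in> set al. \<forall>p' \<in> set al.
       (fst p = fst p' \<longrightarrow> snd p = snd p') \<and>
       (fst p' = Suc (fst p) \<and> fst p \<le> k \<longrightarrow> snd p < snd p')) \<and>
    (\<forall>p \<in> set al.
       (fst p = 0 \<longrightarrow> snd p = 0) \<and>
       (fst p = Suc k \<longrightarrow> snd p = Suc (length C)) \<and>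
       (Suc 0 \<le> fst p \<and> fst p \<le> k \<longrightarrow>
         Suc 0 \<le> snd p \<and> snd p \<le> length C \<and> tag (gate_at C (snd p - Suc 0)) = 0) \<and>
       (fst p = Suc (Suc k) \<longrightarrow> snd p < length Gs \<and>
         (\<forall>e \<in> set (nth_default [] Gs (snd p)). \<not> forced (Suc d) C (known k C al) (\<not> snd e) (fst e))))"

lemma okay_functional: "okay d k C Gs al \<Longrightarrow> (q, v) \<in> set al \<Longrightarrow> (q, v') \<in> set al \<Longrightarrow> v = v'"
  unfolding okay_def by fastforce

lemma chain_less:
  fixes z :: "nat \<Rightarrow> nat"
  assumes "\<And>q. q \<le> k \<Longrightarrow> z q < z (Suc q)"
  shows "a < b \<Longrightarrow> b \<le> Suc k \<Longrightarrow> z a < z b"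
proof (induction b)
  case (Suc b)
  show ?case
  proof (cases "a = b")
    case False
    then have "z a < z b" using Suc by simp
    also have "z b < z (Suc b)" using Suc by (intro assms) simp
    finally show ?thesis .
  qed (use Suc assms in simp)
qed simp

text \<open>Used with \<open>P q\<close> as \<open>z q \<le> Suc x\<close> to locate an input
  \<open>x\<close> between two consecutive positions.\<close>

lemma first_failure: "P (0::nat) \<Longrightarrow> \<not> P (Suc k) \<Longrightarrow> \<exists>q \<le> k. P q \<and> \<not> P (Suc q)"
  by (induction k) (auto, metis le_Suc_eq)

lemma set_map_graph: "p \<in> set (map (\<lambda>q. (q, z q)) Q) \<longleftrightarrow> fst p \<in> set Q \<and> snd p = z (fst p)"
  by (cases p) auto

context boolean_circuit
begin

lemma tag_0: "g < n \<Longrightarrow> tag (gate_at C g) = 0 \<longleftrightarrow> C ! g = Input"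
  by (cases "C ! g") (auto simp: gate_at)

text \<open>True entries agree with \<open>A\<close> by its definition. For false ones,
  \<open>z\<close> is increasing and therefore takes no value strictly between \<open>z q\<close>
  and \<open>z (Suc q)\<close>.\<close>

lemma known_correct:
  assumes z: "\<And>q. q \<le> k \<Longrightarrow> z q < z (Suc q)"
    and A: "A = {x. \<exists>q \<ge> 1. q \<le> k \<and> z q = Suc x}"
    and e: "e \<in> set (known k C (map (\<lambda>q. (q, z q)) Q))"
  shows "val A (fst e) = snd e"
proof -
  have e': "fst e < n" "C ! fst e = Input" using e tag_0 by (auto simp: known_def claims_def)
  have "fst e \<in> A \<longleftrightarrow> snd e"
  proof (cases "snd e")
    case True
    then show ?thesis using e by (auto simp: known_def set_map_graph A simp del: set_map)
  next
    case False
    then obtain q where q: "q \<le> k" "z q < Suc (fst e)" "Suc (fst e) < z (Suc q)"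
      using e by (auto simp: known_def set_map_graph simp del: set_map)
    have "z r \<noteq> Suc (fst e)" if "r \<le> k" for r
    proof (cases "r \<le> q")
      case True
      then have "z r \<le> z q" using chain_less[of k z r q, OF z] q by (cases "r = q") auto
      then show ?thesis using q by simp
    next
      case False
      then have "z (Suc q) \<le> z r" using chain_less[of k z "Suc q" r, OF z] that by (cases "r = Suc q") auto
      then show ?thesis using q by simp
    qed
    then show ?thesis using False by (auto simp: A)
  qed
  then show ?thesis using val_eq[OF e'(1), of A] e'(2) by simp
qed

lemma set_claims: "(g, b) \<in> set (claims C) \<longleftrightarrow> g < n"
  by (auto simp: claims_def)

text \<open>Knowledge extracted from a correct enumeration is correct, so it never refutes a true
  claim. Conversely, a false claim would be refuted by at most \<open>2 ^ d\<close> inputs, and some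
  tuple contains the position of the guess together with the positions revealing all of them; its
  test would fail. So all claims of the guess are true, and they force the output.\<close>

lemma assignment_iff:
  assumes weft: "weft1 d C (n - 1)"
  defines "Gs \<equiv> guesses d C"
  shows "(\<exists>z. (\<forall>q < k + 3. z q < n + 2 + length Gs) \<and>
      (\<forall>Q. length Q = 2 * 2 ^ d + 1 \<and> set Q \<subseteq> {..<k + 3} \<longrightarrow> okay d k C Gs (map (\<lambda>q. (q, z q)) Q)))
    \<longleftrightarrow> (\<exists>A \<subseteq> inputs C. card A = k \<and> satisfies A C)"
proof
  assume "\<exists>A \<subseteq> inputs C. card A = k \<and> satisfies A C"
  then obtain A where A: "A \<subseteq> inputs C" "card A = k" "satisfies A C" by blast
  have fA: "finite A" using A(1) finite_subset[of A "{..<n}"] by (auto simp: inputs_def)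
  define xs where "xs = sorted_list_of_set A"
  have xs: "set xs = A" "length xs = k" "sorted_wrt (<) xs"
    using fA A(2) by (auto simp: xs_def)
  obtain cs where cs: "cs \<noteq> []" "length cs \<le> 2 ^ d"
    "\<forall>e \<in> set cs. fst e < n \<and> val A (fst e) = snd e \<and> refutable d C e" "forced d C cs True (n - 1)"
    using claims_complete[of "n - 1" d d A] weft nonempty A(3) satisfies_iff[of A] by auto
  \<comment> \<open>Guesses have length exactly \<open>2 ^ d\<close>; repeating \<open>hd cs\<close>
    leaves the set of claims unchanged.\<close>
  define cs' where "cs' = cs @ replicate (2 ^ d - length cs) (hd cs)"
  have cs': "set cs' = set cs" "length cs' = 2 ^ d" using cs(1,2) by (auto simp: cs'_def)
  have "forced d C cs' True (n - 1)" using forced_mono[OF _ cs(4)] cs'(1) by simp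
  then have "cs' \<in> set Gs"
    using cs(3) cs' by (auto simp: Gs_def guesses_def set_n_lists claims_def)
  then obtain i where i: "i < length Gs" "Gs ! i = cs'" by (auto simp: in_set_conv_nth)
  define z where "z q = (if q = 0 then 0 else if q \<le> k then Suc (xs ! (q - 1)) else if q = Suc k then Suc n else i)" for q
  have nthA: "xs ! j \<in> A" if "j < k" for j using that xs by (metis nth_mem)
  have inn: "x < n" "C ! x = Input" if "x \<in> A" for x using that A(1) by (auto simp: inputs_def)
  have zless: "z q < z (Suc q)" if "q \<le> k" for q
  proof -
    consider "q = 0" | "q \<noteq> 0" "Suc q \<le> k" | "q \<noteq> 0" "q = k" using \<open>q \<le> k\<close> by linarith
    then show ?thesis
    proof cases
      case 2
      then have "xs ! (q - 1) < xs ! q" using xs by (intro sorted_wrt_nth_less[of "(<)"]) auto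
      then show ?thesis using 2 by (simp add: z_def)
    next
      case 3
      then show ?thesis using inn(1)[OF nthA[of "q - 1"]] by (simp add: z_def)
    qed (simp add: z_def)
  qed
  have Aq: "A = {x. \<exists>q \<ge> 1. q \<le> k \<and> z q = Suc x}"
  proof (intro set_eqI iffI)
    fix x assume "x \<in> A"
    then obtain j where "j < k" "xs ! j = x" using xs by (metis in_set_conv_nth)
    then show "x \<in> {x. \<exists>q \<ge> 1. q \<le> k \<and> z q = Suc x}"
      by (intro CollectI exI[of _ "Suc j"]) (simp add: z_def)
  qed (auto simp: z_def intro!: nthA)
  have "okay d k C Gs (map (\<lambda>q. (q, z q)) Q)" for Q
    unfolding okay_def
  proof (intro conjI ballI impI)
    fix p p' assume p: "p \<in> set (map (\<lambda>q. (q, z q)) Q)" "p' \<in> set (map (\<lambda>q. (q, z q)) Q)"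
    show "snd p = snd p'" if "fst p = fst p'" using p that by auto
    show "snd p < snd p'" if "fst p' = Suc (fst p) \<and> fst p \<le> k" using p that zless[of "fst p"] by auto
  next
    fix p assume p: "p \<in> set (map (\<lambda>q. (q, z q)) Q)"
    then have zp: "snd p = z (fst p)" by auto
    show "snd p = 0" if "fst p = 0" using zp that by (simp add: z_def)
    show "snd p = Suc n" if "fst p = Suc k" using zp that by (simp add: z_def)
    show "Suc 0 \<le> snd p" if "Suc 0 \<le> fst p \<and> fst p \<le> k" using zp that by (simp add: z_def)
    show "snd p \<le> n" if "Suc 0 \<le> fst p \<and> fst p \<le> k"
      using zp that inn(1)[OF nthA[of "fst p - 1"]] by (cases "fst p") (simp_all add: z_def Suc_le_eq)
    show "tag (gate_at C (snd p - Suc 0)) = 0" if "Suc 0 \<le> fst p \<and> fst p \<le> k"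
      using zp that inn[OF nthA[of "fst p - 1"]] by (cases "fst p") (simp_all add: z_def gate_at Suc_le_eq)
    assume last: "fst p = Suc (Suc k)"
    then show "snd p < length Gs" using zp i by (simp add: z_def)
    fix e assume "e \<in> set (nth_default [] Gs (snd p))"
    then have e: "e \<in> set cs" using zp last i cs'(1) by (simp add: z_def nth_default_nth)
    show "\<not> forced (Suc d) C (known k C (map (\<lambda>q. (q, z q)) Q)) (\<not> snd e) (fst e)"
    proof
      assume f: "forced (Suc d) C (known k C (map (\<lambda>q. (q, z q)) Q)) (\<not> snd e) (fst e)"
      have "val A (fst e) = (\<not> snd e)"
        using known_correct[OF zless Aq] cs(3) e by (intro forced_sound[OF _ _ f]) auto
      then show False using cs(3) e by blast
    qed
  qed
  moreover have "z q < n + 2 + length Gs" if "q < k + 3" for q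
  proof -
    consider "q = 0" | "q \<noteq> 0" "q \<le> k" | "q = Suc k" | "q = Suc (Suc k)" using \<open>q < k + 3\<close> by linarith
    then show ?thesis
    proof cases
      case 2
      then have "xs ! (q - 1) < n" by (intro inn(1) nthA) simp
      then show ?thesis using 2 by (simp add: z_def)
    qed (use i in \<open>auto simp: z_def\<close>)
  qed
  ultimately show "\<exists>z. (\<forall>q < k + 3. z q < n + 2 + length Gs) \<and>
      (\<forall>Q. length Q = 2 * 2 ^ d + 1 \<and> set Q \<subseteq> {..<k + 3} \<longrightarrow> okay d k C Gs (map (\<lambda>q. (q, z q)) Q))"
    by blast
next
  let ?L = "2 * 2 ^ d + 1 :: nat"
  assume "\<exists>z. (\<forall>q < k + 3. z q < n + 2 + length Gs) \<and>
      (\<forall>Q. length Q = 2 * 2 ^ d + 1 \<and> set Q \<subseteq> {..<k + 3} \<longrightarrow> okay d k C Gs (map (\<lambda>q. (q, z q)) Q))"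
  then obtain z where
    ok': "\<And>Q. length Q = ?L \<Longrightarrow> set Q \<subseteq> {..<k + 3} \<Longrightarrow> okay d k C Gs (map (\<lambda>q. (q, z q)) Q)" by blast
  \<comment> \<open>Tests exist for tuples of full length only. Repeating the first variable pads a
    shorter one without adding variables.\<close>
  have ok: "\<exists>Q'. set Q' = set Q \<and> okay d k C Gs (map (\<lambda>q. (q, z q)) Q')"
    if "Q \<noteq> []" "length Q \<le> ?L" "set Q \<subseteq> {..<k + 3}" for Q
  proof -
    let ?Q = "Q @ replicate (?L - length Q) (hd Q)"
    have "set ?Q = set Q" using that(1) by auto
    then show ?thesis using that ok'[of ?Q] by (intro exI[of _ ?Q]) simp
  qed
  have ok1: "\<exists>Q'. q \<in> set Q' \<and> okay d k C Gs (map (\<lambda>q. (q, z q)) Q')" if "q < k + 3" for q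
    using ok[of "[q]"] that by fastforce
  have L: "2 \<le> ?L" by (simp add: Suc_leI)
  have zless: "z q < z (Suc q)" if "q \<le> k" for q
    using ok[of "[q, Suc q]"] that L unfolding okay_def by fastforce
  have z0: "z 0 = 0" using ok1[of 0] unfolding okay_def by fastforce
  have zk: "z (Suc k) = Suc n" using ok1[of "Suc k"] unfolding okay_def by fastforce
  have zin: "Suc 0 \<le> z q \<and> z q \<le> n \<and> tag (gate_at C (z q - Suc 0)) = 0" if "Suc 0 \<le> q" "q \<le> k" for q
    using ok1[of q] that unfolding okay_def by fastforce
  have zg: "z (Suc (Suc k)) < length Gs" using ok1[of "Suc (Suc k)"] unfolding okay_def by fastforce
  define cs where "cs = Gs ! z (Suc (Suc k))"
  have "cs \<in> set Gs" using zg by (simp add: cs_def)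
  then have cs: "\<forall>e \<in> set cs. fst e < n \<and> refutable d C e" "forced d C cs True (n - 1)"
    by (auto simp: Gs_def guesses_def set_n_lists claims_def)
  define A where "A = {x. \<exists>q \<ge> 1. q \<le> k \<and> z q = Suc x}"
  have A: "A = (\<lambda>q. z q - 1) ` {1..k}"
    using zin by (force simp: A_def image_iff)
  have inj: "inj_on (\<lambda>q. z q - 1) {1..k}"
  proof (rule linorder_inj_onI)
    fix a b assume "a < b" "a \<in> {1..k}" "b \<in> {1..k}"
    then show "z a - 1 \<noteq> z b - 1" using chain_less[of k z a b, OF zless] zin[of a] zin[of b] by auto
  qed auto
  have cardA: "card A = k" using card_image[OF inj] by (simp add: A)
  have Ain: "A \<subseteq> inputs C"
  proof
    fix x assume "x \<in> A"
    then obtain q where "1 \<le> q" "q \<le> k" "z q = Suc x" by (auto simp: A_def)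
    then show "x \<in> inputs C" using zin[of q] tag_0[of x] by (simp add: inputs_def)
  qed
  have "val A (fst e) = snd e" if e: "e \<in> set cs" for e
  proof (rule ccontr)
    assume "val A (fst e) \<noteq> snd e"
    then obtain xs where xs: "length xs \<le> 2 ^ d" "set xs \<subseteq> inputs C"
      "\<And>ks. \<forall>x \<in> set xs. (x, x \<in> A) \<in> set ks \<Longrightarrow> forced (Suc d) C ks (\<not> snd e) (fst e)"
      using refutable_refuted[of d e A] cs(1) e by blast
    \<comment> \<open>The sentinels \<open>0\<close> and \<open>Suc n\<close> enclose every
      \<open>Suc x\<close>, so the search succeeds even if \<open>x\<close> lies before the first or
      after the last true input.\<close>
    have "\<exists>q \<le> k. z q \<le> Suc x \<and> \<not> z (Suc q) \<le> Suc x" if "x \<in> set xs" for x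
      using that xs(2) z0 zk by (intro first_failure) (auto simp: inputs_def)
    then obtain pos where pos: "\<And>x. x \<in> set xs \<Longrightarrow> pos x \<le> k \<and> z (pos x) \<le> Suc x \<and> Suc x < z (Suc (pos x))"
      by (metis not_le)
    \<comment> \<open>One entry for the guess and two for each of at most \<open>2 ^ d\<close>
      inputs: this is where the arity comes from.\<close>
    define Q where "Q = Suc (Suc k) # concat (map (\<lambda>x. [pos x, Suc (pos x)]) xs)"
    have "length Q \<le> ?L" using xs(1) length_concat_map_le[of xs "\<lambda>x. [pos x, Suc (pos x)]" 2] by (simp add: Q_def)
    moreover have "set Q \<subseteq> {..<k + 3}" using pos by (fastforce simp: Q_def)
    ultimately obtain Q' where Q': "set Q' = set Q" "okay d k C Gs (map (\<lambda>q. (q, z q)) Q')"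
      using ok[of Q] by (auto simp: Q_def)
    have "(x, x \<in> A) \<in> set (known k C (map (\<lambda>q. (q, z q)) Q'))" if x: "x \<in> set xs" for x
    proof -
      have x': "x < n" "C ! x = Input" using x xs(2) by (auto simp: inputs_def)
      have mem: "pos x \<in> set Q'" "Suc (pos x) \<in> set Q'" using x by (auto simp: Q' Q_def)
      show ?thesis
      proof (cases "z (pos x) = Suc x")
        case True
        then have "pos x \<noteq> 0" using z0 by (metis nat.distinct(1))
        then have "x \<in> A" unfolding A_def using True pos[OF x] by (intro CollectI exI[of _ "pos x"]) simp
        then show ?thesis using True x' mem pos[OF x] \<open>pos x \<noteq> 0\<close> tag_0[OF x'(1)]
          by (auto simp: known_def set_claims intro!: bexI[of _ "pos x"])
      next
        case False
        then have lt: "z (pos x) < Suc x" using pos[OF x] by simp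
        have "\<exists>p \<in> set (map (\<lambda>q. (q, z q)) Q'). \<exists>p' \<in> set (map (\<lambda>q. (q, z q)) Q').
            fst p' = Suc (fst p) \<and> fst p \<le> k \<and> snd p < Suc x \<and> Suc x < snd p'"
          using lt mem pos[OF x]
          by (intro bexI[of _ "(pos x, z (pos x))"] bexI[of _ "(Suc (pos x), z (Suc (pos x)))"]) auto
        then have m: "(x, False) \<in> set (known k C (map (\<lambda>q. (q, z q)) Q'))"
          using x' tag_0[OF x'(1)] by (simp add: known_def set_claims)
        have "x \<notin> A" using known_correct[OF zless A_def m] val_eq[OF x'(1), of A] x'(2) by simp
        with m show ?thesis by simp
      qed
    qed
    then have "forced (Suc d) C (known k C (map (\<lambda>q. (q, z q)) Q')) (\<not> snd e) (fst e)" using xs(3) by blast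
    moreover have "(Suc (Suc k), z (Suc (Suc k))) \<in> set (map (\<lambda>q. (q, z q)) Q')" by (simp add: Q' Q_def)
    ultimately show False
      using Q'(2) e zg unfolding okay_def cs_def by (fastforce simp: nth_default_nth)
  qed
  then have "val A (n - 1)" using forced_sound[of cs A "n - 1" d True] cs(2) nonempty by auto
  then show "\<exists>A \<subseteq> inputs C. card A = k \<and> satisfies A C"
    using Ain cardA satisfies_iff[of A] by (intro exI[of _ A]) simp
qed

end

section \<open>The reduction\<close>

lemma polytime_tag [polytime_intros]: "polytime f \<Longrightarrow> polytime (\<lambda>x. tag (f x))"
proof (rule polytime_comp[of tag], rule polytime_left)
  show "enc (tag g) = left (enc g)" for g by (cases g) (simp_all add: enc_gate_def enc_nat_def)
qed

lemma polytime_preds [polytime_intros]: assumes "polytime f" shows "polytime (\<lambda>x. preds (f x))"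
proof (rule polytime_comp[OF _ assms])
  have r: "polytime (\<lambda>g :: gate. right (enc g))" by (rule polytime_right) simp
  \<comment> \<open>After the tag comes a single number for \<open>Neg\<close>, and otherwise a
    list, empty for \<open>Input\<close>. Both branches are typed as lists of trees, which are
    encoded like the intended lists of numbers.\<close>
  have "polytime (\<lambda>g. if tag g = 1 then [right (enc g)] else spine (right (enc g)))"
    by (intro polytime_intros r)
  then show "polytime preds"
  proof (rule polytime_coerce)
    show "enc (preds g) = enc (if tag g = 1 then [right (enc g)] else spine (right (enc g)))" for g
      by (cases g) (simp_all add: enc_gate_def enc_nat_def enc_list_def enc_spine[unfolded enc_list_def])
  qed
qed

lemma polytime_gate_at [polytime_intros]: "polytime f \<Longrightarrow> polytime g \<Longrightarrow> polytime (\<lambda>x. gate_at (f x) (g x))"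
  unfolding gate_at_def by (intro polytime_intros)

text \<open>The recursion depth \<open>d\<close> is a constant, so the recursion is unrolled into a
  loop-bounded program by induction on \<open>d\<close>; the same holds for \<open>weft1\<close> and
  \<open>forced\<close>.\<close>

lemma polytime_small: "polytime (\<lambda>p. small d (fst p) (snd p))"
proof (induction d)
  case 0
  show ?case unfolding small.simps by (intro polytime_intros)
next
  case (Suc d)
  show ?case unfolding small.simps by (intro polytime_intros polytime_app2[of "small d", OF Suc])
qed

lemma polytime_weft1: "polytime (\<lambda>p. weft1 d (fst p) (snd p))"
proof (induction d)
  case 0
  show ?case unfolding weft1.simps by (intro polytime_intros)
next
  case (Suc d)
  show ?case unfolding weft1.simps
    by (intro polytime_intros polytime_app2[of "weft1 d", OF Suc] polytime_app2[of "small d", OF polytime_small])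
qed

lemma polytime_forced: "polytime (\<lambda>p. forced d (fst p) (fst (snd p)) (fst (snd (snd p))) (snd (snd (snd p))))"
proof (induction d)
  case 0
  show ?case unfolding forced.simps by (intro polytime_intros)
next
  case (Suc d)
  show ?case unfolding forced.simps by (intro polytime_intros polytime_app4[of "forced d", OF Suc])
qed

lemmas polytime_small' [polytime_intros] = polytime_app2[of "small d" for d, OF polytime_small]
lemmas polytime_weft1' [polytime_intros] = polytime_app2[of "weft1 d" for d, OF polytime_weft1]
lemmas polytime_forced' [polytime_intros] = polytime_app4[of "forced d" for d, OF polytime_forced]

lemma polytime_refutable [polytime_intros]:
  assumes "polytime f" "polytime g" shows "polytime (\<lambda>x. refutable d (f x) (g x))"
proof (rule polytime_app2[OF _ assms])
  show "polytime (\<lambda>p. refutable d (fst p) (snd p))" unfolding refutable_def by (intro polytime_intros)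
qed

lemma polytime_claims [polytime_intros]: "polytime f \<Longrightarrow> polytime (\<lambda>x. claims (f x))"
  unfolding claims_def by (intro polytime_intros)

lemma polytime_guesses [polytime_intros]: "polytime f \<Longrightarrow> polytime (\<lambda>x. guesses d (f x))"
proof (rule polytime_comp[of "guesses d"])
  show "polytime (guesses d)" unfolding guesses_def[abs_def] by (intro polytime_intros)
qed

lemma polytime_known [polytime_intros]:
  assumes "polytime k" "polytime C" "polytime al" shows "polytime (\<lambda>x. known (k x) (C x) (al x))"
proof (rule polytime_app3[OF _ assms])
  show "polytime (\<lambda>p. known (fst p) (fst (snd p)) (snd (snd p)))"
    unfolding known_def by (intro polytime_intros)
qed

lemma polytime_okay [polytime_intros]:
  assumes "polytime k" "polytime C" "polytime Gs" "polytime al" shows "polytime (\<lambda>x. okay d (k x) (C x) (Gs x) (al x))"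
proof (rule polytime_app4[OF _ assms])
  show "polytime (\<lambda>p. okay d (fst p) (fst (snd p)) (fst (snd (snd p))) (snd (snd (snd p))))"
    unfolding okay_def by (intro polytime_intros)
qed

lemma polytime_circuit [polytime_intros]: assumes "polytime f" shows "polytime (\<lambda>x. circuit (f x))"
proof (rule polytime_comp[OF _ assms])
  have "distinct xs \<longleftrightarrow> (\<forall>a \<in> set [0..<length xs]. \<forall>b \<in> set [0..<length xs].
      a \<noteq> b \<longrightarrow> nth_default 0 xs a \<noteq> nth_default (0::nat) xs b)" for xs
    by (auto simp: distinct_conv_nth nth_default_nth)
  moreover have "proper_fanin g \<longleftrightarrow> (2 \<le> tag g \<longrightarrow> 2 \<le> length (preds g))" for g
    by (cases g) auto
  \<comment> \<open>Restated with tags, total list access and quantifiers over lists of positions,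
    for all of which there are closure rules.\<close>
  ultimately have eq: "circuit C \<longleftrightarrow> C \<noteq> [] \<and> (\<forall>i \<in> set [0..<length C].
      (\<forall>j \<in> set (preds (gate_at C i)). j < i) \<and>
      (\<forall>a \<in> set [0..<length (preds (gate_at C i))]. \<forall>b \<in> set [0..<length (preds (gate_at C i))].
        a \<noteq> b \<longrightarrow> nth_default 0 (preds (gate_at C i)) a \<noteq> nth_default 0 (preds (gate_at C i)) b) \<and>
      (2 \<le> tag (gate_at C i) \<longrightarrow> 2 \<le> length (preds (gate_at C i))))" for C
    unfolding circuit_def by (simp only:) (auto simp: gate_at_def nth_default_nth)
  show "polytime circuit" unfolding eq[abs_def] by (intro polytime_intros)
qed

lemma polytime_linked [polytime_intros]:
  assumes "polytime al" "polytime b" "polytime d" shows "polytime (\<lambda>x. linked (al x) (b x) (d x))"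
proof (rule polytime_app3[OF _ assms])
  show "polytime (\<lambda>p. linked (fst p) (fst (snd p)) (snd (snd p)))"
    unfolding linked_def by (intro polytime_intros)
qed

lemma polytime_scopes [polytime_intros]: "polytime K \<Longrightarrow> polytime (\<lambda>x. scopes L (K x))"
  unfolding scopes_def by (intro polytime_intros)

lemma polytime_coordinates [polytime_intros]: "polytime K \<Longrightarrow> polytime (\<lambda>x. coordinates L (K x))"
  unfolding coordinates_def by (intro polytime_intros)

lemma polytime_adj [polytime_intros]:
  "polytime opts \<Longrightarrow> polytime ds \<Longrightarrow> polytime i \<Longrightarrow> polytime b \<Longrightarrow> polytime j \<Longrightarrow> polytime (\<lambda>x. adj (opts x) (ds x) (i x) (b x) (j x))"
  unfolding adj_def by (intro polytime_intros)

text \<open>The adjacency relation is a function and has no encoding, so the rule is stated for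
  relations that \<open>adj\<close> computes from two lists.\<close>

lemma polytime_gadget_inst [polytime_intros]:
  assumes "polytime N" "polytime p" "polytime J" "polytime V" "polytime opts" "polytime ds"
  shows "polytime (\<lambda>x. gadget_inst (N x) (p x) (J x) (V x) (adj (opts x) (ds x)))"
proof -
  let ?N = "fst" and ?p = "\<lambda>x. fst (snd x)" and ?J = "\<lambda>x. fst (snd (snd x))"
    and ?V = "\<lambda>x. fst (snd (snd (snd x)))" and ?o = "\<lambda>x. fst (snd (snd (snd (snd x))))"
    and ?d = "\<lambda>x. snd (snd (snd (snd (snd x))))"
  have "polytime (\<lambda>x. gadget_inst (?N x) (?p x) (?J x) (?V x) (adj (?o x) (?d x)))"
    unfolding gadget_inst_def by (intro polytime_intros)
  from polytime_comp[OF this polytime_Pair[OF assms(1) polytime_Pair[OF assms(2) polytime_Pair[OF assms(3)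
    polytime_Pair[OF assms(4) polytime_Pair[OF assms(5,6)]]]]]]
  show ?thesis by simp
qed

lemma polytime_csp_inst [polytime_intros]:
  assumes "polytime K" "polytime D" "polytime opts" shows "polytime (\<lambda>x. csp_inst L (K x) (D x) (opts x))"
proof (rule polytime_app3[OF _ assms])
  show "polytime (\<lambda>p. csp_inst L (fst p) (fst (snd p)) (snd (snd p)))"
    unfolding csp_inst_def by (intro polytime_intros)
qed

text \<open>The \<open>k + 3\<close> variables are the positions \<open>0, ..., k + 1\<close> and
  the guess. The domain has to contain both the position values \<open>0, ..., length C + 1\<close>
  and the indices of all guesses; its summand 2 also gives every star at least two legs.\<close>

definition circuit_csp :: "nat \<Rightarrow> gate list \<times> nat \<Rightarrow> harmless_inst" where
  "circuit_csp d x = csp_inst (2 * 2 ^ d + 1) (snd x + 3) (length (fst x) + 2 + length (guesses d (fst x)))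
    (filter (okay d (snd x) (fst x) (guesses d (fst x)))
      (List.n_lists (2 * 2 ^ d + 1)
        (List.product [0..<snd x + 3] [0..<length (fst x) + 2 + length (guesses d (fst x))])))"

definition reduce :: "nat \<Rightarrow> gate list \<times> nat \<Rightarrow> harmless_inst" where
  "reduce d x = (if circuit (fst x) \<and> weft1 d (fst x) (length (fst x) - Suc 0) then circuit_csp d x else no_inst)"

lemma polytime_reduce: "polytime (reduce d)"
proof -
  have f: "polytime (\<lambda>x. filter (\<lambda>al. okay d (snd x) (fst x) (guesses d (fst x)) al)
      (List.n_lists (2 * 2 ^ d + 1)
        (List.product [0..<snd x + 3] [0..<length (fst x) + 2 + length (guesses d (fst x))])))"
    by (intro polytime_intros)
  have c: "polytime (circuit_csp d)"
    unfolding circuit_csp_def[abs_def] by (intro polytime_csp_inst f) (intro polytime_intros)+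
  show ?thesis
    unfolding reduce_def[abs_def] by (rule polytime_if[OF _ c polytime_const]) (intro polytime_intros)
qed

section \<open>Correctness of the reduction\<close>

lemma wf_reduce: "wf_harmless_inst (reduce d x)"
  by (simp add: reduce_def circuit_csp_def wf_csp_inst wf_no_inst)

lemma size_reduce:
  "spider_modulator_size (graph_of (reduce d x)) \<le>
    (snd x + 3) ^ (2 * 2 ^ d + 1) * ((snd x + 3) ^ (2 * 2 ^ d + 1) * (snd x + 3))"
proof (cases "circuit (fst x) \<and> weft1 d (fst x) (length (fst x) - Suc 0)")
  case True
  then have "reduce d x = circuit_csp d x" by (simp add: reduce_def)
  then show ?thesis by (simp only: circuit_csp_def csp_inst_size)
next
  case False
  then have "reduce d x = no_inst" unfolding reduce_def by (rule if_not_P)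
  then show ?thesis by (simp only: size_no_inst le0)
qed

lemma yes_reduce:
  "yes_harmless_inst (reduce d (C, k)) \<longleftrightarrow>
    circuit C \<and> weft C \<le> 1 \<and> depth C \<le> d \<and> (\<exists>A \<subseteq> inputs C. card A = k \<and> satisfies A C)"
proof (cases "circuit C")
  case True
  then interpret boolean_circuit C by unfold_locales
  have w: "weft1 d C (length C - Suc 0) \<longleftrightarrow> weft C \<le> 1 \<and> depth C \<le> d"
    using weft1_output[of d] by simp
  show ?thesis
  proof (cases "weft1 d C (length C - Suc 0)")
    case w1: True
    have "yes_harmless_inst (circuit_csp d (C, k)) \<longleftrightarrow>
      (\<exists>z. (\<forall>q < k + 3. z q < length C + 2 + length (guesses d C)) \<and>
      (\<forall>Q. length Q = 2 * 2 ^ d + 1 \<and> set Q \<subseteq> {..<k + 3} \<longrightarrow>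
        okay d k C (guesses d C) (map (\<lambda>q. (q, z q)) Q)))"
      unfolding circuit_csp_def fst_conv snd_conv
      by (intro csp_inst_yes_iff okay_functional[of d k C "guesses d C"]) auto
    also have "\<dots> \<longleftrightarrow> (\<exists>A \<subseteq> inputs C. card A = k \<and> satisfies A C)"
      using assignment_iff[of d k] w1 by simp
    finally show ?thesis using True w w1 by (simp add: reduce_def)
  next
    case False
    then have "reduce d (C, k) = no_inst" by (simp add: reduce_def)
    then show ?thesis using False w not_yes_no_inst by metis
  qed
qed (simp add: reduce_def not_yes_no_inst)

lemma inj_enc_circuit: "inj (enc :: gate list \<times> nat \<Rightarrow> tree)"
  unfolding enc_circuit_inst by (rule inj_enc_circuit_inst)

lemma mem_problem: "x \<in> fst (problem valid e yes par) \<longleftrightarrow> (\<exists>i. valid i \<and> yes i \<and> x = e i)"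
  by (auto simp: problem_def)

lemma par_problem:
  assumes "inj e"
  shows "valid i \<Longrightarrow> snd (problem valid e yes par) (e i) = par i"
    "\<not> valid i \<Longrightarrow> snd (problem valid e yes par) (e i) = 0"
proof -
  show "snd (problem valid e yes par) (e i) = par i" if "valid i"
    using that the_inv_into_f_f[OF inj_on_subset[OF assms subset_UNIV], of i "{i. valid i}"]
    by (simp add: problem_def)
  show "snd (problem valid e yes par) (e i) = 0" if "\<not> valid i"
    using that inj_eq[OF assms] by (auto simp: problem_def)
qed

theorem theorem2:
  shows "W_hard 1 harmless_set_by_spider_modulator"
  unfolding W_hard_def
proof
  fix P assume "P \<in> W_class 1"
  then obtain d where red: "P \<le>\<^sub>f\<^sub>p\<^sub>t weighted_circuit_sat 1 d" unfolding W_class_def by blast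
  define Q where "Q = weighted_circuit_sat 1 d"
  define H where "H = harmless_set_by_spider_modulator"
  \<comment> \<open>Trees that encode no instance have parameter 0; they go to
    \<open>no_inst\<close>, whose empty graph has modulator size 0.\<close>
  define R where "R x = (if is_circuit_inst x then enc (reduce d (inv enc x)) else enc no_inst)" for x
  \<comment> \<open>The number of coordinates for \<open>k + 3\<close> variables and tuples of
    length \<open>2 * 2 ^ d + 1\<close>, which does not involve the circuit.\<close>
  define g where "g k = (k + 3) ^ (2 * 2 ^ d + 1) * ((k + 3) ^ (2 * 2 ^ d + 1) * (k + 3))" for k :: nat
  have e: "enc_harmless_inst = enc" by (simp add: enc_harmless_inst_def)
  have injH: "inj (enc :: harmless_inst \<Rightarrow> tree)" using inj_enc_harmless_inst by (simp add: e)
  have memH: "enc i \<in> fst H \<longleftrightarrow> wf_harmless_inst i \<and> yes_harmless_inst i" for i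
    unfolding H_def harmless_set_by_spider_modulator_def e mem_problem using inj_eq[OF injH] by auto
  have parH: "snd H (enc i) = spider_modulator_size (graph_of i)" if "wf_harmless_inst i" for i
    unfolding H_def harmless_set_by_spider_modulator_def e using par_problem(1)[OF injH] that by blast
  have parQ: "snd Q (enc (C, k)) = (if circuit C \<and> weft C \<le> 1 \<and> depth C \<le> d then k else 0)" for C k
    unfolding Q_def weighted_circuit_sat_def enc_circuit_inst[symmetric]
    using par_problem[OF inj_enc_circuit, of _ "(C, k)"] by simp
  have memQ: "x \<in> fst Q \<longleftrightarrow> (\<exists>C k. x = enc (C, k) \<and> yes_harmless_inst (reduce d (C, k)))" for x
    unfolding Q_def weighted_circuit_sat_def enc_circuit_inst[symmetric] mem_problem yes_reduce by auto
  have R_enc: "R (enc y) = enc (reduce d y)" for y :: "gate list \<times> nat"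
    using inv_f_f[OF inj_enc_circuit, of y] is_circuit_inst_iff[of "enc y"] by (simp add: R_def)
  show "P \<le>\<^sub>f\<^sub>p\<^sub>t harmless_set_by_spider_modulator"
    unfolding H_def[symmetric]
  proof (rule fpt_reducible_poly_trans[OF red[folded Q_def]])
    show "polytime R" unfolding R_def[abs_def] by (rule polytime_decode[OF polytime_reduce polytime_is_circuit_inst is_circuit_inst_iff])
    show "polytime g" unfolding g_def[abs_def] by (intro polytime_intros)
    show "mono g" unfolding g_def by (intro monoI mult_le_mono power_mono) auto
    fix x
    show "x \<in> fst Q \<longleftrightarrow> R x \<in> fst H"
    proof (cases "is_circuit_inst x")
      case True
      then obtain C k where x: "x = enc (C :: gate list, k :: nat)" unfolding is_circuit_inst_iff by auto
      have "x \<in> fst Q \<longleftrightarrow> yes_harmless_inst (reduce d (C, k))"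
        unfolding memQ x using inj_eq[OF inj_enc_circuit] by fastforce
      then show ?thesis using R_enc[of "(C, k)"] memH wf_reduce x by simp
    next
      case False
      then have "x \<notin> fst Q" unfolding is_circuit_inst_iff memQ by blast
      then show ?thesis using False memH not_yes_no_inst by (simp add: R_def)
    qed
    show "snd H (R x) \<le> g (snd Q x)"
    proof (cases "is_circuit_inst x")
      case True
      then obtain C k where x: "x = enc (C :: gate list, k :: nat)" unfolding is_circuit_inst_iff by auto
      have "spider_modulator_size (graph_of (reduce d (C, k))) \<le> g (snd Q x)"
      proof (cases "circuit C \<and> weft C \<le> 1 \<and> depth C \<le> d")
        case True
        then show ?thesis using size_reduce[of d "(C, k)"] parQ[of C k] by (simp add: x g_def)
      next
        \<comment> \<open>Codes of improper circuits, or of circuits of too large weft or depth,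
          also have parameter 0, so their image must have modulator size at most \<open>g 0\<close>;
          \<open>no_inst\<close> has size 0.\<close>
        case False
        then have "reduce d (C, k) = no_inst"
          using boolean_circuit.weft1_output[of C d] by (auto simp: reduce_def boolean_circuit_def)
        then show ?thesis by (simp add: size_no_inst)
      qed
      then show ?thesis using R_enc[of "(C, k)"] parH[OF wf_reduce] x by simp
    next
      case False
      then show ?thesis using parH[OF wf_no_inst] size_no_inst by (simp add: R_def)
    qed
  qed
qed

end
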